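(* For every $u\in\mathscr S'(\mathbb R^d)$, $$WF'(u)=WF_G(u).$$
   Context: Notation: $\langle z\rangle=(1+|z|^2)^{1/2}$; $(\cdot,\cdot)$ is the action of $\mathscr S'$ (tempered distributions) on the Schwartz space $\mathscr S$, conjugate linear in the second argument and consistent with the $L^2$ inner product. For $z=(x,\xi)\in\mathbb R^{2d}$, $\Pi(z)=M_\xi T_x$ with $T_xf(y)=f(y-x)$, $M_\xi f(y)=e^{i\langle y,\xi\rangle}f(y)$. For $\varphi\in\mathscr S(\mathbb R^d)\setminus\{0\}$ and $u\in\mathscr S'(\mathbb R^d)$, the short-time Fourier transform is $V_\varphi u(z)=(u,\Pi(z)\varphi)$, $z\in\mathbb R^{2d}$. A set is conic if it is invariant under multiplication by all positive reals. $WF'(u)$: let $\varphi\in\mathscr S(\mathbb R^d)\setminus\{0\}$; a point $z_0\in\mathbb R^{2d}\setminus\{0\}$ satisfies $z_0\notin WF'(u)$ if there is an open conic set $\Gamma\subseteq\mathbb R^{2d}\setminus\{0\}$ containing $z_0$ with $\sup_{z\in\Gamma}\langle z\rangle^N|V_\varphi u(z)|<\infty$ for all $N\ge0$. (This set does not depend on the choice of $\varphi$.) $WF_G(u)$ (Gabor wave front set): let $\varphi\in\mathscr S(\mathbb R^d)\setminus\{0\}$ and $\Lambda=\alpha\mathbb Z^d\times\beta\mathbb Z^d$ with $\alpha,\beta>0$ sufficiently small that $\{\Pi(\lambda)\varphi\}_{\lambda\in\Lambda}$ is a Gabor frame for $L^2(\mathbb R^d)$, i.e. there are $A,B>0$ with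 $A\|f\|_{L^2}^2\le\sum_{\lambda\in\Lambda}|(f,\Pi(\lambda)\varphi)|^2\le B\|f\|_{L^2}^2$ for all $f\in L^2(\mathbb R^d)$. A point $z_0\in\mathbb R^{2d}\setminus\{0\}$ satisfies $z_0\notin WF_G(u)$ if there is an open conic set $\Gamma\subseteq\mathbb R^{2d}\setminus\{0\}$ containing $z_0$ with $\sup_{\lambda\in\Lambda\cap\Gamma}\langle\lambda\rangle^N|V_\varphi u(\lambda)|<\infty$ for all $N\ge0$. The identity is asserted for any such choice of $(\varphi,\Lambda)$. *)

theory Defs
  imports "HOL-Analysis.Analysis"
begin

definition jbracket :: "'a::real_normed_vector \<Rightarrow> real"
  where "jbracket z = sqrt (1 + (norm z)\<^sup>2)"

definition partial_deriv :: "'d::finite \<Rightarrow> (real ^ 'd \<Rightarrow> complex) \<Rightarrow> real ^ 'd \<Rightarrow> complex"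
  where "partial_deriv i f x = frechet_derivative f (at x) (axis i 1)"

text \<open>A list of coordinate directions plays the role of a multi-index. The order of the entries
  is immaterial for smooth functions.\<close>

definition partial_derivs :: "'d::finite list \<Rightarrow> (real ^ 'd \<Rightarrow> complex) \<Rightarrow> real ^ 'd \<Rightarrow> complex"
  where "partial_derivs is f = foldr partial_deriv is f"

text \<open>All iterated partial derivatives exist and are Frechet differentiable everywhere; in
  particular they are all continuous, so this is infinite differentiability.\<close>

definition smooth :: "(real ^ 'd::finite \<Rightarrow> complex) \<Rightarrow> bool"
  where "smooth f \<longleftrightarrow> (\<forall>is. partial_derivs is f differentiable_on UNIV)"

definition schwartz :: "(real ^ 'd::finite \<Rightarrow> complex) set"
  where "schwartz = {f. smooth f \<and>
    (\<forall>N::nat. \<forall>is. bdd_above (range (\<lambda>x. jbracket x ^ N * norm (partial_derivs is f x))))}"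

definition schwartz_seminorm :: "nat \<Rightarrow> 'd::finite list \<Rightarrow> (real ^ 'd \<Rightarrow> complex) \<Rightarrow> real"
  where "schwartz_seminorm N is f = (SUP x. jbracket x ^ N * norm (partial_derivs is f x))"

definition schwartz_topology :: "(real ^ 'd::finite \<Rightarrow> complex) topology"
  where "schwartz_topology = topology_generated_by
    {{g \<in> schwartz. schwartz_seminorm N is (\<lambda>x. g x - f x) < e} | N is f e.
      f \<in> schwartz \<and> 0 < e}"

text \<open>A tempered distribution is identified with its action on Schwartz functions, which by
  convention is conjugate linear, in accordance with the inner product \<open>l2_inner\<close> below.
  Its values outside \<open>schwartz\<close> are irrelevant.\<close>

definition tempered_distributions :: "((real ^ 'd::finite \<Rightarrow> complex) \<Rightarrow> complex) set"
  where "tempered_distributions = {u.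
    (\<forall>f\<in>schwartz. \<forall>g\<in>schwartz. u (\<lambda>x. f x + g x) = u f + u g) \<and>
    (\<forall>c. \<forall>f\<in>schwartz. u (\<lambda>x. c * f x) = cnj c * u f) \<and>
    continuous_map schwartz_topology euclidean u}"

definition translation :: "real ^ 'd::finite \<Rightarrow> (real ^ 'd \<Rightarrow> complex) \<Rightarrow> real ^ 'd \<Rightarrow> complex"
  where "translation x f y = f (y - x)"

definition modulation :: "real ^ 'd::finite \<Rightarrow> (real ^ 'd \<Rightarrow> complex) \<Rightarrow> real ^ 'd \<Rightarrow> complex"
  where "modulation \<xi> f y = exp (\<i> * complex_of_real (y \<bullet> \<xi>)) * f y"

text \<open>Phase space is the product type \<open>(real ^ 'd) \<times> (real ^ 'd)\<close>, whose norm and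
  topology are the Euclidean ones of dimension 2d.\<close>

definition tf_shift ::
    "(real ^ 'd::finite) \<times> (real ^ 'd) \<Rightarrow> (real ^ 'd \<Rightarrow> complex) \<Rightarrow> real ^ 'd \<Rightarrow> complex"
  where "tf_shift z f = modulation (snd z) (translation (fst z) f)"

definition stft ::
    "(real ^ 'd::finite \<Rightarrow> complex) \<Rightarrow> ((real ^ 'd \<Rightarrow> complex) \<Rightarrow> complex) \<Rightarrow>
      (real ^ 'd) \<times> (real ^ 'd) \<Rightarrow> complex"
  where "stft \<phi> u z = u (tf_shift z \<phi>)"

definition l2_functions :: "(real ^ 'd::finite \<Rightarrow> complex) set"
  where "l2_functions =
    {f \<in> borel_measurable lebesgue. integrable lebesgue (\<lambda>y. (norm (f y))\<^sup>2)}"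

definition l2_inner :: "(real ^ 'd::finite \<Rightarrow> complex) \<Rightarrow> (real ^ 'd \<Rightarrow> complex) \<Rightarrow> complex"
  where "l2_inner f g = (\<integral>y. f y * cnj (g y) \<partial>lebesgue)"

definition l2_norm :: "(real ^ 'd::finite \<Rightarrow> complex) \<Rightarrow> real"
  where "l2_norm f = sqrt (\<integral>y. (norm (f y))\<^sup>2 \<partial>lebesgue)"

definition tf_lattice :: "real \<Rightarrow> real \<Rightarrow> ((real ^ 'd::finite) \<times> (real ^ 'd)) set"
  where "tf_lattice \<alpha> \<beta> =
    {(\<alpha> *\<^sub>R k, \<beta> *\<^sub>R l) | k l. (\<forall>i. k $ i \<in> \<int>) \<and> (\<forall>i. l $ i \<in> \<int>)}"

text \<open>Summability is required explicitly because \<open>infsum\<close> is 0 for divergent sums.\<close>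

definition gabor_frame ::
    "(real ^ 'd::finite \<Rightarrow> complex) \<Rightarrow> ((real ^ 'd) \<times> (real ^ 'd)) set \<Rightarrow> bool"
  where "gabor_frame \<phi> \<Lambda> \<longleftrightarrow> (\<exists>A>0. \<exists>B>0. \<forall>f\<in>l2_functions.
    (\<lambda>z. (norm (l2_inner f (tf_shift z \<phi>)))\<^sup>2) summable_on \<Lambda> \<and>
    A * (l2_norm f)\<^sup>2 \<le> (\<Sum>\<^sub>\<infinity>z\<in>\<Lambda>. (norm (l2_inner f (tf_shift z \<phi>)))\<^sup>2) \<and>
    (\<Sum>\<^sub>\<infinity>z\<in>\<Lambda>. (norm (l2_inner f (tf_shift z \<phi>)))\<^sup>2) \<le> B * (l2_norm f)\<^sup>2)"

text \<open>Unlike the library's \<open>cone\<close>, a conic set need not contain 0.\<close>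

definition conic_set :: "'a::real_vector set \<Rightarrow> bool"
  where "conic_set \<Gamma> \<longleftrightarrow> (\<forall>z\<in>\<Gamma>. \<forall>t>0. t *\<^sub>R z \<in> \<Gamma>)"

text \<open>Both wave front sets carry the window \<open>\<phi>\<close> used to compute them as a parameter, the second
  one also the lattice.\<close>

definition WF' ::
    "(real ^ 'd::finite \<Rightarrow> complex) \<Rightarrow> ((real ^ 'd \<Rightarrow> complex) \<Rightarrow> complex) \<Rightarrow>
      ((real ^ 'd) \<times> (real ^ 'd)) set"
  where "WF' \<phi> u = {z0. z0 \<noteq> 0 \<and>
    \<not> (\<exists>\<Gamma>. open \<Gamma> \<and> conic_set \<Gamma> \<and> \<Gamma> \<subseteq> - {0} \<and> z0 \<in> \<Gamma> \<and>
        (\<forall>N::real. N \<ge> 0 \<longrightarrow>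
          bdd_above ((\<lambda>z. jbracket z powr N * norm (stft \<phi> u z)) ` \<Gamma>)))}"

definition WF_G ::
    "(real ^ 'd::finite \<Rightarrow> complex) \<Rightarrow> ((real ^ 'd) \<times> (real ^ 'd)) set \<Rightarrow>
      ((real ^ 'd \<Rightarrow> complex) \<Rightarrow> complex) \<Rightarrow> ((real ^ 'd) \<times> (real ^ 'd)) set"
  where "WF_G \<phi> \<Lambda> u = {z0. z0 \<noteq> 0 \<and>
    \<not> (\<exists>\<Gamma>. open \<Gamma> \<and> conic_set \<Gamma> \<and> \<Gamma> \<subseteq> - {0} \<and> z0 \<in> \<Gamma> \<and>
        (\<forall>N::real. N \<ge> 0 \<longrightarrow>
          bdd_above ((\<lambda>z. jbracket z powr N * norm (stft \<phi> u z)) ` (\<Lambda> \<inter> \<Gamma>))))}"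

end

theory Submission
  imports Defs
begin

text \<open>
  The usual proof expands in the canonical dual window, which is a Schwartz function by spectral
  invariance. That theorem is avoided as follows. Let \<open>C\<close> be the analysis operator of the frame,
  \<open>G = C C*\<close> its Gram matrix and \<open>S = C* C\<close> the frame operator, with bounds \<open>A \<le> S \<le> B\<close>. The
  iterates \<open>(1 - S/B)^k f\<close> tend to 0 geometrically in L2, and their coefficients are
  \<open>(1 - G/B)^k C f\<close>. The matrix \<open>1 - G/B\<close> is an l2 contraction with rapid off-diagonal decay, so
  its commutator with the weight \<open>(1 + |\<lambda> - z|)^N\<close> is bounded by the weight of order \<open>N - 1\<close>, and
  the weighted l2 norms of the coefficients grow only polynomially in \<open>k\<close>. Interpolating between
  the two facts, the Neumann series yields \<open>\<Pi>(z)\<psi> = \<Sum> c(\<lambda>) \<Pi>(\<lambda>)\<phi>\<close> in the Schwartz space with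
  \<open>|c(\<lambda>)| \<le> C(N) (1 + |\<lambda> - z|)^(-N)\<close> uniformly in \<open>z\<close>. Applying \<open>u\<close> carries rapid decay of
  \<open>V_\<phi> u\<close> on the lattice points of a cone over to \<open>V_\<psi> u\<close> on a smaller cone.

  For the converse, \<open>\<psi>\<close> also satisfies frame inequalities for some fine lattice, and the same
  argument with \<open>\<phi>\<close> and \<open>\<psi>\<close> exchanged bounds \<open>V_\<phi> u\<close> by \<open>V_\<psi> u\<close>. Throughout, the frame
  inequalities are needed for Schwartz functions only.
\<close>

text \<open>The commutator is forced: the Schur test bounds \<open>1 - G/B\<close> on weighted l2
  only by a constant that may exceed 1, and iterating it would give exponential growth that can
  defeat the geometric gain. The iteration runs both on functions and on coefficients because a
  redundant frame makes \<open>G\<close> singular, so that \<open>1 - G/B\<close> is no strict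
  contraction on l2. Geometric decay exists only for functions, where the lower frame bound acts,
  and reaches the coefficients through C (1 - S/B) = (1 - G/B) C. Uniformity in z holds because the
  modulus of the inner product of \<Pi>(z)f and \<Pi>(w)g depends on z - w alone. The remainder of
  the series vanishes because it is a continuous function of L2 norm zero. The lower bound for
  \<psi> comes from Walnut's argument: at a fixed translation the coefficients are Fourier
  coefficients of a periodization. The translation step \<alpha> is so small that the translates of
  a set where \<psi> is large cover the space; the modulation step is 2 pi / L, with L so large that
  \<psi> hardly overlaps its translates by nonzero periods.\<close>

section \<open>Schwartz functions\<close>

text \<open>Comparable to \<open>jbracket\<close>, but exactly submultiplicative, so that Peetre's inequality carries
  no constants.\<close>

definition wt :: "'a::real_normed_vector \<Rightarrow> real"
  where "wt x = 1 + norm x"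

lemma wt_ge1 [simp]: "1 \<le> wt x"
  by (simp add: wt_def)

lemma wt_pos [simp]: "0 < wt x"
  by (simp add: wt_def add_pos_nonneg)

lemma wt_nonneg [simp]: "0 \<le> wt x"
  by (simp add: less_imp_le)

lemma wt_neq0 [simp]: "wt x \<noteq> 0"
  using wt_pos[of x] by linarith

lemma wt_pow_ge1 [simp]: "1 \<le> wt x ^ N"
  by (simp add: one_le_power)

lemma wt_minus: "wt (x - y) = wt (y - x)"
  by (simp add: wt_def norm_minus_commute)

lemma wt_add_le: "wt (x + y) \<le> wt x * wt y"
proof -
  have "norm (x + y) \<le> norm x + norm y"
    by (rule norm_triangle_ineq)
  moreover have "0 \<le> norm x * norm y"
    by simp
  ultimately show ?thesis
    unfolding wt_def distrib_left distrib_right by linarith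
qed

lemma wt_le_mult_diff: "wt x \<le> wt (x - y) * wt y"
  using wt_add_le[of "x - y" y] by simp

lemma jbracket_le_wt: "jbracket x \<le> wt x"
  unfolding jbracket_def wt_def
  by (rule real_le_lsqrt) (auto simp: power2_eq_square algebra_simps)

lemma wt_le_jbracket: "wt x \<le> 2 * jbracket x"
proof -
  have "1 \<le> jbracket x" "norm x \<le> jbracket x"
    by (auto simp: jbracket_def real_le_rsqrt)
  then show ?thesis
    by (simp add: wt_def)
qed

lemma jbracket_ge1: "1 \<le> jbracket x"
  by (simp add: jbracket_def)

lemma partial_derivs_Nil [simp]: "partial_derivs [] f = f"
  by (simp add: partial_derivs_def)

lemma partial_derivs_Cons: "partial_derivs (i # is) f = partial_deriv i (partial_derivs is f)"
  by (simp add: partial_derivs_def)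

lemma partial_derivs_snoc: "partial_derivs (is @ [i]) f = partial_derivs is (partial_deriv i f)"
  by (simp add: partial_derivs_def)

lemma smooth_partial_deriv: "smooth f \<Longrightarrow> smooth (partial_deriv i f)"
  unfolding smooth_def by (metis partial_derivs_snoc)

lemma smooth_partial_derivs: "smooth f \<Longrightarrow> smooth (partial_derivs is f)"
  by (induction "is") (auto simp: partial_derivs_Cons smooth_partial_deriv)

lemma smooth_differentiable: "smooth f \<Longrightarrow> f differentiable (at x)"
  unfolding smooth_def by (metis partial_derivs_Nil differentiable_on_def UNIV_I)

lemma smooth_frechet:
  "smooth f \<Longrightarrow> (f has_derivative frechet_derivative f (at x)) (at x)"
  using smooth_differentiable frechet_derivative_works by blast

lemma frechet_derivative_partial:
  assumes "smooth f"
  shows "frechet_derivative f (at x) h = (\<Sum>i\<in>UNIV. h $ i *\<^sub>R partial_deriv i f x)"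
proof -
  interpret bounded_linear "frechet_derivative f (at x)"
    using smooth_frechet[OF assms] by (rule has_derivative_bounded_linear)
  have "h = (\<Sum>i\<in>UNIV. h $ i *\<^sub>R axis i 1)"
    by (simp add: vec_eq_iff axis_def if_distrib[of "\<lambda>x. _ * x"] cong: if_cong)
  then have "frechet_derivative f (at x) h = frechet_derivative f (at x) (\<Sum>i\<in>UNIV. h $ i *\<^sub>R axis i 1)"
    by simp
  then show ?thesis
    by (simp add: sum scaleR partial_deriv_def)
qed

lemma smooth_has_derivative:
  assumes "smooth f"
  shows "(f has_derivative (\<lambda>h. \<Sum>i\<in>UNIV. h $ i *\<^sub>R partial_deriv i f x)) (at x)"
  using smooth_frechet[OF assms, of x]
  by (simp add: frechet_derivative_partial[OF assms, abs_def])

lemma partial_deriv_eqI: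
  assumes "(f has_derivative f') (at x)"
  shows "partial_deriv i f x = f' (axis i 1)"
  unfolding partial_deriv_def using frechet_derivative_at[OF assms] by simp

lemma smooth_continuous_on: "smooth f \<Longrightarrow> continuous_on S f"
  by (meson smooth_differentiable continuous_at_imp_continuous_on differentiable_imp_continuous_within)

lemma partial_derivs_add:
  assumes "smooth f" "smooth g"
  shows "partial_derivs is (\<lambda>x. f x + g x) = (\<lambda>x. partial_derivs is f x + partial_derivs is g x)"
proof (induction "is")
  case (Cons i "is")
  show ?case
    unfolding partial_derivs_Cons Cons
    using has_derivative_add[OF smooth_frechet[OF smooth_partial_derivs[OF assms(1)]]
        smooth_frechet[OF smooth_partial_derivs[OF assms(2)]]]
    by (intro ext) (subst partial_deriv_eqI, assumption, simp add: partial_deriv_def)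
qed simp

lemma partial_derivs_cmult:
  assumes "smooth f"
  shows "partial_derivs is (\<lambda>x. c * f x) = (\<lambda>x. c * partial_derivs is f x)"
proof (induction "is")
  case (Cons i "is")
  show ?case
    unfolding partial_derivs_Cons Cons
    using has_derivative_mult_right[OF smooth_frechet[OF smooth_partial_derivs[OF assms(1)]]]
    by (intro ext) (subst partial_deriv_eqI, assumption, simp add: partial_deriv_def)
qed simp

lemma smooth_add:
  assumes "smooth f" "smooth g"
  shows "smooth (\<lambda>x. f x + g x)"
  unfolding smooth_def[of "\<lambda>x. f x + g x"] partial_derivs_add[OF assms] differentiable_on_def
  by (intro allI ballI differentiable_add smooth_differentiable smooth_partial_derivs assms)

lemma smooth_cmult:
  assumes "smooth f"
  shows "smooth (\<lambda>x. c * f x)"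
  unfolding smooth_def[of "\<lambda>x. c * f x"] partial_derivs_cmult[OF assms] differentiable_on_def
  by (intro allI ballI differentiable_mult differentiable_const smooth_differentiable smooth_partial_derivs assms)

text \<open>\<open>wt\<close> and \<open>jbracket\<close> agree up to a factor 2, so boundedness
  with one weight is boundedness with the other. All later estimates work with this form.\<close>

lemma schwartz_iff:
  "f \<in> schwartz \<longleftrightarrow> smooth f \<and> (\<forall>N is. \<exists>C. \<forall>x. wt x ^ N * norm (partial_derivs is f x) \<le> C)"
proof -
  have "bdd_above (range (\<lambda>x. jbracket x ^ N * norm (partial_derivs is f x))) \<longleftrightarrow>
        (\<exists>C. \<forall>x. wt x ^ N * norm (partial_derivs is f x) \<le> C)" for N "is"
  proof
    assume "bdd_above (range (\<lambda>x. jbracket x ^ N * norm (partial_derivs is f x)))"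
    then obtain C where C: "jbracket x ^ N * norm (partial_derivs is f x) \<le> C" for x
      by (auto simp: bdd_above_def)
    have "wt x ^ N * norm (partial_derivs is f x) \<le> 2 ^ N * C" for x
    proof -
      have "wt x ^ N * norm (partial_derivs is f x) \<le> (2 * jbracket x) ^ N * norm (partial_derivs is f x)"
        by (intro mult_right_mono power_mono wt_le_jbracket) auto
      also have "\<dots> \<le> 2 ^ N * C"
        using C[of x] by (simp add: power_mult_distrib mult.assoc)
      finally show ?thesis .
    qed
    then show "\<exists>C. \<forall>x. wt x ^ N * norm (partial_derivs is f x) \<le> C"
      by blast
  next
    assume "\<exists>C. \<forall>x. wt x ^ N * norm (partial_derivs is f x) \<le> C"
    then obtain C where C: "wt x ^ N * norm (partial_derivs is f x) \<le> C" for x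
      by blast
    have "jbracket x ^ N * norm (partial_derivs is f x) \<le> C" for x
      using jbracket_ge1[of x] by (intro order_trans[OF _ C[of x]] mult_right_mono power_mono jbracket_le_wt) auto
    then show "bdd_above (range (\<lambda>x. jbracket x ^ N * norm (partial_derivs is f x)))"
      by (auto simp: bdd_above_def)
  qed
  then show ?thesis
    by (simp add: schwartz_def)
qed

lemma schwartz_smooth: "f \<in> schwartz \<Longrightarrow> smooth f"
  by (simp add: schwartz_iff)

lemma schwartz_continuous_on: "f \<in> schwartz \<Longrightarrow> continuous_on S f"
  by (simp add: schwartz_smooth smooth_continuous_on)

lemma schwartz_boundE:
  assumes "f \<in> schwartz"
  obtains C where "0 \<le> C" "\<And>x. wt x ^ N * norm (partial_derivs is f x) \<le> C"
proof -
  obtain C where C: "\<And>x. wt x ^ N * norm (partial_derivs is f x) \<le> C"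
    using assms unfolding schwartz_iff by metis
  moreover have "0 \<le> C"
    by (intro order_trans[OF _ C[of 0]]) simp
  ultimately show thesis
    using that by blast
qed

lemma schwartz_decayE:
  assumes "f \<in> schwartz"
  obtains C where "0 \<le> C" "\<And>x. norm (f x) \<le> C / wt x ^ N"
  using schwartz_boundE[OF assms, of N "[]"]
  by (metis (no_types, lifting) mult.commute partial_derivs_Nil pos_le_divide_eq wt_pos zero_less_power)

lemma schwartz_partial_deriv: "f \<in> schwartz \<Longrightarrow> partial_deriv i f \<in> schwartz"
  unfolding schwartz_iff by (metis partial_derivs_snoc smooth_partial_deriv)

lemma schwartz_add:
  assumes "f \<in> schwartz" "g \<in> schwartz"
  shows "(\<lambda>x. f x + g x) \<in> schwartz"
  unfolding schwartz_iff
proof (intro conjI allI smooth_add schwartz_smooth assms)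
  fix N and "is" :: "'a list"
  obtain C where "\<And>x. wt x ^ N * norm (partial_derivs is f x) \<le> C"
    using schwartz_boundE[OF assms(1)] by metis
  moreover obtain D where "\<And>x. wt x ^ N * norm (partial_derivs is g x) \<le> D"
    using schwartz_boundE[OF assms(2)] by metis
  ultimately have "wt x ^ N * norm (partial_derivs is f x + partial_derivs is g x) \<le> C + D" for x
    by (intro order_trans[OF mult_left_mono[OF norm_triangle_ineq]]) (auto simp: distrib_left intro: add_mono)
  then show "\<exists>C. \<forall>x. wt x ^ N * norm (partial_derivs is (\<lambda>x. f x + g x) x) \<le> C"
    unfolding partial_derivs_add[OF assms[THEN schwartz_smooth]] by blast
qed

lemma schwartz_cmult:
  assumes "f \<in> schwartz"
  shows "(\<lambda>x. c * f x) \<in> schwartz"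
  unfolding schwartz_iff
proof (intro conjI allI smooth_cmult schwartz_smooth assms)
  fix N and "is" :: "'a list"
  obtain C where C: "\<And>x. wt x ^ N * norm (partial_derivs is f x) \<le> C"
    using schwartz_boundE[OF assms(1)] by metis
  have "wt x ^ N * norm (c * partial_derivs is f x) \<le> norm c * C" for x
    using mult_left_mono[OF C[of x], of "norm c"] by (simp add: norm_mult mult.left_commute)
  then show "\<exists>C. \<forall>x. wt x ^ N * norm (partial_derivs is (\<lambda>x. c * f x) x) \<le> C"
    unfolding partial_derivs_cmult[OF assms[THEN schwartz_smooth]] by blast
qed

lemma schwartz_diff:
  assumes "f \<in> schwartz" "g \<in> schwartz"
  shows "(\<lambda>x. f x - g x) \<in> schwartz"
  using schwartz_add[OF assms(1) schwartz_cmult[OF assms(2), of "-1"]] by simp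

lemma schwartz_zero: "(\<lambda>x. 0) \<in> schwartz"
proof -
  have "partial_derivs is (\<lambda>x. 0) = (\<lambda>x::real^'a. 0)" for "is" :: "'a list"
    by (induction "is") (auto simp: partial_derivs_Cons partial_deriv_def)
  then show ?thesis
    by (auto simp: schwartz_iff smooth_def)
qed

lemma schwartz_sum:
  assumes "\<And>k. k \<in> I \<Longrightarrow> f k \<in> schwartz"
  shows "(\<lambda>x. \<Sum>k\<in>I. f k x) \<in> schwartz"
  using assms
proof (induction I rule: infinite_finite_induct)
  case (insert k I)
  then show ?case using schwartz_add[of "f k" "\<lambda>x. \<Sum>k\<in>I. f k x"] by simp
qed (auto simp: schwartz_zero)

section \<open>Time-frequency shifts of Schwartz functions\<close>

lemma tf_shift_apply: "tf_shift z f y = exp (\<i> * complex_of_real (y \<bullet> snd z)) * f (y - fst z)"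
  by (simp add: tf_shift_def modulation_def translation_def)

lemma norm_tf_shift: "norm (tf_shift z f y) = norm (f (y - fst z))"
  by (simp add: tf_shift_apply norm_mult)

lemma tf_shift_has_derivative:
  assumes "smooth f"
  shows "(tf_shift z f has_derivative (\<lambda>h. \<i> * complex_of_real (h \<bullet> snd z) * tf_shift z f y +
      exp (\<i> * complex_of_real (y \<bullet> snd z)) * frechet_derivative f (at (y - fst z)) h)) (at y)"
proof -
  have 1: "((\<lambda>y. f (y - fst z)) has_derivative (\<lambda>h. frechet_derivative f (at (y - fst z)) h)) (at y)"
    by (rule has_derivative_compose[where f="\<lambda>y. y - fst z" and f'="\<lambda>h. h", OF _ smooth_frechet[OF assms]])
      (auto intro!: derivative_eq_intros)
  have 2: "((\<lambda>y. exp (\<i> * complex_of_real (y \<bullet> snd z))) has_derivative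
      (\<lambda>h. exp (\<i> * complex_of_real (y \<bullet> snd z)) * (\<i> * complex_of_real (h \<bullet> snd z)))) (at y)"
    by (rule has_derivative_compose[where f="\<lambda>y. \<i> * complex_of_real (y \<bullet> snd z)" and g=exp])
      (auto intro!: derivative_eq_intros DERIV_exp[unfolded has_field_derivative_def])
  show ?thesis
    unfolding tf_shift_apply[abs_def]
    by (rule has_derivative_eq_rhs[OF has_derivative_mult[OF 2 1]]) (auto simp: algebra_simps)
qed

lemma partial_deriv_tf_shift:
  assumes "smooth f"
  shows "partial_deriv i (tf_shift z f) =
    (\<lambda>y. \<i> * complex_of_real (snd z $ i) * tf_shift z f y + tf_shift z (partial_deriv i f) y)"
  by (rule ext, subst partial_deriv_eqI[OF tf_shift_has_derivative[OF assms]])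
    (simp add: tf_shift_apply partial_deriv_def inner_axis')

lemma partial_deriv_tf_shift':
  assumes "smooth f"
  shows "partial_deriv i (tf_shift z f) =
    tf_shift z (\<lambda>y. \<i> * complex_of_real (snd z $ i) * f y + partial_deriv i f y)"
  unfolding partial_deriv_tf_shift[OF assms] by (auto simp: tf_shift_apply algebra_simps)

text \<open>A partial derivative of a shifted smooth function is again the shift, by the same
  \<open>z\<close>, of a smooth function. This property passes through any list of derivatives, and
  such a shift is differentiable.\<close>

lemma smooth_tf_shift:
  assumes "smooth f"
  shows "smooth (tf_shift z f)"
proof -
  have "\<exists>g. smooth g \<and> partial_derivs is (tf_shift z f) = tf_shift z g" for "is"
  proof (induction "is")
    case (Cons i "is")
    then obtain g where g: "smooth g" "partial_derivs is (tf_shift z f) = tf_shift z g"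
      by blast
    then show ?case
      using partial_deriv_tf_shift'[OF g(1), of i z]
      by (metis g(1) partial_derivs_Cons smooth_add smooth_cmult smooth_partial_deriv)
  qed (use assms in auto)
  moreover have "tf_shift z g differentiable_on UNIV" if "smooth g" for g
    unfolding differentiable_on_def differentiable_def using tf_shift_has_derivative[OF that] by fast
  ultimately show ?thesis
    unfolding smooth_def[of "tf_shift z f"] by metis
qed

text \<open>The weight in y costs \<open>wt z ^ N\<close> by Peetre's inequality, and each
  derivative costs one more factor \<open>wt z\<close> when it hits the modulation. The induction
  removes the innermost derivative, which leaves shifts of f and of its derivative; hence f is
  arbitrary. The polynomial growth in z serves both the convergence of synthesis and the growth
  bound for the short-time Fourier transform.\<close>

lemma tf_shift_bound:
  assumes "f \<in> schwartz"
  shows "\<exists>C\<ge>0. \<forall>z y. wt y ^ N * norm (partial_derivs is (tf_shift z f) y) \<le> C * wt z ^ (N + length is)"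
  using assms
proof (induction "is" arbitrary: f rule: rev_induct)
  case Nil
  obtain C where C: "0 \<le> C" "\<And>x. wt x ^ N * norm (f x) \<le> C"
    using schwartz_boundE[OF Nil, of N "[]"] by auto
  have "wt y ^ N * norm (tf_shift z f y) \<le> C * wt z ^ N" for z y
  proof -
    have "wt y \<le> wt (y - fst z) * wt (fst z)"
      by (rule wt_le_mult_diff)
    also have "\<dots> \<le> wt (y - fst z) * wt z"
      by (intro mult_left_mono) (use norm_fst_le[of "fst z" "snd z"] in \<open>auto simp: wt_def\<close>)
    finally have "wt y ^ N \<le> wt (y - fst z) ^ N * wt z ^ N"
      by (metis power_mono power_mult_distrib wt_nonneg)
    then have "wt y ^ N * norm (tf_shift z f y) \<le> (wt (y - fst z) ^ N * wt z ^ N) * norm (f (y - fst z))"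
      unfolding norm_tf_shift by (rule mult_right_mono) auto
    also have "\<dots> = (wt (y - fst z) ^ N * norm (f (y - fst z))) * wt z ^ N"
      by simp
    also have "\<dots> \<le> C * wt z ^ N"
      by (intro mult_right_mono C) auto
    finally show ?thesis .
  qed
  then show ?case
    using C(1) by auto
next
  case (snoc i "is")
  obtain C where C: "0 \<le> C"
    "\<And>z y. wt y ^ N * norm (partial_derivs is (tf_shift z f) y) \<le> C * wt z ^ (N + length is)"
    using snoc.IH[OF snoc.prems] by blast
  obtain D where D: "0 \<le> D"
    "\<And>z y. wt y ^ N * norm (partial_derivs is (tf_shift z (partial_deriv i f)) y) \<le> D * wt z ^ (N + length is)"
    using snoc.IH[OF schwartz_partial_deriv[OF snoc.prems]] by blast
  note sm = schwartz_smooth[OF snoc.prems]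
  have eq: "partial_derivs (is @ [i]) (tf_shift z f) = (\<lambda>y. \<i> * complex_of_real (snd z $ i) *
      partial_derivs is (tf_shift z f) y + partial_derivs is (tf_shift z (partial_deriv i f)) y)" for z
    unfolding partial_derivs_snoc partial_deriv_tf_shift[OF sm]
    by (simp add: partial_derivs_add partial_derivs_cmult sm smooth_tf_shift smooth_cmult smooth_partial_deriv)
  have "wt y ^ N * norm (partial_derivs (is @ [i]) (tf_shift z f) y) \<le> (C + D) * wt z ^ (N + length (is @ [i]))" for z y
  proof -
    define X where "X = wt z ^ (N + length is)"
    have a: "\<bar>snd z $ i\<bar> \<le> wt z"
      using component_le_norm_cart[of "snd z" i] norm_snd_le[of "snd z" "fst z"] by (simp add: wt_def)
    have X: "0 \<le> X" by (simp add: X_def)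
    have "wt y ^ N * norm (partial_derivs (is @ [i]) (tf_shift z f) y) \<le>
       wt y ^ N * (\<bar>snd z $ i\<bar> * norm (partial_derivs is (tf_shift z f) y)
         + norm (partial_derivs is (tf_shift z (partial_deriv i f)) y))"
      unfolding eq by (intro mult_left_mono order_trans[OF norm_triangle_ineq]) (auto simp: norm_mult)
    also have "\<dots> = \<bar>snd z $ i\<bar> * (wt y ^ N * norm (partial_derivs is (tf_shift z f) y))
         + wt y ^ N * norm (partial_derivs is (tf_shift z (partial_deriv i f)) y)"
      by (simp add: algebra_simps)
    also have "\<dots> \<le> wt z * (C * X) + D * X"
      unfolding X_def by (intro add_mono mult_mono a C D) (auto intro: mult_nonneg_nonneg)
    also have "\<dots> \<le> wt z * (C * X) + wt z * (D * X)"
      using mult_right_mono[OF wt_ge1[of z], of "D * X"] D(1) X by simp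
    finally show ?thesis
      by (simp add: X_def algebra_simps)
  qed
  then show ?case
    using C(1) D(1) by (intro exI[of _ "C + D"]) auto
qed

lemma schwartz_tf_shift:
  assumes "f \<in> schwartz"
  shows "tf_shift z f \<in> schwartz"
  unfolding schwartz_iff using smooth_tf_shift[OF schwartz_smooth[OF assms]] tf_shift_bound[OF assms]
  by blast

text \<open>Linearity is recorded as additivity only, so that one notion covers tempered
  distributions, which are conjugate linear, as well as \<open>\<lambda>f. l2_inner f h\<close>,
  which is linear. Continuity takes the form of a bound by finitely many seminorms.\<close>

definition tempered_functional :: "((real ^ 'd::finite \<Rightarrow> complex) \<Rightarrow> complex) \<Rightarrow> bool"
  where "tempered_functional v \<longleftrightarrow>
    (\<forall>f\<in>schwartz. \<forall>g\<in>schwartz. v (\<lambda>x. f x + g x) = v f + v g) \<and>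
    (\<exists>I C. finite I \<and> (\<forall>f\<in>schwartz. norm (v f) \<le> C * (\<Sum>(N, is)\<in>I. schwartz_seminorm N is f)))"

lemma schwartz_bdd_above:
  "f \<in> schwartz \<Longrightarrow> bdd_above (range (\<lambda>x. jbracket x ^ N * norm (partial_derivs is f x)))"
  by (simp add: schwartz_def)

lemma schwartz_seminorm_upper:
  assumes "f \<in> schwartz"
  shows "jbracket x ^ N * norm (partial_derivs is f x) \<le> schwartz_seminorm N is f"
  unfolding schwartz_seminorm_def
  by (rule cSUP_upper[OF UNIV_I schwartz_bdd_above[OF assms]])

lemma schwartz_seminorm_nonneg:
  assumes "f \<in> schwartz"
  shows "0 \<le> schwartz_seminorm N is f"
  by (rule order_trans[OF _ schwartz_seminorm_upper[OF assms, of 0 N "is"]]) (simp add: jbracket_def)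

lemma schwartz_seminorm_le:
  assumes "\<And>x. wt x ^ N * norm (partial_derivs is f x) \<le> C"
  shows "schwartz_seminorm N is f \<le> C"
  unfolding schwartz_seminorm_def
proof (rule cSUP_least)
  fix x
  have "jbracket x ^ N * norm (partial_derivs is f x) \<le> wt x ^ N * norm (partial_derivs is f x)"
    using jbracket_ge1[of x] by (intro mult_right_mono power_mono jbracket_le_wt) auto
  then show "jbracket x ^ N * norm (partial_derivs is f x) \<le> C"
    using assms[of x] by linarith
qed auto

lemma schwartz_seminorm_add:
  assumes "f \<in> schwartz" "g \<in> schwartz"
  shows "schwartz_seminorm N is (\<lambda>x. f x + g x) \<le> schwartz_seminorm N is f + schwartz_seminorm N is g"
  unfolding schwartz_seminorm_def[of N "is" "\<lambda>x. f x + g x"]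
proof (rule cSUP_least)
  fix x
  have "jbracket x ^ N * norm (partial_derivs is (\<lambda>x. f x + g x) x) \<le>
     jbracket x ^ N * (norm (partial_derivs is f x) + norm (partial_derivs is g x))"
    unfolding partial_derivs_add[OF assms[THEN schwartz_smooth]]
    using jbracket_ge1[of x] by (intro mult_left_mono norm_triangle_ineq) auto
  also have "\<dots> \<le> schwartz_seminorm N is f + schwartz_seminorm N is g"
    unfolding distrib_left by (intro add_mono schwartz_seminorm_upper assms)
  finally show "jbracket x ^ N * norm (partial_derivs is (\<lambda>x. f x + g x) x) \<le>
    schwartz_seminorm N is f + schwartz_seminorm N is g" .
qed auto

lemma schwartz_seminorm_cmult:
  assumes "f \<in> schwartz"
  shows "schwartz_seminorm N is (\<lambda>x. c * f x) \<le> norm c * schwartz_seminorm N is f"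
  unfolding schwartz_seminorm_def[of N "is" "\<lambda>x. c * f x"]
proof (rule cSUP_least)
  fix x
  show "jbracket x ^ N * norm (partial_derivs is (\<lambda>x. c * f x) x) \<le> norm c * schwartz_seminorm N is f"
    using mult_left_mono[OF schwartz_seminorm_upper[OF assms, of x N "is"], of "norm c"]
    by (simp add: partial_derivs_cmult[OF schwartz_smooth[OF assms]] norm_mult mult.left_commute)
qed auto

text \<open>Summing the majorants of the finitely many partial derivatives gives a summable
  \<open>K\<close> with \<open>norm (F n x h) \<le> K n * norm h\<close>. The total derivatives of
  the partial sums therefore converge uniformly in x, relative to \<open>norm h\<close>, as termwise
  differentiation requires.\<close>

lemma suminf_has_derivative_partial:
  fixes f :: "nat \<Rightarrow> real ^ 'd::finite \<Rightarrow> complex"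
  assumes sm: "\<And>n. smooth (f n)"
    and s0: "summable \<kappa>0" "\<And>n x. norm (f n x) \<le> \<kappa>0 n"
    and s1: "\<And>i. summable (\<kappa> i)" "\<And>n i x. norm (partial_deriv i (f n) x) \<le> \<kappa> i n"
  shows "((\<lambda>x. \<Sum>n. f n x) has_derivative (\<lambda>h. \<Sum>i\<in>UNIV. h $ i *\<^sub>R (\<Sum>n. partial_deriv i (f n) x))) (at x)"
proof -
  define K where "K n = (\<Sum>i\<in>UNIV. \<kappa> i n)" for n
  have K: "summable K"
    unfolding K_def by (intro summable_sum s1)
  define F where "F n x h = (\<Sum>i\<in>UNIV. h $ i *\<^sub>R partial_deriv i (f n) x)" for n x h
  define G where "G x h = (\<Sum>i\<in>UNIV. h $ i *\<^sub>R (\<Sum>n. partial_deriv i (f n) x))" for x h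
  have sp: "summable (\<lambda>n. partial_deriv i (f n) x)" for i x
    by (rule summable_comparison_test'[OF s1(1)[of i]]) (simp add: s1(2))
  have Gs: "(\<lambda>n. F n x h) sums G x h" for x h
    unfolding F_def G_def by (intro sums_sum sums_scaleR_right summable_sums sp)
  have nF: "norm (F n x h) \<le> K n * norm h" for n x h
  proof -
    have "norm (F n x h) \<le> (\<Sum>i\<in>UNIV. \<bar>h $ i\<bar> * norm (partial_deriv i (f n) x))"
      unfolding F_def by (rule order_trans[OF norm_sum]) simp
    also have "\<dots> \<le> (\<Sum>i\<in>UNIV. norm h * \<kappa> i n)"
      using component_le_norm_cart[of h] by (intro sum_mono mult_mono s1) auto
    finally show ?thesis
      by (simp add: K_def sum_distrib_left mult.commute)
  qed
  have unif: "\<forall>\<^sub>F n in sequentially. \<forall>x\<in>UNIV. \<forall>h. norm ((\<Sum>i<n. F i x h) - G x h) \<le> e * norm h" if "e > 0" for e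
  proof -
    have "(\<lambda>n. \<Sum>i. K (i + n)) \<longlonglongrightarrow> 0"
      by (rule suminf_exist_split2[OF K])
    then have "\<forall>\<^sub>F n in sequentially. (\<Sum>i. K (i + n)) < e"
      using that by (rule order_tendstoD)
    then show ?thesis
    proof eventually_elim
      case (elim n)
      show ?case
      proof (intro ballI allI)
        fix x h :: "real ^ 'd"
        have sK: "summable (\<lambda>i. K (i + n) * norm h)"
          by (intro summable_mult2 summable_ignore_initial_segment K)
        have sF: "summable (\<lambda>i. norm (F (i + n) x h))"
          by (rule summable_comparison_test'[OF sK]) (simp add: nF)
        have "G x h - (\<Sum>i<n. F i x h) = (\<Sum>i. F (i + n) x h)"
          using suminf_minus_initial_segment[OF sums_summable[OF Gs[of x h]], of n] sums_unique[OF Gs[of x h]]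
          by simp
        then have "norm ((\<Sum>i<n. F i x h) - G x h) = norm (\<Sum>i. F (i + n) x h)"
          by (metis norm_minus_commute)
        also have "\<dots> \<le> (\<Sum>i. norm (F (i + n) x h))"
          by (rule summable_norm[OF sF])
        also have "\<dots> \<le> (\<Sum>i. K (i + n) * norm h)"
          by (rule suminf_le[OF nF sF sK])
        also have "\<dots> = (\<Sum>i. K (i + n)) * norm h"
          by (rule suminf_mult2[symmetric]) (intro summable_ignore_initial_segment K)
        also have "\<dots> \<le> e * norm h"
          using elim by (intro mult_right_mono) auto
        finally show "norm ((\<Sum>i<n. F i x h) - G x h) \<le> e * norm h" .
      qed
    qed
  qed
  have sf: "summable (\<lambda>n. f n x)" for x
    by (rule summable_comparison_test'[OF s0(1)]) (simp add: s0(2))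
  have "\<exists>g. \<forall>x\<in>UNIV. (\<lambda>n. f n x) sums g x \<and> (g has_derivative G x) (at x within UNIV)"
  proof (rule has_derivative_series[OF convex_UNIV _ unif])
    show "(f n has_derivative F n x) (at x within UNIV)" for n x
      unfolding F_def using smooth_has_derivative[OF sm] by simp
    show "(\<lambda>n. f n 0) sums (\<Sum>n. f n 0)"
      by (rule summable_sums[OF sf])
  qed auto
  then obtain g where g: "\<And>x. (\<lambda>n. f n x) sums g x" "\<And>x. (g has_derivative G x) (at x)"
    by auto
  moreover have "g = (\<lambda>x. \<Sum>n. f n x)"
    using g(1) by (auto simp: sums_iff)
  ultimately show ?thesis
    unfolding G_def by simp
qed

text \<open>Each further derivative uses the majorants for the lists \<open>is\<close> and
  \<open>i # is\<close>, so the termwise formula and differentiability propagate along the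
  list.\<close>

lemma schwartz_series_partial_derivs:
  fixes f :: "nat \<Rightarrow> real ^ 'd::finite \<Rightarrow> complex"
  assumes f: "\<And>n. f n \<in> schwartz"
    and \<kappa>: "\<And>N is. \<exists>\<kappa>. summable \<kappa> \<and> (\<forall>n x. wt x ^ N * norm (partial_derivs is (f n) x) \<le> \<kappa> n)"
  shows "partial_derivs is (\<lambda>x. \<Sum>n. f n x) = (\<lambda>x. \<Sum>n. partial_derivs is (f n) x)"
    and "(\<lambda>x. \<Sum>n. partial_derivs is (f n) x) differentiable (at x)"
proof -
  have "\<exists>\<kappa>. \<forall>is. summable (\<kappa> is) \<and> (\<forall>n x. wt x ^ 0 * norm (partial_derivs is (f n) x) \<le> \<kappa> is n)"
    using \<kappa>[of 0] by (intro choice) blast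
  then obtain \<kappa>' where k: "\<And>is. summable (\<kappa>' is)" "\<And>is n x. norm (partial_derivs is (f n) x) \<le> \<kappa>' is n"
    by auto
  have d: "((\<lambda>x. \<Sum>n. partial_derivs is (f n) x) has_derivative
      (\<lambda>h. \<Sum>i\<in>UNIV. h $ i *\<^sub>R (\<Sum>n. partial_derivs (i # is) (f n) x))) (at x)" for "is" x
    unfolding partial_derivs_Cons
    by (rule suminf_has_derivative_partial[OF smooth_partial_derivs[OF schwartz_smooth[OF f]] k(1)[of "is"] _ k(1)[of "_ # is"]])
      (auto simp flip: partial_derivs_Cons intro: k)
  show "(\<lambda>x. \<Sum>n. partial_derivs is (f n) x) differentiable (at x)" for "is" x
    using d by (auto simp: differentiable_def)
  show "partial_derivs is (\<lambda>x. \<Sum>n. f n x) = (\<lambda>x. \<Sum>n. partial_derivs is (f n) x)" for "is"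
  proof (induction "is")
    case (Cons i "is")
    show ?case
      unfolding partial_derivs_Cons[of i "is" "\<lambda>x. \<Sum>n. f n x"] Cons
      by (intro ext, subst partial_deriv_eqI[OF d])
        (simp add: axis_def if_distrib[of "\<lambda>x. x *\<^sub>R _"] cong: if_cong)
  qed simp
qed

lemma schwartz_series:
  fixes f :: "nat \<Rightarrow> real ^ 'd::finite \<Rightarrow> complex"
  assumes f: "\<And>n. f n \<in> schwartz"
    and \<kappa>: "\<And>N is. \<exists>\<kappa>. summable \<kappa> \<and> (\<forall>n x. wt x ^ N * norm (partial_derivs is (f n) x) \<le> \<kappa> n)"
  shows "(\<lambda>x. \<Sum>n. f n x) \<in> schwartz"
proof -
  note pd = schwartz_series_partial_derivs[of f, OF f \<kappa>]
  have "\<exists>C. \<forall>x. wt x ^ N * norm (\<Sum>n. partial_derivs is (f n) x) \<le> C" for N "is"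
  proof -
    obtain k where k: "summable k" "\<And>n x. wt x ^ N * norm (partial_derivs is (f n) x) \<le> k n"
      using \<kappa> by blast
    have "wt x ^ N * norm (\<Sum>n. partial_derivs is (f n) x) \<le> suminf k" for x
    proof -
      have s: "summable (\<lambda>n. wt x ^ N * norm (partial_derivs is (f n) x))"
        by (rule summable_comparison_test'[OF k(1)]) (use k(2) in auto)
      have s': "summable (\<lambda>n. norm (partial_derivs is (f n) x))"
        using summable_mult_D[OF s] by simp
      have "wt x ^ N * norm (\<Sum>n. partial_derivs is (f n) x) \<le> wt x ^ N * (\<Sum>n. norm (partial_derivs is (f n) x))"
        by (intro mult_left_mono summable_norm s') auto
      also have "\<dots> = (\<Sum>n. wt x ^ N * norm (partial_derivs is (f n) x))"
        by (rule suminf_mult[symmetric, OF s'])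
      also have "\<dots> \<le> suminf k"
        by (rule suminf_le[OF k(2) s k(1)])
      finally show ?thesis .
    qed
    then show ?thesis by blast
  qed
  then show ?thesis
    unfolding schwartz_iff smooth_def pd(1) using pd(2) by (simp add: differentiable_on_def)
qed

lemma tempered_functional_sum:
  assumes v: "tempered_functional v" and f: "\<And>k. k \<in> I \<Longrightarrow> f k \<in> schwartz"
  shows "v (\<lambda>x. \<Sum>k\<in>I. f k x) = (\<Sum>k\<in>I. v (f k))"
proof -
  have add: "v (\<lambda>x. g x + h x) = v g + v h" if "g \<in> schwartz" "h \<in> schwartz" for g h
    using v that by (auto simp: tempered_functional_def)
  have z: "v (\<lambda>x. 0) = 0"
    using add[OF schwartz_zero schwartz_zero] by simp
  show ?thesis
    using f
  proof (induction I rule: infinite_finite_induct)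
    case (insert k I)
    then show ?case
      using add[of "f k" "\<lambda>x. \<Sum>k\<in>I. f k x"] schwartz_sum[of I f] by simp
  qed (auto simp: z)
qed

text \<open>The tails \<open>r n\<close> are Schwartz functions, and each of their seminorms is at
  most the tail of a convergent numerical series. Only finitely many seminorms control
  \<open>v\<close>, so \<open>v (r n)\<close> tends to 0.\<close>

lemma tempered_functional_series:
  fixes f :: "nat \<Rightarrow> real ^ 'd::finite \<Rightarrow> complex"
  assumes v: "tempered_functional v" and f: "\<And>n. f n \<in> schwartz"
    and \<kappa>: "\<And>N is. \<exists>\<kappa>. summable \<kappa> \<and> (\<forall>n x. wt x ^ N * norm (partial_derivs is (f n) x) \<le> \<kappa> n)"
  shows "(\<lambda>n. v (f n)) sums v (\<lambda>x. \<Sum>n. f n x)"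
proof -
  define g where "g = (\<lambda>x. \<Sum>n. f n x)"
  define r where "r n = (\<lambda>x. \<Sum>i. f (i + n) x)" for n
  have sf: "summable (\<lambda>n. f n x)" for x
  proof -
    obtain k where k: "summable k" "\<And>n x. wt x ^ 0 * norm (partial_derivs [] (f n) x) \<le> k n"
      using \<kappa> by blast
    show ?thesis
      by (rule summable_comparison_test'[OF k(1)]) (use k(2) in auto)
  qed
  have k': "\<exists>\<kappa>. summable \<kappa> \<and> (\<forall>i x. wt x ^ N * norm (partial_derivs is (f (i + n)) x) \<le> \<kappa> i)" for N "is" n
    using \<kappa>[of N "is"] summable_ignore_initial_segment by blast
  have r: "r n \<in> schwartz" for n
    unfolding r_def by (rule schwartz_series[OF f k'])
  obtain I C where I: "finite I" "\<And>f. f \<in> schwartz \<Longrightarrow> norm (v f) \<le> C * (\<Sum>(N, is)\<in>I. schwartz_seminorm N is f)"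
    using v unfolding tempered_functional_def by blast
  have lim: "(\<lambda>n. schwartz_seminorm N is (r n)) \<longlonglongrightarrow> 0" for N "is"
  proof -
    obtain k where k: "summable k" "\<And>n x. wt x ^ N * norm (partial_derivs is (f n) x) \<le> k n"
      using \<kappa> by blast
    have "schwartz_seminorm N is (r n) \<le> (\<Sum>i. k (i + n))" for n
    proof (rule schwartz_seminorm_le)
      fix x
      note kn = summable_ignore_initial_segment[OF k(1), of n]
      have s: "summable (\<lambda>i. wt x ^ N * norm (partial_derivs is (f (i + n)) x))"
        by (rule summable_comparison_test'[OF kn]) (use k(2) in auto)
      have s': "summable (\<lambda>i. norm (partial_derivs is (f (i + n)) x))"
        using summable_mult_D[OF s] by simp
      have "wt x ^ N * norm (partial_derivs is (r n) x) \<le> wt x ^ N * (\<Sum>i. norm (partial_derivs is (f (i + n)) x))"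
        unfolding r_def schwartz_series_partial_derivs(1)[OF f k']
        by (intro mult_left_mono summable_norm s') auto
      also have "\<dots> = (\<Sum>i. wt x ^ N * norm (partial_derivs is (f (i + n)) x))"
        by (rule suminf_mult[symmetric, OF s'])
      also have "\<dots> \<le> (\<Sum>i. k (i + n))"
        by (rule suminf_le[OF k(2) s kn])
      finally show "wt x ^ N * norm (partial_derivs is (r n) x) \<le> (\<Sum>i. k (i + n))" .
    qed
    then show ?thesis
      by (intro tendsto_sandwich[OF _ _ tendsto_const suminf_exist_split2[OF k(1)]])
        (auto simp: schwartz_seminorm_nonneg r)
  qed
  have "(\<lambda>n. C * (\<Sum>(N, is)\<in>I. schwartz_seminorm N is (r n))) \<longlonglongrightarrow> C * (\<Sum>(N, is)\<in>I. 0)"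
    unfolding case_prod_beta by (intro tendsto_intros lim)
  then have "(\<lambda>n. C * (\<Sum>(N, is)\<in>I. schwartz_seminorm N is (r n))) \<longlonglongrightarrow> 0"
    by simp
  then have "(\<lambda>n. v (r n)) \<longlonglongrightarrow> 0"
    by (rule Lim_null_comparison[rotated]) (simp add: I r)
  moreover have "v g - (\<Sum>i<n. v (f i)) = v (r n)" for n
  proof -
    have "g = (\<lambda>x. (\<Sum>i<n. f i x) + r n x)"
      unfolding g_def r_def using suminf_split_initial_segment[OF sf, of _ n]
      by (intro ext) (simp add: add.commute)
    then have "v g = v (\<lambda>x. \<Sum>i<n. f i x) + v (r n)"
      using v r f schwartz_sum[of "{..<n}" f] unfolding tempered_functional_def by auto
    then show ?thesis
      by (simp add: tempered_functional_sum[OF v f])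
  qed
  ultimately have "(\<lambda>n. v g - (\<Sum>i<n. v (f i))) \<longlonglongrightarrow> 0"
    by simp
  then have "(\<lambda>n. v g - (v g - (\<Sum>i<n. v (f i)))) \<longlonglongrightarrow> v g - 0"
    by (intro tendsto_intros)
  then show ?thesis
    by (simp add: sums_def g_def)
qed

section \<open>Tempered functionals and integrals\<close>

text \<open>The seminorm balls are only a subbasis with arbitrary centres. Induction over the
  generation of the topology turns membership into a ball around \<open>h\<close> itself:
  intersections collect the seminorms and take the smaller radius, and a generator uses the triangle
  inequality with the radius that remains at \<open>h\<close>.\<close>

lemma openin_schwartz_topology_ball:
  assumes "openin schwartz_topology U" "h \<in> U"
  shows "h \<in> schwartz \<and> (\<exists>I \<delta>. finite I \<and> \<delta> > 0 \<and>
    (\<forall>g\<in>schwartz. (\<forall>(N, is)\<in>I. schwartz_seminorm N is (\<lambda>x. g x - h x) < \<delta>) \<longrightarrow> g \<in> U))"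
proof -
  have "generate_topology_on {{g \<in> schwartz. schwartz_seminorm N is (\<lambda>x. g x - f x) < e} | N is f e.
      f \<in> schwartz \<and> 0 < e} U"
    using assms(1) unfolding schwartz_topology_def by (rule openin_topology_generated_by)
  then show ?thesis
    using assms(2)
  proof (induction arbitrary: h)
    case Empty
    then show ?case by simp
  next
    case (Int a b)
    have hab: "h \<in> a" "h \<in> b"
      using Int.prems by auto
    obtain I d where I: "finite I" "d > 0"
      "\<forall>g\<in>schwartz. (\<forall>(N, is)\<in>I. schwartz_seminorm N is (\<lambda>x. g x - h x) < d) \<longrightarrow> g \<in> a"
      using Int.IH(1)[OF hab(1)] by blast
    obtain J e where J: "finite J" "e > 0"
      "\<forall>g\<in>schwartz. (\<forall>(N, is)\<in>J. schwartz_seminorm N is (\<lambda>x. g x - h x) < e) \<longrightarrow> g \<in> b"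
      using Int.IH(2)[OF hab(2)] by blast
    have h: "h \<in> schwartz"
      using Int.IH(1)[OF hab(1)] by blast
    have "\<forall>g\<in>schwartz. (\<forall>(N, is)\<in>I \<union> J. schwartz_seminorm N is (\<lambda>x. g x - h x) < min d e) \<longrightarrow> g \<in> a \<inter> b"
    proof (intro ballI impI IntI)
      fix g assume g: "g \<in> schwartz"
        and lt: "\<forall>(N, is)\<in>I \<union> J. schwartz_seminorm N is (\<lambda>x. g x - h x) < min d e"
      show "g \<in> a"
        using lt by (intro I(3)[rule_format, OF g]) auto
      show "g \<in> b"
        using lt by (intro J(3)[rule_format, OF g]) auto
    qed
    moreover have "finite (I \<union> J)" "min d e > 0"
      using I J by auto
    ultimately show ?case
      using h by blast
  next
    case (UN K)
    then obtain k where k: "k \<in> K" "h \<in> k" by blast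
    show ?case
      using UN.IH[OF k] k(1) Union_upper[OF k(1)] by (meson subsetD)
  next
    case (Basis s)
    then obtain N "is" f e where s: "s = {g \<in> schwartz. schwartz_seminorm N is (\<lambda>x. g x - f x) < e}"
      and f: "f \<in> schwartz" "0 < e"
      by blast
    have h: "h \<in> schwartz" "schwartz_seminorm N is (\<lambda>x. h x - f x) < e"
      using Basis s by auto
    have "g \<in> s" if g: "g \<in> schwartz"
      and le: "schwartz_seminorm N is (\<lambda>x. g x - h x) < e - schwartz_seminorm N is (\<lambda>x. h x - f x)" for g
      using schwartz_seminorm_add[OF schwartz_diff[OF g h(1)] schwartz_diff[OF h(1) f(1)], of N "is"] g le
      by (simp add: s)
    then show ?case
      using h by (intro conjI exI[of _ "{(N, is)}"] exI[of _ "e - schwartz_seminorm N is (\<lambda>x. h x - f x)"]) auto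
  qed
qed

lemma topspace_schwartz_topology: "topspace schwartz_topology = schwartz"
proof
  show "topspace schwartz_topology \<subseteq> schwartz"
    unfolding schwartz_topology_def topology_generated_by_topspace by blast
  show "schwartz \<subseteq> topspace schwartz_topology"
  proof
    fix f :: "real ^ 'd \<Rightarrow> complex" assume f: "f \<in> schwartz"
    then have "f \<in> {g \<in> schwartz. schwartz_seminorm 0 [] (\<lambda>x. g x - f x) < 1}"
      by (simp add: schwartz_seminorm_def)
    moreover have "{g \<in> schwartz. schwartz_seminorm 0 [] (\<lambda>x. g x - f x) < 1} \<in>
      {{g \<in> schwartz. schwartz_seminorm N is (\<lambda>x. g x - f x) < e} | N is f e. f \<in> schwartz \<and> 0 < e}"
      using f zero_less_one by blast
    ultimately show "f \<in> topspace schwartz_topology"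
      unfolding schwartz_topology_def topology_generated_by_topspace by (rule UnionI[rotated])
  qed
qed

text \<open>The usual scaling argument: the preimage of the unit ball contains a seminorm ball
  around 0, and rescaling f into that ball turns \<open>norm (u g) < 1\<close> into a linear
  bound.\<close>

lemma tempered_distribution_functional:
  fixes u :: "(real ^ 'd::finite \<Rightarrow> complex) \<Rightarrow> complex"
  assumes u: "u \<in> tempered_distributions"
  shows "tempered_functional u"
proof -
  have add: "\<forall>f\<in>schwartz. \<forall>g\<in>schwartz. u (\<lambda>x. f x + g x) = u f + u g"
    and cm: "\<And>c f. f \<in> schwartz \<Longrightarrow> u (\<lambda>x. c * f x) = cnj c * u f"
    and cont: "continuous_map schwartz_topology euclidean u"
    using u by (auto simp: tempered_distributions_def)
  have u0: "u (\<lambda>x. 0) = 0"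
    using cm[OF schwartz_zero, of 0] by simp
  have "openin schwartz_topology {f \<in> topspace schwartz_topology. u f \<in> ball 0 1}"
    using cont by (rule openin_continuous_map_preimage) auto
  from openin_schwartz_topology_ball[OF this, of "\<lambda>x. 0"]
  have "\<exists>I \<delta>. finite I \<and> \<delta> > 0 \<and>
      (\<forall>g\<in>schwartz. (\<forall>(N, is)\<in>I. schwartz_seminorm N is g < \<delta>) \<longrightarrow> norm (u g) < 1)"
    using u0 schwartz_zero by (simp add: topspace_schwartz_topology)
  then obtain I \<delta> where I: "finite I" "\<delta> > 0"
    "\<forall>g\<in>schwartz. (\<forall>(N, is)\<in>I. schwartz_seminorm N is g < \<delta>) \<longrightarrow> norm (u g) < 1"
    by blast
  have "norm (u f) \<le> (1 / \<delta>) * (\<Sum>(N, is)\<in>I. schwartz_seminorm N is f)" if f: "f \<in> schwartz" for f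
  proof -
    define S where "S = (\<Sum>(N, is)\<in>I. schwartz_seminorm N is f)"
    have S0: "0 \<le> S"
      unfolding S_def by (intro sum_nonneg) (auto simp: schwartz_seminorm_nonneg f)
    have le: "schwartz_seminorm N is f \<le> S" if "(N, is) \<in> I" for N "is"
      unfolding S_def using member_le_sum[OF that, of "\<lambda>(N, is). schwartz_seminorm N is f"] I(1)
      by (auto simp: schwartz_seminorm_nonneg f)
    have "\<delta> * norm (u f) \<le> S + e" if e: "e > 0" for e
    proof -
      \<comment> \<open>Scaling by \<open>c\<close> brings every relevant seminorm of f below
        \<delta>. The summand \<open>e\<close> keeps the denominator positive when S = 0 and is
        removed at the end.\<close>
      define c where "c = \<delta> / (S + e)"
      have c: "c > 0"
        unfolding c_def using I(2) S0 e by simp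
      have "schwartz_seminorm N is (\<lambda>x. of_real c * f x) < \<delta>" if "(N, is) \<in> I" for N "is"
      proof -
        have "schwartz_seminorm N is (\<lambda>x. of_real c * f x) \<le> c * schwartz_seminorm N is f"
          using schwartz_seminorm_cmult[OF f, of N "is" "of_real c"] c by simp
        also have "\<dots> \<le> c * S"
          using le[OF that] c by simp
        also have "\<dots> < c * (S + e)"
          using c e by simp
        also have "\<dots> = \<delta>"
          unfolding c_def using S0 e by simp
        finally show ?thesis .
      qed
      then have "norm (u (\<lambda>x. of_real c * f x)) < 1"
        using I(3)[rule_format, OF schwartz_cmult[OF f]] by blast
      then have "c * norm (u f) < 1"
        using c by (simp add: cm[OF f] norm_mult)
      then show ?thesis
        unfolding c_def using S0 e by (simp add: field_simps)
    qed
    then have "\<delta> * norm (u f) \<le> S"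
      by (rule field_le_epsilon)
    then show ?thesis
      using I(2) by (simp add: S_def field_simps)
  qed
  then show ?thesis
    unfolding tempered_functional_def using add I(1) by blast
qed

text \<open>Comparison with a sum over balls of integer radius: a point with integer part of the
  norm equal to j lies in the ball of radius j + 1. The exponent leaves (1 + j)^(-2) after the
  volume of that ball is taken out.\<close>

lemma integrable_wt:
  "integrable lborel (\<lambda>y::'a::euclidean_space. 1 / wt y ^ (DIM('a) + 2))"
proof -
  define M where "M = DIM('a) + 2"
  define B where "B = unit_ball_vol (real DIM('a))"
  have le: "1 / wt y ^ M \<le> (\<Sum>j. ennreal (1 / (1 + real j) ^ M) * indicator (ball 0 (real j + 1)) y)" for y :: 'a
  proof -
    define j where "j = nat \<lfloor>norm y\<rfloor>"
    have j: "real j \<le> norm y" "norm y < real j + 1"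
      unfolding j_def using norm_ge_zero[of y] by auto
    have "ennreal (1 / wt y ^ M) \<le> ennreal (1 / (1 + real j) ^ M)"
      unfolding wt_def using j by (intro ennreal_leI divide_left_mono power_mono) auto
    also have "\<dots> = (\<Sum>k\<in>{j}. ennreal (1 / (1 + real k) ^ M) * indicator (ball 0 (real k + 1)) y)"
      using j by simp
    also have "\<dots> \<le> (\<Sum>j. ennreal (1 / (1 + real j) ^ M) * indicator (ball 0 (real j + 1)) y)"
      by (rule sum_le_suminf) auto
    finally show ?thesis .
  qed
  have "(\<integral>\<^sup>+ y. ennreal (1 / wt y ^ M) \<partial>(lborel :: 'a measure)) \<le>
      (\<integral>\<^sup>+ y. (\<Sum>j. ennreal (1 / (1 + real j) ^ M) * indicator (ball 0 (real j + 1)) y) \<partial>(lborel :: 'a measure))"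
    by (intro nn_integral_mono le)
  also have "\<dots> = (\<Sum>j. \<integral>\<^sup>+ y. ennreal (1 / (1 + real j) ^ M) * indicator (ball 0 (real j + 1)) y \<partial>(lborel :: 'a measure))"
    by (intro nn_integral_suminf borel_measurable_times_ennreal borel_measurable_const borel_measurable_indicator) auto
  also have "\<dots> = (\<Sum>j. ennreal (1 / (1 + real j) ^ M) * ennreal (B * (real j + 1) ^ DIM('a)))"
    by (subst nn_integral_cmult_indicator) (auto simp: emeasure_ball B_def ennreal_mult'')
  also have "\<dots> = (\<Sum>j. ennreal (B * (1 / (1 + real j) ^ 2)))"
  proof (rule suminf_cong)
    fix j
    have "(1 + real j) ^ M = (1 + real j) ^ DIM('a) * (1 + real j) ^ 2"
      by (simp add: M_def power_add power2_eq_square)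
    then show "ennreal (1 / (1 + real j) ^ M) * ennreal (B * (real j + 1) ^ DIM('a)) = ennreal (B * (1 / (1 + real j) ^ 2))"
      by (subst ennreal_mult''[symmetric]) (auto simp: B_def add.commute)
  qed
  also have "\<dots> < \<infinity>"
  proof -
    have "summable (\<lambda>j. B * (1 / (1 + real j) ^ 2))"
      using summable_mult[of "\<lambda>j. inverse (real (Suc j) ^ 2)" B] inverse_power_summable[of 2, where 'a=real]
        summable_Suc_iff[of "\<lambda>j. inverse (real j ^ 2)"]
      by (simp add: field_simps)
    then show ?thesis
      by (subst suminf_ennreal2) (auto simp: B_def)
  qed
  finally show ?thesis
    unfolding M_def[symmetric]
    by (intro integrableI_bounded) (auto simp: wt_def)
qed

lemma borel_measurable_cnj [measurable (raw)]:
  "f \<in> borel_measurable M \<Longrightarrow> (\<lambda>x. cnj (f x)) \<in> borel_measurable M"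
  by (rule borel_measurable_continuous_on[OF continuous_on_cnj[OF continuous_on_id]])

lemma lborel_shift:
  fixes f :: "'a::euclidean_space \<Rightarrow> 'b::{banach, second_countable_topology}"
  assumes "f \<in> borel_measurable borel"
  shows "(\<integral>y. f (a + y) \<partial>lborel) = (\<integral>y. f y \<partial>lborel)"
    and "integrable lborel (\<lambda>y. f (a + y)) \<longleftrightarrow> integrable lborel f"
  using integral_distr[of "(+) a" lborel borel f] integrable_distr_eq[of "(+) a" lborel borel f]
    lborel_distr_plus[of a] assms by auto

lemma lborel_shift_diff:
  fixes f :: "'a::euclidean_space \<Rightarrow> 'b::{banach, second_countable_topology}"
  assumes "f \<in> borel_measurable borel"
  shows "(\<integral>y. f (y - a) \<partial>lborel) = (\<integral>y. f y \<partial>lborel)"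
    and "integrable lborel (\<lambda>y. f (y - a)) \<longleftrightarrow> integrable lborel f"
  using lborel_shift[OF assms, of "- a"] by auto

lemma integral_suminf_dominated:
  fixes g :: "nat \<Rightarrow> 'a::euclidean_space \<Rightarrow> 'b::{banach, second_countable_topology}"
  assumes g: "\<And>n. g n \<in> borel_measurable borel" "\<And>n y. norm (g n y) \<le> \<kappa> n * h y"
    and k: "summable \<kappa>" and h: "integrable lborel h"
  shows "integrable lborel (\<lambda>y. \<Sum>n. g n y)"
    and "(\<lambda>n. \<integral>y. g n y \<partial>lborel) sums (\<integral>y. (\<Sum>n. g n y) \<partial>lborel)"
proof -
  have ig: "integrable lborel (g n)" for n
  proof (rule Bochner_Integration.integrable_bound)
    show "integrable lborel (\<lambda>y. \<kappa> n * h y)"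
      using h by simp
    show "AE y in lborel. norm (g n y) \<le> norm (\<kappa> n * h y)"
      using order_trans[OF g(2) abs_ge_self] by (intro AE_I2) simp
  qed (use g in simp)
  have sg: "summable (\<lambda>n. norm (g n y))" for y
    by (rule summable_comparison_test'[OF summable_mult2[OF k, of "h y"]]) (simp add: g(2))
  have si: "summable (\<lambda>n. \<integral>y. norm (g n y) \<partial>lborel)"
  proof (rule summable_comparison_test'[OF summable_mult2[OF k, of "\<integral>y. h y \<partial>lborel"]])
    fix n
    have "(\<integral>y. norm (g n y) \<partial>lborel) \<le> (\<integral>y. \<kappa> n * h y \<partial>lborel)"
      using g(2) ig h by (intro integral_mono) auto
    then show "norm (\<integral>y. norm (g n y) \<partial>lborel) \<le> \<kappa> n * (\<integral>y. h y \<partial>lborel)"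
      by simp
  qed
  show "integrable lborel (\<lambda>y. \<Sum>n. g n y)"
    by (rule integrable_suminf[OF ig _ si]) (simp add: sg)
  show "(\<lambda>n. \<integral>y. g n y \<partial>lborel) sums (\<integral>y. (\<Sum>n. g n y) \<partial>lborel)"
    by (rule sums_integral[OF ig _ si]) (simp add: sg)
qed

lemma integrable_decay:
  fixes f :: "'a::euclidean_space \<Rightarrow> complex"
  assumes f: "f \<in> borel_measurable borel"
    and le: "\<And>y. norm (f y) \<le> C / wt y ^ (DIM('a) + 2)"
  shows "integrable lborel f"
proof (rule Bochner_Integration.integrable_bound)
  show "integrable lborel (\<lambda>y::'a. C * (1 / wt y ^ (DIM('a) + 2)))"
    by (intro integrable_mult_right integrable_wt)
  show "AE y in lborel. norm (f y) \<le> norm (C * (1 / wt y ^ (DIM('a) + 2)))"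
    using order_trans[OF le abs_ge_self] by (intro AE_I2) simp
qed (use f in simp)

lemma schwartz_borel: "f \<in> schwartz \<Longrightarrow> f \<in> borel_measurable borel"
  by (intro borel_measurable_continuous_onI schwartz_continuous_on)

lemma schwartz_mult_decay:
  fixes f g :: "real ^ 'd::finite \<Rightarrow> complex"
  assumes "f \<in> schwartz" "g \<in> schwartz"
  obtains C where "0 \<le> C" "\<And>y. norm (f y * cnj (g y)) \<le> C / wt y ^ N"
proof -
  obtain C where C: "0 \<le> C" "\<And>y. norm (f y) \<le> C / wt y ^ N"
    using schwartz_decayE[OF assms(1)] by metis
  obtain D where D: "0 \<le> D" "\<And>y. norm (g y) \<le> D / wt y ^ 0"
    using schwartz_decayE[OF assms(2)] by metis
  have "norm (f y * cnj (g y)) \<le> C * D / wt y ^ N" for y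
    using mult_mono[OF C(2)[of y] D(2)[of y]] C(1) by (simp add: norm_mult)
  then show thesis
    using C D that[of "C * D"] by auto
qed

lemma schwartz_mult_integrable:
  fixes f g :: "real ^ 'd::finite \<Rightarrow> complex"
  assumes "f \<in> schwartz" "g \<in> schwartz"
  shows "integrable lborel (\<lambda>y. f y * cnj (g y))"
proof -
  obtain C where "\<And>y. norm (f y * cnj (g y)) \<le> C / wt y ^ (DIM(real ^ 'd) + 2)"
    using schwartz_mult_decay[OF assms] by metis
  moreover have "(\<lambda>y. f y * cnj (g y)) \<in> borel_measurable borel"
    by (intro borel_measurable_continuous_onI continuous_intros schwartz_continuous_on assms)
  ultimately show ?thesis
    by (intro integrable_decay)
qed

lemma schwartz_integrable:
  fixes f :: "real ^ 'd::finite \<Rightarrow> complex"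
  assumes "f \<in> schwartz"
  shows "integrable lborel f"
proof -
  obtain C where "\<And>y. norm (f y) \<le> C / wt y ^ (DIM(real ^ 'd) + 2)"
    using schwartz_decayE[OF assms] by metis
  then show ?thesis
    by (intro integrable_decay schwartz_borel assms)
qed

section \<open>The L2 inner product on Schwartz functions\<close>

lemma l2_inner_lborel:
  assumes "f \<in> schwartz" "g \<in> schwartz"
  shows "l2_inner f g = (\<integral>y. f y * cnj (g y) \<partial>lborel)"
  unfolding l2_inner_def
proof (rule integral_completion)
  have "(\<lambda>y. f y * cnj (g y)) \<in> borel_measurable borel"
    by (intro borel_measurable_continuous_onI continuous_intros schwartz_continuous_on assms)
  then show "(\<lambda>y. f y * cnj (g y)) \<in> borel_measurable lborel"
    by simp
qed

lemma schwartz_norm2_integrable: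
  assumes "f \<in> schwartz"
  shows "integrable lborel (\<lambda>y. (norm (f y))\<^sup>2)"
proof -
  have "(\<lambda>y. norm (f y * cnj (f y))) = (\<lambda>y. (norm (f y))\<^sup>2)"
    by (simp add: norm_mult power2_eq_square)
  then show ?thesis
    using integrable_norm[OF schwartz_mult_integrable[OF assms assms]] by simp
qed

lemma l2_norm_lborel:
  assumes "f \<in> schwartz"
  shows "(l2_norm f)\<^sup>2 = (\<integral>y. (norm (f y))\<^sup>2 \<partial>lborel)"
proof -
  have "(\<integral>y. (norm (f y))\<^sup>2 \<partial>lebesgue) = (\<integral>y. (norm (f y))\<^sup>2 \<partial>lborel)"
    by (rule integral_completion) (use schwartz_borel[OF assms] in measurable)
  then show ?thesis
    by (simp add: l2_norm_def)
qed

lemma schwartz_l2: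
  assumes "f \<in> schwartz"
  shows "f \<in> l2_functions"
proof -
  have [measurable]: "f \<in> borel_measurable lborel"
    using schwartz_borel[OF assms] by simp
  then have "f \<in> borel_measurable lebesgue"
    by (rule measurable_completion)
  moreover have "integrable lebesgue (\<lambda>y. (norm (f y))\<^sup>2)"
    by (subst integrable_completion) (use schwartz_norm2_integrable[OF assms] in auto)
  ultimately show ?thesis
    by (simp add: l2_functions_def)
qed

lemma l2_inner_add_left:
  assumes "f \<in> schwartz" "g \<in> schwartz" "h \<in> schwartz"
  shows "l2_inner (\<lambda>x. f x + g x) h = l2_inner f h + l2_inner g h"
  unfolding l2_inner_lborel[OF assms(1,3)] l2_inner_lborel[OF assms(2,3)]
    l2_inner_lborel[OF schwartz_add[OF assms(1,2)] assms(3)] distrib_right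
  by (intro Bochner_Integration.integral_add schwartz_mult_integrable assms)

lemma l2_inner_cmult_left:
  assumes "f \<in> schwartz" "h \<in> schwartz"
  shows "l2_inner (\<lambda>x. c * f x) h = c * l2_inner f h"
  unfolding l2_inner_lborel[OF assms] l2_inner_lborel[OF schwartz_cmult[OF assms(1)] assms(2)] mult.assoc
  by (intro integral_mult_right_zero)

lemma l2_inner_diff_left:
  assumes "f \<in> schwartz" "g \<in> schwartz" "h \<in> schwartz"
  shows "l2_inner (\<lambda>x. f x - g x) h = l2_inner f h - l2_inner g h"
  unfolding l2_inner_lborel[OF assms(1,3)] l2_inner_lborel[OF assms(2,3)]
    l2_inner_lborel[OF schwartz_diff[OF assms(1,2)] assms(3)] left_diff_distrib
  by (intro Bochner_Integration.integral_diff schwartz_mult_integrable assms)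

lemma l2_inner_commute:
  assumes "f \<in> schwartz" "g \<in> schwartz"
  shows "l2_inner g f = cnj (l2_inner f g)"
proof -
  have "(\<integral>y. cnj (f y * cnj (g y)) \<partial>lborel) = cnj (\<integral>y. f y * cnj (g y) \<partial>lborel)"
    by (intro integral_bounded_linear[OF bounded_linear_cnj] schwartz_mult_integrable assms)
  then show ?thesis
    using assms by (simp add: l2_inner_lborel mult.commute)
qed

lemma l2_inner_self:
  assumes "f \<in> schwartz"
  shows "l2_inner f f = of_real ((l2_norm f)\<^sup>2)"
proof -
  have "(\<integral>y. f y * cnj (f y) \<partial>lborel) = (\<integral>y. complex_of_real ((norm (f y))\<^sup>2) \<partial>lborel)"
    by (intro Bochner_Integration.integral_cong refl complex_norm_square[symmetric])
  also have "\<dots> = of_real (\<integral>y. (norm (f y))\<^sup>2 \<partial>lborel)"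
    by (intro integral_bounded_linear[OF bounded_linear_of_real] schwartz_norm2_integrable assms)
  finally show ?thesis
    using assms by (simp add: l2_inner_lborel l2_norm_lborel)
qed

lemma l2_norm_diff_scaled:
  assumes "f \<in> schwartz" "g \<in> schwartz"
  shows "(l2_norm (\<lambda>x. f x - of_real t * g x))\<^sup>2 =
    (l2_norm f)\<^sup>2 - 2 * t * Re (l2_inner f g) + t\<^sup>2 * (l2_norm g)\<^sup>2"
proof -
  let ?g = "\<lambda>x. of_real t * g x"
  have tg: "?g \<in> schwartz" and d: "(\<lambda>x. f x - ?g x) \<in> schwartz"
    using assms schwartz_cmult schwartz_diff by blast+
  have r: "l2_inner h (\<lambda>x. f x - ?g x) = l2_inner h f - of_real t * l2_inner h g" if "h \<in> schwartz" for h
  proof -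
    have "l2_inner h (\<lambda>x. f x - ?g x) = cnj (l2_inner f h - of_real t * l2_inner g h)"
      by (subst l2_inner_commute[OF d that])
        (simp only: l2_inner_diff_left[OF assms(1) tg that] l2_inner_cmult_left[OF assms(2) that])
    then show ?thesis
      by (simp add: l2_inner_commute[OF assms(1) that] l2_inner_commute[OF assms(2) that])
  qed
  have "of_real ((l2_norm (\<lambda>x. f x - ?g x))\<^sup>2) = l2_inner (\<lambda>x. f x - ?g x) (\<lambda>x. f x - ?g x)"
    by (rule l2_inner_self[OF d, symmetric])
  also have "\<dots> = l2_inner f f - of_real t * l2_inner f g - of_real t * (cnj (l2_inner f g) - of_real t * l2_inner g g)"
    by (simp only: l2_inner_diff_left[OF assms(1) tg d] l2_inner_cmult_left[OF assms(2) d] r[OF assms(1)] r[OF assms(2)]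
        l2_inner_commute[OF assms])
  finally have "Re (of_real ((l2_norm (\<lambda>x. f x - ?g x))\<^sup>2)) = Re (l2_inner f f - of_real t * l2_inner f g - of_real t * (cnj (l2_inner f g) - of_real t * l2_inner g g))"
    by simp
  then show ?thesis
    unfolding l2_inner_self[OF assms(1)] l2_inner_self[OF assms(2)]
    by (simp add: algebra_simps power2_eq_square)
qed

text \<open>The set where f does not vanish is open by continuity and null by the integral, and a
  nonempty open set is not negligible.\<close>

lemma l2_norm_zero_imp:
  assumes f: "f \<in> schwartz" and 0: "l2_norm f = 0"
  shows "f x = 0"
proof -
  have "(\<integral>y. (norm (f y))\<^sup>2 \<partial>lborel) = 0"
    unfolding l2_norm_lborel[OF f, symmetric] 0 by simp
  moreover have "((\<integral>y. (norm (f y))\<^sup>2 \<partial>lborel) = 0) \<longleftrightarrow> (AE y in lborel. (norm (f y))\<^sup>2 = 0)"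
    by (rule integral_nonneg_eq_0_iff_AE[OF schwartz_norm2_integrable[OF f]]) simp
  ultimately have "AE y in lborel. f y = 0"
    by simp
  moreover have "open {y. f y \<noteq> 0}"
    by (rule open_Collect_neq) (auto intro: schwartz_continuous_on f)
  ultimately have "{y. f y \<noteq> 0} \<in> null_sets lborel"
    using AE_iff_null_sets[of "{y. f y \<noteq> 0}" lborel] by simp
  then have "negligible {y. f y \<noteq> 0}"
    by (simp add: negligible_iff_null_sets null_sets_completionI)
  moreover have "open {y. f y \<noteq> 0}"
    by (rule open_Collect_neq) (auto intro: schwartz_continuous_on f)
  ultimately show ?thesis
    using open_not_negligible by blast
qed

lemma tempered_functional_l2_inner:
  fixes h :: "real ^ 'd::finite \<Rightarrow> complex"
  assumes h: "h \<in> schwartz"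
  shows "tempered_functional (\<lambda>f. l2_inner f h)"
  unfolding tempered_functional_def
proof (intro conjI ballI exI)
  show "finite {(0::nat, []::'d list)}"
    by simp
  fix f :: "real ^ 'd \<Rightarrow> complex" assume f: "f \<in> schwartz"
  have "norm (f y) \<le> schwartz_seminorm 0 [] f" for y
    using schwartz_seminorm_upper[OF f, of y 0 "[]"] by simp
  then have "norm (f y * cnj (h y)) \<le> schwartz_seminorm 0 [] f * norm (h y)" for y
    by (simp add: norm_mult mult_right_mono)
  then have "norm (\<integral>y. f y * cnj (h y) \<partial>lborel) \<le> (\<integral>y. schwartz_seminorm 0 [] f * norm (h y) \<partial>lborel)"
    by (intro order_trans[OF integral_norm_bound] integral_mono integrable_norm integrable_mult_right
        schwartz_mult_integrable schwartz_integrable f h)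
  then show "norm (l2_inner f h) \<le> (\<integral>y. norm (h y) \<partial>lborel) * (\<Sum>(N, is)\<in>{(0, [])}. schwartz_seminorm N is f)"
    by (simp add: l2_inner_lborel f h mult.commute)
next
  show "l2_inner (\<lambda>x. f x + g x) h = l2_inner f h + l2_inner g h"
    if "f \<in> schwartz" "g \<in> schwartz" for f g
    using that h by (rule l2_inner_add_left)
qed

section \<open>Decay of short-time Fourier transforms\<close>

text \<open>The mean value inequality along a coordinate segment. A shift by at most 1 changes
  \<open>wt\<close> by a factor of at most 2, which explains \<open>2 ^ N\<close>. The bound
  supplies the integrable majorant for the next limit.\<close>

lemma difference_quotient_decay:
  fixes y :: "real ^ 'd::finite"
  assumes h: "\<And>y. (h has_derivative h' y) (at y)"
    and le: "\<And>y. norm (h' y (axis i 1)) \<le> C / wt y ^ N"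
    and t: "0 < t" "t \<le> 1" and C: "0 \<le> C"
  shows "norm (h (t *\<^sub>R axis i 1 + y) - h y :: complex) \<le> (C * 2 ^ N / wt y ^ N) * t"
proof -
  define B where "B = C * 2 ^ N / wt y ^ N"
  have "norm (h (t *\<^sub>R axis i 1 + y) - h (0 *\<^sub>R axis i 1 + y)) \<le> B * norm (t - 0)"
  proof (rule differentiable_bound[where S="{0..t}" and f="\<lambda>s. h (s *\<^sub>R axis i 1 + y)"
        and f'="\<lambda>s x. x *\<^sub>R h' (s *\<^sub>R axis i 1 + y) (axis i 1)"])
    fix s assume s: "s \<in> {0..t}"
    interpret bounded_linear "h' (s *\<^sub>R axis i 1 + y)"
      using h by (rule has_derivative_bounded_linear)
    have "((\<lambda>s. h (s *\<^sub>R axis i 1 + y)) has_derivative (\<lambda>x. h' (s *\<^sub>R axis i 1 + y) (x *\<^sub>R axis i 1))) (at s within {0..t})"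
      by (rule has_derivative_compose[OF _ h]) (auto intro!: derivative_eq_intros)
    then show "((\<lambda>s. h (s *\<^sub>R axis i 1 + y)) has_derivative (\<lambda>x. x *\<^sub>R h' (s *\<^sub>R axis i 1 + y) (axis i 1))) (at s within {0..t})"
      by (simp add: scaleR)
    have "wt y \<le> wt (y - (s *\<^sub>R axis i 1 + y)) * wt (s *\<^sub>R axis i 1 + y)"
      by (rule wt_le_mult_diff)
    also have "\<dots> \<le> 2 * wt (s *\<^sub>R axis i 1 + y)"
      using s t by (intro mult_right_mono) (auto simp: wt_def)
    finally have "wt y ^ N \<le> 2 ^ N * wt (s *\<^sub>R axis i 1 + y) ^ N"
      by (metis power_mono power_mult_distrib wt_nonneg)
    then have "1 / wt (s *\<^sub>R axis i 1 + y) ^ N \<le> 2 ^ N / wt y ^ N"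
      by (simp add: divide_simps)
    then have "C / wt (s *\<^sub>R axis i 1 + y) ^ N \<le> B"
      unfolding B_def using C mult_left_mono[of _ _ C] by fastforce
    then have "norm (h' (s *\<^sub>R axis i 1 + y) (axis i 1)) \<le> B"
      using le[of "s *\<^sub>R axis i 1 + y"] by linarith
    then show "onorm (\<lambda>x. x *\<^sub>R h' (s *\<^sub>R axis i 1 + y) (axis i 1)) \<le> B"
      by (intro onorm_bound) (auto intro: order_trans[OF norm_ge_zero] simp: mult_left_mono mult.commute[of B])
  qed (use t in auto)
  then show ?thesis
    using t by (simp add: B_def)
qed

text \<open>Translation invariance makes every difference quotient integrate to 0, and dominated
  convergence passes to the derivative. No iterated integration in coordinates is involved.\<close>

lemma integral_partial_derivative_zero:
  fixes h :: "real ^ 'd::finite \<Rightarrow> complex"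
  assumes h: "\<And>y. (h has_derivative h' y) (at y)"
    and hle: "\<And>y. norm (h y) \<le> C / wt y ^ (DIM(real ^ 'd) + 2)"
    and le: "\<And>y. norm (h' y (axis i 1)) \<le> C / wt y ^ (DIM(real ^ 'd) + 2)" and C: "0 \<le> C"
    and cont: "continuous_on UNIV (\<lambda>y. h' y (axis i 1))"
  shows "(\<integral>y. h' y (axis i 1) \<partial>lborel) = 0"
proof -
  define N where "N = DIM(real ^ 'd) + 2"
  define t where "t n = 1 / real (Suc n)" for n
  have t: "0 < t n" "t n \<le> 1" for n
    by (auto simp: t_def)
  have t0: "t \<longlonglongrightarrow> 0"
    unfolding t_def by (rule LIMSEQ_Suc[OF lim_1_over_n])
  define q where "q n y = (1 / t n) *\<^sub>R (h (t n *\<^sub>R axis i 1 + y) - h y)" for n y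
  have ch: "continuous_on S h" for S
    using h by (meson continuous_at_imp_continuous_on has_derivative_continuous)
  have hb: "h \<in> borel_measurable borel"
    by (intro borel_measurable_continuous_onI ch)
  have ih: "integrable lborel h"
    using hle by (intro integrable_decay hb)
  have qb: "q n \<in> borel_measurable borel" for n
    unfolding q_def by (intro borel_measurable_continuous_onI continuous_intros continuous_on_compose2[OF ch[of UNIV]]) auto
  have qi: "(\<integral>y. q n y \<partial>lborel) = 0" for n
    unfolding q_def using lborel_shift[OF hb, of "t n *\<^sub>R axis i 1"] ih by simp
  have qle: "norm (q n y) \<le> C * 2 ^ N * (1 / wt y ^ N)" for n y
  proof -
    have "norm (q n y) = norm (h (t n *\<^sub>R axis i 1 + y) - h y) / t n"
      unfolding q_def using t[of n] by simp
    also have "\<dots> \<le> C * 2 ^ N / wt y ^ N"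
      using difference_quotient_decay[OF h le t C, of n y] t[of n] by (simp add: N_def field_simps)
    finally show ?thesis by simp
  qed
  have lim: "(\<lambda>n. q n y) \<longlonglongrightarrow> h' y (axis i 1)" for y
  proof -
    interpret bounded_linear "h' y"
      using h by (rule has_derivative_bounded_linear)
    have "((\<lambda>s. h (s *\<^sub>R axis i 1 + y)) has_derivative (\<lambda>x. h' (0 *\<^sub>R axis i 1 + y) (x *\<^sub>R axis i 1))) (at 0)"
      by (rule has_derivative_compose[OF _ h]) (auto intro!: derivative_eq_intros)
    then have "((\<lambda>s. norm (h (s *\<^sub>R axis i 1 + y) - h y - s *\<^sub>R h' y (axis i 1)) / norm s) \<longlongrightarrow> 0) (at 0)"
      unfolding has_derivative_iff_norm by (simp add: scaleR)
    then have "((\<lambda>s. norm ((1 / s) *\<^sub>R (h (s *\<^sub>R axis i 1 + y) - h y) - h' y (axis i 1))) \<longlongrightarrow> 0) (at 0)"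
    proof (rule Lim_transform_eventually)
      have "norm (h (s *\<^sub>R axis i 1 + y) - h y - s *\<^sub>R h' y (axis i 1)) / norm s =
          norm ((1 / s) *\<^sub>R (h (s *\<^sub>R axis i 1 + y) - h y) - h' y (axis i 1))" if "s \<noteq> 0" for s
      proof -
        have "(1 / s) *\<^sub>R (h (s *\<^sub>R axis i 1 + y) - h y) - h' y (axis i 1) =
            (1 / s) *\<^sub>R (h (s *\<^sub>R axis i 1 + y) - h y - s *\<^sub>R h' y (axis i 1))"
          using that by (simp add: scaleR_diff_right)
        then show ?thesis
          by simp
      qed
      then show "\<forall>\<^sub>F s in at 0. norm (h (s *\<^sub>R axis i 1 + y) - h y - s *\<^sub>R h' y (axis i 1)) / norm s =
          norm ((1 / s) *\<^sub>R (h (s *\<^sub>R axis i 1 + y) - h y) - h' y (axis i 1))"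
        by (auto simp: eventually_at_filter)
    qed
    then have "((\<lambda>s. (1 / s) *\<^sub>R (h (s *\<^sub>R axis i 1 + y) - h y)) \<longlongrightarrow> h' y (axis i 1)) (at 0)"
      using Lim_null tendsto_norm_zero_iff by blast
    moreover have "filterlim t (at 0) sequentially"
      using t0 t by (auto simp: filterlim_at less_imp_neq[symmetric] intro!: always_eventually)
    ultimately show ?thesis
      unfolding q_def by (rule filterlim_compose)
  qed
  have "(\<lambda>n. \<integral>y. q n y \<partial>lborel) \<longlonglongrightarrow> (\<integral>y. h' y (axis i 1) \<partial>lborel)"
  proof (rule integral_dominated_convergence[where w="\<lambda>y. C * 2 ^ N * (1 / wt y ^ N)"])
    show "integrable lborel (\<lambda>y::real ^ 'd. C * 2 ^ N * (1 / wt y ^ N))"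
      unfolding N_def by (intro integrable_mult_right integrable_wt)
    show "(\<lambda>y. h' y (axis i 1)) \<in> borel_measurable lborel"
      using borel_measurable_continuous_onI[OF cont] by simp
  qed (use qb qle lim in auto)
  then have "(\<lambda>n. 0) \<longlonglongrightarrow> (\<integral>y. h' y (axis i 1) \<partial>lborel)"
    by (simp add: qi)
  then show ?thesis
    using LIMSEQ_unique tendsto_const by blast
qed

text \<open>The derivative of \<open>tf_shift z f * cnj g\<close> integrates to 0. Differentiating
  the modulation produces the frequency coordinate, so one power of frequency is traded for one
  derivative of f or g.\<close>

lemma l2_inner_tf_shift_by_parts:
  assumes f: "f \<in> schwartz" and g: "g \<in> schwartz"
  shows "\<i> * complex_of_real (snd z $ i) * l2_inner (tf_shift z f) g =
    - l2_inner (tf_shift z (partial_deriv i f)) g - l2_inner (tf_shift z f) (partial_deriv i g)"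
proof -
  let ?F = "tf_shift z f" and ?D = "\<lambda>f. partial_deriv i f"
  have F: "?F \<in> schwartz" and DF: "?D ?F \<in> schwartz" and Dg: "?D g \<in> schwartz"
    and P: "tf_shift z (?D f) \<in> schwartz"
    using f g by (auto intro: schwartz_tf_shift schwartz_partial_deriv)
  define h' where "h' y v = ?F y * cnj (frechet_derivative g (at y) v) + frechet_derivative ?F (at y) v * cnj (g y)" for y v
  have der: "((\<lambda>y. ?F y * cnj (g y)) has_derivative h' y) (at y)" for y
    unfolding h'_def
    by (intro has_derivative_mult smooth_frechet schwartz_smooth F has_derivative_cnj g)
  have h'_eq: "h' y (axis i 1) = ?F y * cnj (?D g y) + ?D ?F y * cnj (g y)" for y
    by (simp add: h'_def partial_deriv_def)
  obtain C0 where C0: "0 \<le> C0" "\<And>y. norm (?F y * cnj (g y)) \<le> C0 / wt y ^ (DIM(real ^ 'a) + 2)"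
    using schwartz_mult_decay[OF F g] by metis
  obtain C1 where C1: "0 \<le> C1" "\<And>y. norm (?F y * cnj (?D g y)) \<le> C1 / wt y ^ (DIM(real ^ 'a) + 2)"
    using schwartz_mult_decay[OF F Dg] by metis
  obtain C2 where C2: "0 \<le> C2" "\<And>y. norm (?D ?F y * cnj (g y)) \<le> C2 / wt y ^ (DIM(real ^ 'a) + 2)"
    using schwartz_mult_decay[OF DF g] by metis
  have "(\<integral>y. h' y (axis i 1) \<partial>lborel) = 0"
  proof (rule integral_partial_derivative_zero[OF der, where C="C0 + C1 + C2"])
    fix y :: "real ^ 'a"
    have "C0 / wt y ^ (DIM(real ^ 'a) + 2) \<le> (C0 + C1 + C2) / wt y ^ (DIM(real ^ 'a) + 2)"
      using C1 C2 by (intro divide_right_mono) auto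
    then show "norm (?F y * cnj (g y)) \<le> (C0 + C1 + C2) / wt y ^ (DIM(real ^ 'a) + 2)"
      using C0(2)[of y] by linarith
    have "norm (h' y (axis i 1)) \<le> C1 / wt y ^ (DIM(real ^ 'a) + 2) + C2 / wt y ^ (DIM(real ^ 'a) + 2)"
      unfolding h'_eq by (intro norm_triangle_mono C1 C2)
    also have "\<dots> \<le> (C0 + C1 + C2) / wt y ^ (DIM(real ^ 'a) + 2)"
      unfolding add_divide_distrib[symmetric] using C0 by (intro divide_right_mono) auto
    finally show "norm (h' y (axis i 1)) \<le> (C0 + C1 + C2) / wt y ^ (DIM(real ^ 'a) + 2)" .
  next
    show "continuous_on UNIV (\<lambda>y. h' y (axis i 1))"
      unfolding h'_eq by (intro continuous_intros schwartz_continuous_on F DF Dg g)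
  qed (use C0 C1 C2 in auto)
  then have "l2_inner ?F (?D g) + l2_inner (?D ?F) g = 0"
    unfolding h'_eq using F DF Dg g by (simp add: l2_inner_lborel schwartz_mult_integrable)
  moreover have "l2_inner (?D ?F) g = \<i> * complex_of_real (snd z $ i) * l2_inner ?F g + l2_inner (tf_shift z (?D f)) g"
    unfolding partial_deriv_tf_shift[OF schwartz_smooth[OF f]]
    by (subst l2_inner_add_left[OF schwartz_cmult[OF F] P g]) (simp add: l2_inner_cmult_left[OF F g])
  ultimately show ?thesis
    by algebra
qed

text \<open>Peetre's inequality distributes the weight of the translation over f and g; the
  additional \<open>N\<close> powers of decay of g make the integral converge.\<close>

lemma l2_inner_translate_decay:
  fixes f g :: "real ^ 'd::finite \<Rightarrow> complex"
  assumes f: "f \<in> schwartz" and g: "g \<in> schwartz"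
  shows "\<exists>C. \<forall>z. wt (fst z) ^ M * norm (l2_inner (tf_shift z f) g) \<le> C"
proof -
  define N where "N = DIM(real ^ 'd) + 2"
  have iw: "integrable lborel (\<lambda>y::real ^ 'd. 1 / wt y ^ N)"
    unfolding N_def by (rule integrable_wt)
  obtain C where C: "0 \<le> C" "\<And>y. norm (f y) \<le> C / wt y ^ M"
    using schwartz_decayE[OF f] by metis
  obtain D where D: "0 \<le> D" "\<And>y. norm (g y) \<le> D / wt y ^ (M + N)"
    using schwartz_decayE[OF g] by metis
  have "wt (fst z) ^ M * norm (l2_inner (tf_shift z f) g) \<le> (\<integral>y. C * D * (1 / wt (y::real ^ 'd) ^ N) \<partial>lborel)" for z :: "(real ^ 'd) \<times> (real ^ 'd)"
  proof -
    have ptw: "norm (wt (fst z) ^ M *\<^sub>R (tf_shift z f y * cnj (g y))) \<le> C * D * (1 / wt y ^ N)" for y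
    proof -
      have w: "wt (fst z) ^ M \<le> wt (y - fst z) ^ M * wt y ^ M"
        using wt_le_mult_diff[of "fst z" y] by (metis power_mono power_mult_distrib wt_nonneg wt_minus)
      have "norm (wt (fst z) ^ M *\<^sub>R (tf_shift z f y * cnj (g y))) = wt (fst z) ^ M * (norm (f (y - fst z)) * norm (g y))"
        by (simp add: norm_mult norm_tf_shift)
      also have "\<dots> \<le> (wt (y - fst z) ^ M * wt y ^ M) * ((C / wt (y - fst z) ^ M) * (D / wt y ^ (M + N)))"
        by (intro mult_mono w C D) (auto simp: C D)
      also have "\<dots> = C * D * (1 / wt y ^ N)"
        by (simp add: power_add)
      finally show ?thesis .
    qed
    have z: "tf_shift z f \<in> schwartz"
      by (rule schwartz_tf_shift[OF f])
    have "wt (fst z) ^ M * norm (l2_inner (tf_shift z f) g) = norm (\<integral>y. wt (fst z) ^ M *\<^sub>R (tf_shift z f y * cnj (g y)) \<partial>lborel)"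
      by (simp add: l2_inner_lborel z g)
    also have "\<dots> \<le> (\<integral>y. C * D * (1 / wt (y::real ^ 'd) ^ N) \<partial>lborel)"
      by (intro order_trans[OF integral_norm_bound] integral_mono integrable_norm integrable_mult_right
          integrable_scaleR_right schwartz_mult_integrable z g ptw iw)
    finally show ?thesis .
  qed
  then show ?thesis by blast
qed

text \<open>Each power of the frequency coordinate is paid for by one integration by parts, which
  moves a derivative onto f or g. Both are Schwartz again, so the induction keeps them
  arbitrary.\<close>

lemma l2_inner_tf_shift_decay1:
  fixes f g :: "real ^ 'd::finite \<Rightarrow> complex"
  assumes "f \<in> schwartz" "g \<in> schwartz"
  shows "\<exists>C. \<forall>z. (1 + \<bar>snd z $ i\<bar>) ^ N * (wt (fst z) ^ M * norm (l2_inner (tf_shift z f) g)) \<le> C"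
  using assms
proof (induction N arbitrary: f g)
  case 0
  then show ?case using l2_inner_translate_decay by simp
next
  case (Suc N)
  let ?D = "\<lambda>f. partial_deriv i f"
  let ?I = "\<lambda>f g z. wt (fst z) ^ M * norm (l2_inner (tf_shift z f) g)"
  let ?s = "\<lambda>z. 1 + \<bar>snd z $ i\<bar>"
  obtain C0 where C0: "\<And>z. ?s z ^ N * ?I f g z \<le> C0"
    using Suc.IH[OF Suc.prems] by blast
  obtain C1 where C1: "\<And>z. ?s z ^ N * ?I (?D f) g z \<le> C1"
    using Suc.IH[OF schwartz_partial_deriv[OF Suc.prems(1)] Suc.prems(2)] by blast
  obtain C2 where C2: "\<And>z. ?s z ^ N * ?I f (?D g) z \<le> C2"
    using Suc.IH[OF Suc.prems(1) schwartz_partial_deriv[OF Suc.prems(2)]] by blast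
  have "?s z ^ Suc N * ?I f g z \<le> C0 + (C1 + C2)" for z
  proof -
    have "\<bar>snd z $ i\<bar> * norm (l2_inner (tf_shift z f) g) = norm (\<i> * complex_of_real (snd z $ i) * l2_inner (tf_shift z f) g)"
      by (simp add: norm_mult)
    also have "\<dots> \<le> norm (l2_inner (tf_shift z (?D f)) g) + norm (l2_inner (tf_shift z f) (?D g))"
      unfolding l2_inner_tf_shift_by_parts[OF Suc.prems]
      by (metis norm_minus_cancel norm_triangle_ineq4)
    finally have "(?s z ^ N * wt (fst z) ^ M) * (\<bar>snd z $ i\<bar> * norm (l2_inner (tf_shift z f) g)) \<le>
        (?s z ^ N * wt (fst z) ^ M) * (norm (l2_inner (tf_shift z (?D f)) g) + norm (l2_inner (tf_shift z f) (?D g)))"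
      by (intro mult_left_mono) auto
    then have "?s z ^ N * ?I f g z * \<bar>snd z $ i\<bar> \<le> ?s z ^ N * ?I (?D f) g z + ?s z ^ N * ?I f (?D g) z"
      by (simp add: algebra_simps)
    then have "?s z ^ N * ?I f g z + ?s z ^ N * ?I f g z * \<bar>snd z $ i\<bar> \<le> C0 + (C1 + C2)"
      using C0[of z] C1[of z] C2[of z] by linarith
    then show ?thesis
      by (simp add: algebra_simps)
  qed
  then show ?case by blast
qed

lemma l2_inner_tf_shift_decay0:
  fixes f g :: "real ^ 'd::finite \<Rightarrow> complex"
  assumes "f \<in> schwartz" "g \<in> schwartz"
  shows "\<exists>C. \<forall>z. wt z ^ N * norm (l2_inner (tf_shift z f) g) \<le> C"
proof -
  let ?n = "real CARD('d)"
  have "\<forall>i. \<exists>C. \<forall>z. (1 + \<bar>snd z $ i\<bar>) ^ N * (wt (fst z) ^ N * norm (l2_inner (tf_shift z f) g)) \<le> C"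
    using l2_inner_tf_shift_decay1[OF assms] by blast
  then obtain C where C: "\<And>i z. (1 + \<bar>snd z $ i\<bar>) ^ N * (wt (fst z) ^ N * norm (l2_inner (tf_shift z f) g)) \<le> C i"
    by (metis choice)
  have "wt z ^ N * norm (l2_inner (tf_shift z f) g) \<le> ?n ^ N * (\<Sum>i\<in>UNIV. \<bar>C i\<bar>)" for z
  proof -
    \<comment> \<open>The coordinate \<open>j\<close> of largest modulus controls the whole
      frequency vector up to a factor \<open>CARD('d)\<close>, so the bounds in single coordinates
      suffice.\<close>
    have "Max (range (\<lambda>i. \<bar>snd z $ i\<bar>)) \<in> range (\<lambda>i. \<bar>snd z $ i\<bar>)"
      by (intro Max_in) auto
    then obtain j where "Max (range (\<lambda>i. \<bar>snd z $ i\<bar>)) = \<bar>snd z $ j\<bar>"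
      by blast
    then have j: "\<bar>snd z $ i\<bar> \<le> \<bar>snd z $ j\<bar>" for i
      by (metis Max_ge finite finite_imageI rangeI)
    have "norm (snd z) \<le> (\<Sum>i\<in>UNIV. \<bar>snd z $ i\<bar>)"
      by (rule norm_le_l1_cart)
    also have "\<dots> \<le> ?n * \<bar>snd z $ j\<bar>"
      using sum_bounded_above[of UNIV "\<lambda>i. \<bar>snd z $ i\<bar>" "\<bar>snd z $ j\<bar>"] j by simp
    finally have "norm (snd z) \<le> ?n * \<bar>snd z $ j\<bar>" .
    moreover have "1 \<le> ?n"
      by simp
    ultimately have 1: "wt (snd z) \<le> ?n * (1 + \<bar>snd z $ j\<bar>)"
      unfolding wt_def distrib_left by linarith
    have "wt z \<le> wt (fst z) * wt (snd z)"
      using wt_add_le[of "(fst z, 0)" "(0, snd z)"] by (simp add: wt_def)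
    also have "\<dots> \<le> wt (fst z) * (?n * (1 + \<bar>snd z $ j\<bar>))"
      by (intro mult_left_mono 1) auto
    finally have "wt z ^ N \<le> (wt (fst z) * (?n * (1 + \<bar>snd z $ j\<bar>))) ^ N"
      by (intro power_mono) auto
    then have "wt z ^ N * norm (l2_inner (tf_shift z f) g) \<le> (wt (fst z) * (?n * (1 + \<bar>snd z $ j\<bar>))) ^ N * norm (l2_inner (tf_shift z f) g)"
      by (intro mult_right_mono) auto
    also have "\<dots> = ?n ^ N * ((1 + \<bar>snd z $ j\<bar>) ^ N * (wt (fst z) ^ N * norm (l2_inner (tf_shift z f) g)))"
      by (simp add: power_mult_distrib)
    also have "\<dots> \<le> ?n ^ N * C j"
      by (intro mult_left_mono C) auto
    also have "\<dots> \<le> ?n ^ N * (\<Sum>i\<in>UNIV. \<bar>C i\<bar>)"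
    proof (intro mult_left_mono)
      have "\<bar>C j\<bar> \<le> (\<Sum>i\<in>UNIV. \<bar>C i\<bar>)"
        by (rule member_le_sum) auto
      then show "C j \<le> (\<Sum>i\<in>UNIV. \<bar>C i\<bar>)"
        by linarith
    qed auto
    finally show ?thesis .
  qed
  then show ?thesis by blast
qed

text \<open>Time-frequency shifts form a projective representation: undoing \<open>w\<close> in both
  arguments leaves the shift by z - w and the unimodular phase \<open>c\<close>. This is what makes
  the later constants independent of the base point.\<close>

lemma l2_inner_tf_shift_tf_shift:
  assumes f: "f \<in> schwartz" and g: "g \<in> schwartz"
  shows "norm (l2_inner (tf_shift z f) (tf_shift w g)) = norm (l2_inner (tf_shift (z - w) f) g)"
proof -
  let ?h = "\<lambda>y. tf_shift z f y * cnj (tf_shift w g y)"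
  define c where "c = exp (\<i> * complex_of_real (fst w \<bullet> (snd z - snd w)))"
  have nc: "norm c = 1"
    by (simp add: c_def)
  have h: "?h (fst w + y) = c * (tf_shift (z - w) f y * cnj (g y))" for y
  proof -
    have "cnj (exp (\<i> * complex_of_real ((fst w + y) \<bullet> snd w))) = exp (- (\<i> * complex_of_real ((fst w + y) \<bullet> snd w)))"
      by (simp add: exp_cnj)
    moreover have "exp (\<i> * complex_of_real ((fst w + y) \<bullet> snd z)) * exp (- (\<i> * complex_of_real ((fst w + y) \<bullet> snd w))) =
       c * exp (\<i> * complex_of_real (y \<bullet> (snd z - snd w)))"
      unfolding c_def exp_add[symmetric] by (simp add: inner_add_left inner_diff_right algebra_simps)
    moreover have "fst w + y - fst z = y - fst (z - w)" "fst w + y - fst w = y"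
      by auto
    ultimately show ?thesis
      by (simp add: tf_shift_apply algebra_simps)
  qed
  have "?h \<in> borel_measurable borel"
    by (intro borel_measurable_continuous_onI continuous_intros schwartz_continuous_on schwartz_tf_shift f g)
  then have "(\<integral>y. ?h y \<partial>lborel) = (\<integral>y. c * (tf_shift (z - w) f y * cnj (g y)) \<partial>lborel)"
    using lborel_shift(1)[of ?h "fst w"] by (simp only: h)
  then have "l2_inner (tf_shift z f) (tf_shift w g) = c * l2_inner (tf_shift (z - w) f) g"
    by (simp add: l2_inner_lborel schwartz_tf_shift f g)
  then show ?thesis
    by (simp add: norm_mult nc)
qed

lemma l2_inner_tf_shift_decayE:
  fixes f g :: "real ^ 'd::finite \<Rightarrow> complex"
  assumes "f \<in> schwartz" "g \<in> schwartz"
  obtains C where "0 \<le> C" "\<And>z w. norm (l2_inner (tf_shift z f) (tf_shift w g)) \<le> C / wt (z - w) ^ N"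
proof -
  obtain C where C: "\<And>z. wt z ^ N * norm (l2_inner (tf_shift z f) g) \<le> C"
    using l2_inner_tf_shift_decay0[OF assms] by blast
  have "0 \<le> C"
    by (intro order_trans[OF _ C[of 0]]) simp
  moreover have "norm (l2_inner (tf_shift z f) (tf_shift w g)) \<le> C / wt (z - w) ^ N" for z w
    unfolding l2_inner_tf_shift_tf_shift[OF assms]
    using C[of "z - w"] by (simp add: pos_le_divide_eq mult.commute)
  ultimately show thesis
    using that by blast
qed

section \<open>Separated point sets and the Schur test\<close>

text \<open>The balls of radius \<delta>/2 around the points are disjoint and have the same volume
  \<open>V\<close>. On each of them the weight is comparable to its value at the centre, up to
  \<open>(1 + \<delta>) ^ M\<close>, so \<open>V\<close> times the sum is at most a multiple of an
  integral that does not depend on z.\<close>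

lemma separated_sum_bound:
  fixes p :: "nat \<Rightarrow> 'a::euclidean_space"
  assumes \<delta>: "\<delta> > 0" and sep: "\<And>m n. m \<noteq> n \<Longrightarrow> \<delta> \<le> dist (p m) (p n)"
  obtains \<sigma> where "0 \<le> \<sigma>" "\<And>z. summable (\<lambda>n. 1 / wt (p n - z) ^ (DIM('a) + 2))"
    "\<And>z. (\<Sum>n. 1 / wt (p n - z) ^ (DIM('a) + 2)) \<le> \<sigma>"
proof -
  define M where "M = DIM('a) + 2"
  define I where "I = (\<integral>y. 1 / wt (y::'a) ^ M \<partial>lborel)"
  define V where "V = measure lborel (ball (0::'a) (\<delta> / 2))"
  have Vp: "measure lborel (ball x (\<delta> / 2)) = V" for x :: 'a
    using \<delta> by (simp add: V_def content_ball)
  have V: "V > 0"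
    using \<delta> content_ball_pos[of "\<delta> / 2" "0::'a"] by (simp add: V_def)
  have bm: "(\<lambda>y::'a. 1 / wt y ^ M) \<in> borel_measurable borel"
    unfolding wt_def by measurable
  have iw: "integrable lborel (\<lambda>y. 1 / wt (y - z) ^ M)" "(\<integral>y. 1 / wt (y - z) ^ M \<partial>lborel) = I" for z :: 'a
    using lborel_shift_diff[OF bm, of z] integrable_wt[where 'a='a] by (simp_all add: I_def M_def)
  have fin: "(\<Sum>n<m. 1 / wt (p n - z) ^ M) \<le> (1 + \<delta>) ^ M * I / V" for m z
  proof -
    define g where "g n y = indicator (ball (p n) (\<delta> / 2)) y * (1 / wt (p n - z) ^ M)" for n y
    have ig: "integrable lborel (g n)" for n
      unfolding g_def by (intro integrable_mult_left integrable_real_indicator) (auto simp: emeasure_lborel_ball_finite[unfolded infinity_ennreal_def])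
    have eq: "(\<integral>y. g n y \<partial>lborel) = V * (1 / wt (p n - z) ^ M)" for n
      unfolding g_def by (simp add: Vp)
    have ptw: "(\<Sum>n<m. g n y) \<le> (1 + \<delta>) ^ M * (1 / wt (y - z) ^ M)" for y
    proof (cases "\<exists>k. y \<in> ball (p k) (\<delta> / 2)")
      case True
      then obtain k where k: "dist (p k) y < \<delta> / 2" by auto
      have "g n y = (if n = k then 1 / wt (p k - z) ^ M else 0)" for n
      proof (cases "n = k")
        case False
        then have "\<not> dist (p n) y < \<delta> / 2"
          using sep[OF False] k dist_triangle2[of "p n" "p k" y] by linarith
        then show ?thesis
          using False by (simp add: g_def)
      qed (use k in \<open>simp add: g_def\<close>)
      then have "(\<Sum>n<m. g n y) \<le> 1 / wt (p k - z) ^ M"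
        by simp
      also have "\<dots> \<le> (1 + \<delta>) ^ M * (1 / wt (y - z) ^ M)"
      proof -
        have "wt (y - z) \<le> wt (y - p k) * wt (p k - z)"
          using wt_add_le[of "y - p k" "p k - z"] by simp
        also have "\<dots> \<le> (1 + \<delta>) * wt (p k - z)"
          using k \<delta> by (intro mult_right_mono) (auto simp: wt_def dist_norm norm_minus_commute)
        finally have "wt (y - z) ^ M \<le> (1 + \<delta>) ^ M * wt (p k - z) ^ M"
          by (metis power_mono power_mult_distrib wt_nonneg)
        then show ?thesis
          by (simp add: divide_simps)
      qed
      finally show ?thesis .
    next
      case False
      then show ?thesis
        using \<delta> by (simp add: g_def)
    qed
    have "V * (\<Sum>n<m. 1 / wt (p n - z) ^ M) = (\<integral>y. (\<Sum>n<m. g n y) \<partial>lborel)"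
      using ig by (simp add: eq sum_distrib_left)
    also have "\<dots> \<le> (\<integral>y. (1 + \<delta>) ^ M * (1 / wt (y - z) ^ M) \<partial>lborel)"
      by (intro integral_mono integrable_mult_right iw Bochner_Integration.integrable_sum ig ptw)
    also have "\<dots> = (1 + \<delta>) ^ M * I"
      unfolding iw(2)[of z, symmetric] by (rule integral_mult_right_zero)
    finally show ?thesis
      using V by (simp add: field_simps)
  qed
  have s: "summable (\<lambda>n. 1 / wt (p n - z) ^ M)" for z
    by (rule bounded_imp_summable[where B="(1 + \<delta>) ^ M * I / V"])
      (use fin[of z "Suc _"] in \<open>auto simp: lessThan_Suc_atMost\<close>)
  moreover have "(\<Sum>n. 1 / wt (p n - z) ^ M) \<le> (1 + \<delta>) ^ M * I / V" for z
    by (rule suminf_le_const[OF s fin])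
  moreover have "0 \<le> (1 + \<delta>) ^ M * I / V"
    using fin[of _ 0] by simp
  ultimately show thesis
    using that unfolding M_def by blast
qed

section \<open>Square-summable sequences and matrices acting on them\<close>

definition ell2 :: "(nat \<Rightarrow> complex) set"
  where "ell2 = {c. summable (\<lambda>n. (norm (c n))\<^sup>2)}"

definition ell2_norm :: "(nat \<Rightarrow> complex) \<Rightarrow> real"
  where "ell2_norm c = sqrt (\<Sum>n. (norm (c n))\<^sup>2)"

lemma ell2_norm_power2: "c \<in> ell2 \<Longrightarrow> (ell2_norm c)\<^sup>2 = (\<Sum>n. (norm (c n))\<^sup>2)"
  unfolding ell2_def ell2_norm_def by (simp add: suminf_nonneg)

lemma ell2_norm_nonneg: "c \<in> ell2 \<Longrightarrow> 0 \<le> ell2_norm c"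
  unfolding ell2_def ell2_norm_def by (simp add: suminf_nonneg)

lemma ell2_L2_set_le:
  assumes "c \<in> ell2"
  shows "L2_set (\<lambda>n. norm (c n)) {..<m} \<le> ell2_norm c"
  unfolding L2_set_def ell2_norm_def
  using assms by (intro real_sqrt_le_mono sum_le_suminf) (auto simp: ell2_def)

lemma ell2I:
  assumes "0 \<le> B" "\<And>m. (\<Sum>n<m. (norm (c n))\<^sup>2) \<le> B\<^sup>2"
  shows "c \<in> ell2" "ell2_norm c \<le> B"
proof -
  have s: "summable (\<lambda>n. (norm (c n))\<^sup>2)"
    by (rule bounded_imp_summable[where B="B\<^sup>2"]) (use assms(2)[of "Suc _"] in \<open>auto simp: lessThan_Suc_atMost\<close>)
  then show "c \<in> ell2"
    by (simp add: ell2_def)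
  have "(\<Sum>n. (norm (c n))\<^sup>2) \<le> B\<^sup>2"
    by (rule suminf_le_const[OF s assms(2)])
  then show "ell2_norm c \<le> B"
    unfolding ell2_norm_def using assms(1) by (rule real_le_lsqrt[rotated -1])
qed

lemma ell2_triangle:
  assumes "c \<in> ell2" "d \<in> ell2"
  shows "(\<lambda>n. c n + d n) \<in> ell2" "ell2_norm (\<lambda>n. c n + d n) \<le> ell2_norm c + ell2_norm d"
proof -
  have "(\<Sum>n<m. (norm (c n + d n))\<^sup>2) \<le> (ell2_norm c + ell2_norm d)\<^sup>2" for m
  proof -
    have "L2_set (\<lambda>n. norm (c n + d n)) {..<m} \<le> L2_set (\<lambda>n. norm (c n) + norm (d n)) {..<m}"
      by (intro L2_set_mono norm_triangle_ineq) auto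
    also have "\<dots> \<le> ell2_norm c + ell2_norm d"
      by (intro order_trans[OF L2_set_triangle_ineq] add_mono ell2_L2_set_le assms)
    finally have "sqrt (\<Sum>n<m. (norm (c n + d n))\<^sup>2) \<le> ell2_norm c + ell2_norm d"
      by (simp add: L2_set_def)
    then show ?thesis
      by (rule sqrt_le_D)
  qed
  then show "(\<lambda>n. c n + d n) \<in> ell2" "ell2_norm (\<lambda>n. c n + d n) \<le> ell2_norm c + ell2_norm d"
    using ell2I[of "ell2_norm c + ell2_norm d" "\<lambda>n. c n + d n"] assms by (auto simp: ell2_norm_nonneg)
qed

lemma ell2_Cauchy_Schwarz:
  assumes "c \<in> ell2" "d \<in> ell2"
  shows "summable (\<lambda>n. norm (c n) * norm (d n))"
    "(\<Sum>n. norm (c n) * norm (d n)) \<le> ell2_norm c * ell2_norm d"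
proof -
  have le: "(\<Sum>n<m. norm (c n) * norm (d n)) \<le> ell2_norm c * ell2_norm d" for m
  proof -
    have "(\<Sum>n<m. \<bar>norm (c n)\<bar> * \<bar>norm (d n)\<bar>) \<le> L2_set (\<lambda>n. norm (c n)) {..<m} * L2_set (\<lambda>n. norm (d n)) {..<m}"
      by (rule L2_set_mult_ineq)
    also have "\<dots> \<le> ell2_norm c * ell2_norm d"
      by (intro mult_mono ell2_L2_set_le assms ell2_norm_nonneg L2_set_nonneg)
    finally show ?thesis by simp
  qed
  show s: "summable (\<lambda>n. norm (c n) * norm (d n))"
    by (rule bounded_imp_summable[where B="ell2_norm c * ell2_norm d"])
      (use le[of "Suc _"] in \<open>auto simp: lessThan_Suc_atMost\<close>)
  show "(\<Sum>n. norm (c n) * norm (d n)) \<le> ell2_norm c * ell2_norm d"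
    by (rule suminf_le_const[OF s le])
qed

text \<open>Cauchy-Schwarz after splitting k |c| into sqrt(k) times sqrt(k) |c| bounds each row by s
  times a weighted sum of squares. Summing over the rows uses the column sums, which equal the row
  sums by symmetry.\<close>

lemma Schur_test:
  fixes k :: "nat \<Rightarrow> nat \<Rightarrow> real"
  assumes K: "\<And>m n. norm (K m n :: complex) \<le> k m n"
    and sym: "\<And>m n. k m n = k n m"
    and sk: "\<And>m. summable (k m)" "\<And>m. suminf (k m) \<le> s"
    and c: "c \<in> ell2"
  shows "(\<lambda>m. \<Sum>n. K m n * c n) \<in> ell2" and "ell2_norm (\<lambda>m. \<Sum>n. K m n * c n) \<le> s * ell2_norm c"
proof -
  have k0: "0 \<le> k m n" for m n
    using K[of m n] norm_ge_zero order_trans by blast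
  have s0: "0 \<le> s"
    using sk(2)[of 0] suminf_nonneg[OF sk(1)[of 0] k0] by linarith
  have kle: "k m n \<le> s" for m n
    using sum_le_suminf[OF sk(1)[of m], of "{n}"] sk(2)[of m] k0 by force
  have sc: "summable (\<lambda>n. (norm (c n))\<^sup>2)"
    using c by (simp add: ell2_def)
  have skc: "summable (\<lambda>n. k m n * (norm (c n))\<^sup>2)" for m
    by (rule summable_comparison_test'[OF summable_mult[OF sc, of s]])
      (simp add: k0 kle mult_right_mono)
  have e1: "(\<lambda>n. complex_of_real (sqrt (k m n))) \<in> ell2"
    and e2: "(\<lambda>n. complex_of_real (sqrt (k m n)) * c n) \<in> ell2" for m
    using sk(1)[of m] skc[of m] by (simp_all add: ell2_def norm_mult power_mult_distrib k0)
  have eq: "norm (complex_of_real (sqrt (k m n))) * norm (complex_of_real (sqrt (k m n)) * c n) = k m n * norm (c n)" for m n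
    by (simp add: norm_mult k0 flip: mult.assoc)
  have skc1: "summable (\<lambda>n. k m n * norm (c n))" for m
    using ell2_Cauchy_Schwarz(1)[OF e1[of m] e2[of m]] by (simp only: eq)
  have sK: "summable (\<lambda>n. norm (K m n * c n))" for m
    by (rule summable_comparison_test'[OF skc1[of m]]) (simp add: norm_mult K mult_right_mono)
  have row: "(norm (\<Sum>n. K m n * c n))\<^sup>2 \<le> s * (\<Sum>n. k m n * (norm (c n))\<^sup>2)" for m
  proof -
    have "norm (\<Sum>n. K m n * c n) \<le> (\<Sum>n. norm (K m n * c n))"
      by (rule summable_norm[OF sK])
    also have "\<dots> \<le> (\<Sum>n. k m n * norm (c n))"
      by (rule suminf_le[OF _ sK skc1]) (simp add: norm_mult K mult_right_mono)
    also have "\<dots> \<le> sqrt (\<Sum>n. k m n) * sqrt (\<Sum>n. k m n * (norm (c n))\<^sup>2)"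
      using ell2_Cauchy_Schwarz(2)[OF e1[of m] e2[of m]] by (simp only: eq) (simp add: ell2_norm_def norm_mult power_mult_distrib k0)
    finally have "(norm (\<Sum>n. K m n * c n))\<^sup>2 \<le> (sqrt (\<Sum>n. k m n) * sqrt (\<Sum>n. k m n * (norm (c n))\<^sup>2))\<^sup>2"
      by (intro power_mono) auto
    also have "\<dots> = (\<Sum>n. k m n) * (\<Sum>n. k m n * (norm (c n))\<^sup>2)"
      by (simp add: power_mult_distrib suminf_nonneg sk skc k0)
    also have "\<dots> \<le> s * (\<Sum>n. k m n * (norm (c n))\<^sup>2)"
      by (intro mult_right_mono sk suminf_nonneg skc) (simp add: k0)
    finally show ?thesis .
  qed
  have le: "(\<Sum>m<j. (norm (\<Sum>n. K m n * c n))\<^sup>2) \<le> (s * ell2_norm c)\<^sup>2" for j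
  proof -
    have col: "(\<Sum>m<j. k m n) \<le> s" for n
      using sum_le_suminf[OF sk(1)[of n], of "{..<j}"] sk(2)[of n] k0 by (simp add: sym[of _ n])
    have "(\<Sum>m<j. (norm (\<Sum>n. K m n * c n))\<^sup>2) \<le> (\<Sum>m<j. s * (\<Sum>n. k m n * (norm (c n))\<^sup>2))"
      by (intro sum_mono row)
    also have "\<dots> = s * (\<Sum>n. \<Sum>m<j. k m n * (norm (c n))\<^sup>2)"
      by (simp add: suminf_sum skc sum_distrib_left)
    also have "\<dots> \<le> s * (\<Sum>n. s * (norm (c n))\<^sup>2)"
      by (intro mult_left_mono s0 suminf_le summable_sum skc summable_mult sc)
        (simp add: sum_distrib_right[symmetric] col mult_right_mono)
    also have "\<dots> = (s * ell2_norm c)\<^sup>2"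
      by (simp add: suminf_mult[OF sc] power_mult_distrib ell2_norm_power2[OF c]) (simp add: power2_eq_square)
    finally show ?thesis .
  qed
  then show "(\<lambda>m. \<Sum>n. K m n * c n) \<in> ell2" "ell2_norm (\<lambda>m. \<Sum>n. K m n * c n) \<le> s * ell2_norm c"
    using ell2I[of "s * ell2_norm c" "\<lambda>m. \<Sum>n. K m n * c n"] s0 ell2_norm_nonneg[OF c] by auto
qed

section \<open>Analysis and synthesis\<close>

lemma tf_shift_zero [simp]: "tf_shift 0 f = f"
  by (auto simp: tf_shift_apply)

lemma wt_uminus [simp]: "wt (- x) = wt x"
  by (simp add: wt_def)

text \<open>Meant for weights a, b at two points and d the weight of their difference: the
  difference of the powers has one order less in b, at the price of powers of d that off-diagonal
  decay absorbs. The induction writes a^(n+1) - b^(n+1) as a (a^n - b^n) + b^n (a - b).\<close>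

lemma power_diff_le_weighted:
  fixes a b d :: real
  assumes "0 \<le> a" "1 \<le> b" "1 \<le> d" "a \<le> d * b" "\<bar>a - b\<bar> \<le> d"
  shows "\<bar>a ^ Suc N - b ^ Suc N\<bar> \<le> real (Suc N) * d ^ Suc N * b ^ N"
proof (induction N)
  case (Suc N)
  have "\<bar>a ^ Suc (Suc N) - b ^ Suc (Suc N)\<bar> = \<bar>a * (a ^ Suc N - b ^ Suc N) + b ^ Suc N * (a - b)\<bar>"
    by (simp add: algebra_simps)
  also have "\<dots> \<le> a * \<bar>a ^ Suc N - b ^ Suc N\<bar> + b ^ Suc N * \<bar>a - b\<bar>"
    by (rule order_trans[OF abs_triangle_ineq]) (use assms in \<open>simp add: abs_mult\<close>)
  also have "\<dots> \<le> (d * b) * (real (Suc N) * d ^ Suc N * b ^ N) + b ^ Suc N * d ^ Suc (Suc N)"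
  proof (intro add_mono mult_mono Suc.IH assms)
    have "d ^ 1 \<le> d ^ Suc (Suc N)"
      by (rule power_increasing) (use assms in auto)
    then show "\<bar>a - b\<bar> \<le> d ^ Suc (Suc N)"
      using assms(5) by (simp only: power_one_right)
  qed (use assms in auto)
  also have "\<dots> = real (Suc (Suc N)) * d ^ Suc (Suc N) * b ^ Suc N"
    by (simp add: algebra_simps)
  finally show ?case .
qed (use assms in simp)

lemma summable_power_mult_geometric:
  fixes r :: real
  assumes r: "0 < r" "r < 1"
  shows "summable (\<lambda>k. r ^ k * (1 + real k) ^ N)"
proof -
  have "(\<lambda>k. r * (1 + inverse (real (Suc k))) ^ N) \<longlonglongrightarrow> r * (1 + 0) ^ N"
    by (intro tendsto_intros LIMSEQ_inverse_real_of_nat)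
  then have "\<forall>\<^sub>F k in sequentially. r * (1 + inverse (real (Suc k))) ^ N < (1 + r) / 2"
    using r by (intro order_tendstoD) auto
  then obtain K where K: "\<And>k. k \<ge> K \<Longrightarrow> r * (1 + inverse (real (Suc k))) ^ N < (1 + r) / 2"
    by (auto simp: eventually_sequentially)
  show ?thesis
  proof (rule summable_ratio_test[of "(1 + r) / 2" K])
    fix k assume k: "k \<ge> K"
    have "1 + real (Suc k) = (1 + inverse (real (Suc k))) * (1 + real k)"
      by (simp add: field_simps)
    then have "r ^ Suc k * (1 + real (Suc k)) ^ N = (r * (1 + inverse (real (Suc k))) ^ N) * (r ^ k * (1 + real k) ^ N)"
      by (simp add: power_mult_distrib)
    also have "\<dots> \<le> (1 + r) / 2 * (r ^ k * (1 + real k) ^ N)"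
      using K[OF k] r by (intro mult_right_mono) auto
    finally show "norm (r ^ Suc k * (1 + real (Suc k)) ^ N) \<le> (1 + r) / 2 * norm (r ^ k * (1 + real k) ^ N)"
      using r by simp
  qed (use r in auto)
qed

text \<open>A lattice enters the analysis only through an enumeration of its points and their mutual
  distance, so sums over it become series over \<open>nat\<close>.\<close>

locale gabor_points =
  fixes \<phi> :: "real ^ 'd::finite \<Rightarrow> complex"
    and p :: "nat \<Rightarrow> (real ^ 'd) \<times> (real ^ 'd)" and \<delta> :: real
  assumes \<phi>: "\<phi> \<in> schwartz" and \<delta>: "\<delta> > 0"
    and sep: "\<And>m n. m \<noteq> n \<Longrightarrow> \<delta> \<le> dist (p m) (p n)"
begin

text \<open>\<open>coef\<close> is the analysis operator C of the overview, and \<open>synth\<close>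
  below is its adjoint C*.\<close>

definition coef :: "(real ^ 'd \<Rightarrow> complex) \<Rightarrow> nat \<Rightarrow> complex"
  where "coef f n = l2_inner f (tf_shift (p n) \<phi>)"

definition synth :: "(nat \<Rightarrow> complex) \<Rightarrow> real ^ 'd \<Rightarrow> complex"
  where "synth c y = (\<Sum>n. c n * tf_shift (p n) \<phi> y)"

text \<open>The sequences on which synthesis converges in the Schwartz space. Analysis leads from
  Schwartz functions back to them, so the whole iteration stays inside these two spaces.\<close>

definition rapid :: "(nat \<Rightarrow> complex) \<Rightarrow> bool"
  where "rapid c \<longleftrightarrow> (\<forall>N. \<exists>C. \<forall>n. wt (p n) ^ N * norm (c n) \<le> C)"

text \<open>The exponent of \<open>separated_sum_bound\<close> in phase space: this many powers of
  decay are spent whenever a sum over all points is taken.\<close>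

definition M0 :: nat
  where "M0 = DIM((real ^ 'd) \<times> (real ^ 'd)) + 2"

lemma atom: "tf_shift (p n) \<phi> \<in> schwartz"
  by (rule schwartz_tf_shift[OF \<phi>])

lemma sumE:
  obtains \<sigma> where "0 \<le> \<sigma>" "\<And>z. summable (\<lambda>n. 1 / wt (p n - z) ^ M0)"
    "\<And>z. (\<Sum>n. 1 / wt (p n - z) ^ M0) \<le> \<sigma>"
  by (rule separated_sum_bound[OF \<delta> sep]) (auto intro!: that simp: M0_def)

lemma rapid_summable:
  assumes "rapid c"
  shows "summable (\<lambda>n. wt (p n) ^ N * norm (c n))"
proof -
  obtain \<sigma> where "summable (\<lambda>n. 1 / wt (p n - 0) ^ M0)"
    using sumE by blast
  then have s: "summable (\<lambda>n. 1 / wt (p n) ^ M0)"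
    by simp
  obtain C where C: "\<And>n. wt (p n) ^ (M0 + N) * norm (c n) \<le> C"
    using assms unfolding rapid_def by blast
  show ?thesis
  proof (rule summable_comparison_test'[OF summable_mult[OF s, of C]])
    fix n
    show "norm (wt (p n) ^ N * norm (c n)) \<le> C * (1 / wt (p n) ^ M0)"
      using C[of n] by (simp add: power_add field_simps)
  qed
qed

lemma rapid_ell2_weighted:
  assumes "rapid c"
  shows "(\<lambda>n. of_real (wt (p n - z) ^ N) * c n) \<in> ell2"
    and "rapid (\<lambda>n. of_real (wt (p n - z) ^ N) * c n)"
proof -
  have w: "wt (p n - z) ^ N \<le> wt z ^ N * wt (p n) ^ N" for n
  proof -
    have "wt (p n - z) \<le> wt z * wt (p n)"
      using wt_add_le[of "- z" "p n"] by simp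
    then show ?thesis
      by (metis power_mono power_mult_distrib wt_nonneg)
  qed
  show r: "rapid (\<lambda>n. of_real (wt (p n - z) ^ N) * c n)"
    unfolding rapid_def
  proof
    fix K
    obtain C where C: "\<And>n. wt (p n) ^ (K + N) * norm (c n) \<le> C"
      using assms unfolding rapid_def by blast
    have "wt (p n) ^ K * norm (of_real (wt (p n - z) ^ N) * c n) \<le> wt z ^ N * C" for n
    proof -
      have "wt (p n) ^ K * norm (of_real (wt (p n - z) ^ N) * c n) = wt (p n) ^ K * (wt (p n - z) ^ N * norm (c n))"
        by (simp add: norm_mult norm_power)
      also have "\<dots> \<le> wt (p n) ^ K * ((wt z ^ N * wt (p n) ^ N) * norm (c n))"
        by (intro mult_left_mono mult_right_mono w) auto
      also have "\<dots> = wt z ^ N * (wt (p n) ^ (K + N) * norm (c n))"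
        by (simp add: power_add)
      also have "\<dots> \<le> wt z ^ N * C"
        by (intro mult_left_mono C) auto
      finally show ?thesis .
    qed
    then show "\<exists>C. \<forall>n. wt (p n) ^ K * norm (of_real (wt (p n - z) ^ N) * c n) \<le> C"
      by blast
  qed
  have *: "d \<in> ell2" if d: "rapid d" for d
  proof -
    obtain C where C: "\<And>n. wt (p n) ^ 0 * norm (d n) \<le> C"
      using d unfolding rapid_def by blast
    have s: "summable (\<lambda>n. norm (d n))"
      using rapid_summable[OF d, of 0] by simp
    have "summable (\<lambda>n. (norm (d n))\<^sup>2)"
      by (rule summable_comparison_test'[OF summable_mult[OF s, of C]])
        (use C in \<open>auto simp: power2_eq_square mult_right_mono\<close>)
    then show ?thesis
      by (simp add: ell2_def)
  qed
  show "(\<lambda>n. of_real (wt (p n - z) ^ N) * c n) \<in> ell2"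
    by (rule *[OF r])
qed

lemma rapid_ell2: "rapid c \<Longrightarrow> c \<in> ell2"
  using rapid_ell2_weighted(1)[of c 0 0] by simp

lemma rapid_diff_scale:
  assumes "rapid c" "rapid d"
  shows "rapid (\<lambda>n. c n - a * d n)"
  unfolding rapid_def
proof
  fix N
  obtain C where C: "\<And>n. wt (p n) ^ N * norm (c n) \<le> C"
    using assms(1) unfolding rapid_def by blast
  obtain D where D: "\<And>n. wt (p n) ^ N * norm (d n) \<le> D"
    using assms(2) unfolding rapid_def by blast
  have "wt (p n) ^ N * norm (c n - a * d n) \<le> C + norm a * D" for n
  proof -
    have "wt (p n) ^ N * norm (c n - a * d n) \<le> wt (p n) ^ N * (norm (c n) + norm a * norm (d n))"
      by (intro mult_left_mono order_trans[OF norm_triangle_ineq4]) (auto simp: norm_mult)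
    also have "\<dots> = wt (p n) ^ N * norm (c n) + norm a * (wt (p n) ^ N * norm (d n))"
      by (simp add: algebra_simps)
    also have "\<dots> \<le> C + norm a * D"
      by (intro add_mono mult_left_mono C D) auto
    finally show ?thesis .
  qed
  then show "\<exists>C. \<forall>n. wt (p n) ^ N * norm (c n - a * d n) \<le> C"
    by blast
qed

lemma rapid_coef:
  assumes "f \<in> schwartz"
  shows "rapid (coef f)"
  unfolding rapid_def
proof
  fix N
  obtain C where C: "\<And>z w. norm (l2_inner (tf_shift z f) (tf_shift w \<phi>)) \<le> C / wt (z - w) ^ N"
    using l2_inner_tf_shift_decayE[OF assms \<phi>] by metis
  have "wt (p n) ^ N * norm (coef f n) \<le> C" for n
    using C[of 0 "p n"] by (simp add: coef_def field_simps)
  then show "\<exists>C. \<forall>n. wt (p n) ^ N * norm (coef f n) \<le> C"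
    by blast
qed

text \<open>By \<open>tf_shift_bound\<close> the seminorms of the n-th atom grow at most
  polynomially in \<open>wt (p n)\<close>, and rapid decay of the coefficients outweighs
  that.\<close>

lemma synth_terms:
  assumes "rapid c"
  shows "\<exists>\<kappa>. summable \<kappa> \<and> (\<forall>n y. wt y ^ N * norm (partial_derivs is (\<lambda>y. c n * tf_shift (p n) \<phi> y) y) \<le> \<kappa> n)"
proof -
  obtain C where C: "0 \<le> C"
    "\<And>z y. wt y ^ N * norm (partial_derivs is (tf_shift z \<phi>) y) \<le> C * wt z ^ (N + length is)"
    using tf_shift_bound[OF \<phi>] by blast
  have "wt y ^ N * norm (partial_derivs is (\<lambda>y. c n * tf_shift (p n) \<phi> y) y) \<le> C * (wt (p n) ^ (N + length is) * norm (c n))" for n y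
    using mult_left_mono[OF C(2)[of y "p n"], of "norm (c n)"]
    by (simp add: partial_derivs_cmult[OF schwartz_smooth[OF atom]] norm_mult algebra_simps)
  then show ?thesis
    using summable_mult[OF rapid_summable[OF assms]] by blast
qed

lemma synth_schwartz:
  assumes "rapid c"
  shows "synth c \<in> schwartz"
proof -
  have "(\<lambda>y. \<Sum>n. c n * tf_shift (p n) \<phi> y) \<in> schwartz"
    by (rule schwartz_series[OF schwartz_cmult[OF atom] synth_terms[OF assms]])
  then show ?thesis
    by (simp add: synth_def[abs_def])
qed

lemma synth_functional:
  assumes "tempered_functional v" "rapid c"
  shows "(\<lambda>n. v (\<lambda>y. c n * tf_shift (p n) \<phi> y)) sums v (synth c)"
  using tempered_functional_series[OF assms(1) schwartz_cmult[OF atom] synth_terms[OF assms(2)]]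
  by (simp add: synth_def[abs_def])

lemma synth_sums:
  assumes "rapid c"
  shows "(\<lambda>n. c n * tf_shift (p n) \<phi> y) sums synth c y"
proof -
  obtain \<kappa> where \<kappa>: "summable \<kappa>" "\<And>n y. wt y ^ 0 * norm (partial_derivs [] (\<lambda>y. c n * tf_shift (p n) \<phi> y) y) \<le> \<kappa> n"
    using synth_terms[OF assms] by blast
  have "summable (\<lambda>n. c n * tf_shift (p n) \<phi> y)"
    by (rule summable_comparison_test'[OF \<kappa>(1)]) (use \<kappa>(2) in simp)
  then show ?thesis
    unfolding synth_def by (rule summable_sums)
qed

lemma synth_diff_scale:
  assumes "rapid c" "rapid d"
  shows "synth (\<lambda>n. c n - a * d n) y = synth c y - a * synth d y"
proof -
  have "(\<lambda>n. c n * tf_shift (p n) \<phi> y - a * (d n * tf_shift (p n) \<phi> y)) sums (synth c y - a * synth d y)"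
    by (intro sums_diff sums_mult synth_sums assms)
  then show ?thesis
    by (simp add: synth_def algebra_simps sums_iff)
qed

lemma l2_inner_synth:
  assumes "rapid c" "h \<in> schwartz"
  shows "(\<lambda>n. c n * l2_inner (tf_shift (p n) \<phi>) h) sums l2_inner (synth c) h"
  using synth_functional[OF tempered_functional_l2_inner[OF assms(2)] assms(1)]
  by (simp add: l2_inner_cmult_left[OF atom assms(2)])

lemma l2_inner_synth_coef:
  assumes "rapid c" "h \<in> schwartz"
  shows "(\<lambda>n. c n * cnj (coef h n)) sums l2_inner (synth c) h"
  using l2_inner_synth[OF assms] by (simp add: coef_def l2_inner_commute[OF assms(2) atom])

lemma Re_l2_inner_synth_le:
  assumes "rapid c" "h \<in> schwartz"
  shows "Re (l2_inner (synth c) h) \<le> ell2_norm c * ell2_norm (coef h)"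
proof -
  have e: "c \<in> ell2" "coef h \<in> ell2"
    using assms by (auto intro: rapid_ell2 rapid_coef)
  have s: "summable (\<lambda>n. norm (c n * cnj (coef h n)))"
    using ell2_Cauchy_Schwarz(1)[OF e] by (simp add: norm_mult)
  have "Re (l2_inner (synth c) h) \<le> norm (\<Sum>n. c n * cnj (coef h n))"
    using sums_unique[OF l2_inner_synth_coef[OF assms]] complex_Re_le_cmod by metis
  also have "\<dots> \<le> (\<Sum>n. norm (c n * cnj (coef h n)))"
    by (rule summable_norm[OF s])
  also have "\<dots> \<le> ell2_norm c * ell2_norm (coef h)"
    using ell2_Cauchy_Schwarz(2)[OF e] by (simp add: norm_mult)
  finally show ?thesis .
qed

text \<open>With the frame operator S = C* C this says that the inner product of S h with h is the
  square of the norm of C h.\<close>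

lemma l2_inner_synth_coef_self:
  assumes "h \<in> schwartz"
  shows "l2_inner (synth (coef h)) h = of_real ((ell2_norm (coef h))\<^sup>2)"
proof -
  have e: "coef h \<in> ell2"
    using assms by (auto intro: rapid_ell2 rapid_coef)
  then have "(\<lambda>n. (norm (coef h n))\<^sup>2) sums (ell2_norm (coef h))\<^sup>2"
    unfolding ell2_norm_power2[OF e] using e by (intro summable_sums) (simp add: ell2_def)
  then have "(\<lambda>n. complex_of_real ((norm (coef h n))\<^sup>2)) sums of_real ((ell2_norm (coef h))\<^sup>2)"
    by (rule sums_of_real)
  then have "(\<lambda>n. coef h n * cnj (coef h n)) sums of_real ((ell2_norm (coef h))\<^sup>2)"
    by (simp only: complex_norm_square)
  then show ?thesis
    using l2_inner_synth_coef[OF rapid_coef[OF assms] assms] sums_unique2 by blast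
qed

lemma gram_decayE:
  obtains C where "0 \<le> C"
    "\<And>m n. norm (l2_inner (tf_shift (p n) \<phi>) (tf_shift (p m) \<phi>)) \<le> C / wt (p m - p n) ^ N"
proof -
  obtain C where C: "0 \<le> C" "\<And>z w. norm (l2_inner (tf_shift z \<phi>) (tf_shift w \<phi>)) \<le> C / wt (z - w) ^ N"
    by (rule l2_inner_tf_shift_decayE[OF \<phi> \<phi>, of N]) metis
  show thesis
    by (rule that[OF C(1)]) (subst wt_minus, rule C(2))
qed

lemma kernel_ell2:
  assumes K: "\<And>m n. norm (K m n :: complex) \<le> C / wt (p m - p n) ^ M0" and C: "0 \<le> C"
    and \<sigma>: "\<And>z. summable (\<lambda>n. 1 / wt (p n - z) ^ M0)" "\<And>z. (\<Sum>n. 1 / wt (p n - z) ^ M0) \<le> \<sigma>"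
    and c: "c \<in> ell2"
  shows "(\<lambda>m. \<Sum>n. K m n * c n) \<in> ell2" "ell2_norm (\<lambda>m. \<Sum>n. K m n * c n) \<le> C * \<sigma> * ell2_norm c"
proof -
  have eq: "C / wt (p m - p n) ^ M0 = C * (1 / wt (p n - p m) ^ M0)" for m n
    by (simp add: wt_minus)
  have 1: "summable (\<lambda>n. C / wt (p m - p n) ^ M0)" for m
    unfolding eq by (intro summable_mult \<sigma>)
  have 2: "(\<Sum>n. C / wt (p m - p n) ^ M0) \<le> C * \<sigma>" for m
    unfolding eq suminf_mult[OF \<sigma>(1)] by (intro mult_left_mono \<sigma> C)
  have 3: "C / wt (p m - p n) ^ M0 = C / wt (p n - p m) ^ M0" for m n
    by (simp add: wt_minus)
  show "(\<lambda>m. \<Sum>n. K m n * c n) \<in> ell2" "ell2_norm (\<lambda>m. \<Sum>n. K m n * c n) \<le> C * \<sigma> * ell2_norm c"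
    by (rule Schur_test[of K "\<lambda>m n. C / wt (p m - p n) ^ M0", OF K 3 1 2 c])+
qed

lemma coef_synth:
  assumes "rapid c"
  shows "(\<lambda>n. l2_inner (tf_shift (p n) \<phi>) (tf_shift (p m) \<phi>) * c n) sums coef (synth c) m"
  unfolding coef_def using l2_inner_synth[OF assms atom, of m] by (simp add: mult.commute)

text \<open>The Gram matrix is bounded on l2 by the Schur test, which gives a bound K E for the
  squared norm of g = S f, where E is the squared norm of the coefficients of f. Expanding the
  square of the norm of f - g/K, which is nonnegative, then leaves E/K below the squared norm of
  f.\<close>

lemma upper_frame_bound:
  obtains K where "K > 0" "\<And>f. f \<in> schwartz \<Longrightarrow> (ell2_norm (coef f))\<^sup>2 \<le> K * (l2_norm f)\<^sup>2"
proof -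
  obtain \<sigma> where \<sigma>: "0 \<le> \<sigma>" "\<And>z. summable (\<lambda>n. 1 / wt (p n - z) ^ M0)" "\<And>z. (\<Sum>n. 1 / wt (p n - z) ^ M0) \<le> \<sigma>"
    by (rule sumE) metis
  obtain C where C: "0 \<le> C" "\<And>m n. norm (l2_inner (tf_shift (p n) \<phi>) (tf_shift (p m) \<phi>)) \<le> C / wt (p m - p n) ^ M0"
    by (rule gram_decayE[of M0]) metis
  \<comment> \<open>The summand 1 makes \<open>K\<close> positive, so that dividing by it is
    legitimate.\<close>
  define K where "K = C * \<sigma> + 1"
  have K: "K > 0"
    using C \<sigma> by (simp add: K_def add_nonneg_pos)
  have gs: "ell2_norm (coef (synth c)) \<le> K * ell2_norm c" if c: "rapid c" for c
  proof -
    have "coef (synth c) = (\<lambda>m. \<Sum>n. l2_inner (tf_shift (p n) \<phi>) (tf_shift (p m) \<phi>) * c n)"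
      using coef_synth[OF c] by (auto simp: sums_iff)
    then have "ell2_norm (coef (synth c)) \<le> C * \<sigma> * ell2_norm c"
      using kernel_ell2(2)[OF C(2,1) \<sigma>(2,3) rapid_ell2[OF c]] by simp
    then show ?thesis
      using ell2_norm_nonneg[OF rapid_ell2[OF c]] by (simp add: K_def algebra_simps)
  qed
  have "(ell2_norm (coef f))\<^sup>2 \<le> K * (l2_norm f)\<^sup>2" if f: "f \<in> schwartz" for f
  proof -
    define E where "E = (ell2_norm (coef f))\<^sup>2"
    define g where "g = synth (coef f)"
    have g: "g \<in> schwartz"
      unfolding g_def by (intro synth_schwartz rapid_coef f)
    have "of_real ((l2_norm g)\<^sup>2) = l2_inner g g"
      by (rule l2_inner_self[OF g, symmetric])
    then have "(l2_norm g)\<^sup>2 = Re (l2_inner g g)"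
      by (metis Re_complex_of_real)
    also have "\<dots> \<le> ell2_norm (coef f) * ell2_norm (coef g)"
      using Re_l2_inner_synth_le[OF rapid_coef[OF f] g] by (simp add: g_def)
    also have "\<dots> \<le> ell2_norm (coef f) * (K * ell2_norm (coef f))"
      unfolding g_def by (intro mult_left_mono gs rapid_coef f ell2_norm_nonneg rapid_ell2)
    finally have gE: "(l2_norm g)\<^sup>2 \<le> K * E"
      by (simp add: E_def power2_eq_square algebra_simps)
    have "Re (l2_inner f g) = E"
      unfolding l2_inner_commute[OF g f] by (simp add: g_def l2_inner_synth_coef_self[OF f] E_def)
    then have "0 \<le> (l2_norm f)\<^sup>2 - 2 * (1 / K) * E + (1 / K)\<^sup>2 * (l2_norm g)\<^sup>2"
      using l2_norm_diff_scaled[OF f g, of "1 / K"] by (metis zero_le_power2)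
    also have "\<dots> \<le> (l2_norm f)\<^sup>2 - 2 * (1 / K) * E + (1 / K)\<^sup>2 * (K * E)"
      by (intro add_left_mono mult_left_mono gE) auto
    also have "\<dots> = (l2_norm f)\<^sup>2 - E / K"
      using K by (simp add: power2_eq_square field_simps)
    finally show ?thesis
      using K by (simp add: E_def field_simps)
  qed
  then show thesis
    using K that by blast
qed

end

section \<open>Frame iteration\<close>

lemma norm_diff_scaled_power2:
  fixes a b :: complex
  shows "(norm (a - of_real t * b))\<^sup>2 = (norm a)\<^sup>2 - 2 * t * Re (a * cnj b) + t\<^sup>2 * (norm b)\<^sup>2"
  unfolding cmod_power2 by (simp add: power2_eq_square algebra_simps)

locale gabor_frame_points = gabor_points \<phi> p \<delta>
  for \<phi> :: "real ^ 'd::finite \<Rightarrow> complex" and p :: "nat \<Rightarrow> (real ^ 'd) \<times> (real ^ 'd)" and \<delta> +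
  fixes A B :: real
  assumes A: "A > 0" and B: "B > 0"
    and lower: "\<And>f. f \<in> schwartz \<Longrightarrow> A * (l2_norm f)\<^sup>2 \<le> (ell2_norm (coef f))\<^sup>2"
    and upper: "\<And>f. f \<in> schwartz \<Longrightarrow> (ell2_norm (coef f))\<^sup>2 \<le> B * (l2_norm f)\<^sup>2"
begin

text \<open>An operator and its adjoint have the same norm: X is the pairing of c with the
  coefficients of \<open>synth c\<close>, whose squared norm is at most B X. Squaring and cancelling
  one factor X gives the claim.\<close>

lemma norm_synth_le:
  assumes "rapid c"
  shows "(l2_norm (synth c))\<^sup>2 \<le> B * (ell2_norm c)\<^sup>2"
proof -
  define X where "X = (l2_norm (synth c))\<^sup>2"
  define E where "E = ell2_norm (coef (synth c))"
  have s: "synth c \<in> schwartz"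
    by (rule synth_schwartz[OF assms])
  have "X = Re (l2_inner (synth c) (synth c))"
    unfolding l2_inner_self[OF s] X_def by (rule Re_complex_of_real[symmetric])
  also have "\<dots> \<le> ell2_norm c * E"
    unfolding E_def by (rule Re_l2_inner_synth_le[OF assms s])
  finally have "X \<le> ell2_norm c * E" .
  then have "X\<^sup>2 \<le> (ell2_norm c * E)\<^sup>2"
    by (rule power_mono) (simp add: X_def)
  also have "\<dots> = (ell2_norm c)\<^sup>2 * E\<^sup>2"
    by (rule power_mult_distrib)
  also have "\<dots> \<le> (ell2_norm c)\<^sup>2 * (B * X)"
    using upper[OF s] by (intro mult_left_mono) (auto simp: E_def X_def)
  finally have le: "X * X \<le> (B * (ell2_norm c)\<^sup>2) * X"
    by (simp add: power2_eq_square algebra_simps)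
  have "X \<le> B * (ell2_norm c)\<^sup>2"
  proof (cases "X = 0")
    case True
    then show ?thesis using B by simp
  next
    case False
    then have "X > 0" by (simp add: X_def)
    then show ?thesis using le mult_le_cancel_right_pos by blast
  qed
  then show ?thesis by (simp add: X_def)
qed

text \<open>The matrix \<open>1 - G/B\<close>, written through synthesis followed by
  analysis.\<close>

definition step :: "(nat \<Rightarrow> complex) \<Rightarrow> nat \<Rightarrow> complex"
  where "step c n = c n - of_real (1 / B) * coef (synth c) n"

lemma rapid_step: "rapid c \<Longrightarrow> rapid (step c)"
  unfolding step_def[abs_def] by (intro rapid_diff_scale rapid_coef synth_schwartz)

text \<open>In the expanded square the cross term contributes -2 X / B, where X is the squared norm
  of \<open>synth c\<close>, and the upper frame bound limits the last term to X / B. The remaining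
  -X / B may vanish, since G may have a kernel, so the contraction need not be strict.\<close>

lemma norm_step_le:
  assumes c: "rapid c"
  shows "ell2_norm (step c) \<le> ell2_norm c"
proof -
  define d where "d = coef (synth c)"
  define X where "X = (l2_norm (synth c))\<^sup>2"
  have s: "synth c \<in> schwartz" and d: "rapid d"
    using c by (auto simp: d_def intro: synth_schwartz rapid_coef)
  have e: "c \<in> ell2" "d \<in> ell2" "step c \<in> ell2"
    using c d by (auto intro: rapid_ell2 rapid_step)
  have "(\<lambda>n. Re (c n * cnj (d n))) sums Re (l2_inner (synth c) (synth c))"
    unfolding d_def by (intro sums_Re l2_inner_synth_coef c s)
  then have 1: "(\<lambda>n. Re (c n * cnj (d n))) sums X"
    unfolding l2_inner_self[OF s] X_def Re_complex_of_real .
  have sq: "(\<lambda>n. (norm (b n))\<^sup>2) sums (ell2_norm b)\<^sup>2" if "b \<in> ell2" for b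
    using that unfolding ell2_norm_power2[OF that] by (intro summable_sums) (simp add: ell2_def)
  have "(\<lambda>n. (norm (c n))\<^sup>2 - 2 * (1 / B) * Re (c n * cnj (d n)) + (1 / B)\<^sup>2 * (norm (d n))\<^sup>2) sums
      ((ell2_norm c)\<^sup>2 - 2 * (1 / B) * X + (1 / B)\<^sup>2 * (ell2_norm d)\<^sup>2)"
    by (intro sums_add sums_diff sums_mult 1 sq e)
  moreover have "(norm (step c n))\<^sup>2 = (norm (c n))\<^sup>2 - 2 * (1 / B) * Re (c n * cnj (d n)) + (1 / B)\<^sup>2 * (norm (d n))\<^sup>2" for n
    unfolding step_def d_def[symmetric] by (rule norm_diff_scaled_power2)
  ultimately have "(ell2_norm (step c))\<^sup>2 = (ell2_norm c)\<^sup>2 - 2 * (1 / B) * X + (1 / B)\<^sup>2 * (ell2_norm d)\<^sup>2"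
    using sq[OF e(3)] sums_unique2 by (simp only:)
  also have "\<dots> \<le> (ell2_norm c)\<^sup>2 - 2 * (1 / B) * X + (1 / B)\<^sup>2 * (B * X)"
    using upper[OF s] by (intro add_left_mono mult_left_mono) (auto simp: d_def X_def)
  also have "\<dots> = (ell2_norm c)\<^sup>2 - X / B"
    using B by (simp add: power2_eq_square field_simps)
  also have "\<dots> \<le> (ell2_norm c)\<^sup>2"
    using B by (simp add: X_def)
  finally show ?thesis
    using ell2_norm_nonneg[OF e(1)] power2_le_imp_le by blast
qed

section \<open>Growth of weighted norms under the iteration\<close>

definition wc :: "(real ^ 'd) \<times> (real ^ 'd) \<Rightarrow> nat \<Rightarrow> (nat \<Rightarrow> complex) \<Rightarrow> nat \<Rightarrow> complex"
  where "wc z N c n = of_real (wt (p n - z) ^ N) * c n"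

lemma wc_ell2: "rapid c \<Longrightarrow> wc z N c \<in> ell2" and wc_rapid: "rapid c \<Longrightarrow> rapid (wc z N c)"
  unfolding wc_def[abs_def] by (rule rapid_ell2_weighted; assumption)+

lemma norm_wc: "norm (wc z N c n) = wt (p n - z) ^ N * norm (c n)"
  by (simp add: wc_def norm_mult norm_power)

text \<open>Conjugating \<open>step\<close> with a weight costs only the commutator, whose kernel gains one power
  of the weight; hence the weighted norms of the iterates grow polynomially.\<close>

lemma weighted_step_le:
  "\<exists>\<kappa>\<ge>0. \<forall>z c. rapid c \<longrightarrow>
    ell2_norm (wc z (Suc N) (step c)) \<le> ell2_norm (wc z (Suc N) c) + \<kappa> * ell2_norm (wc z N c)"
proof -
  obtain \<sigma> where \<sigma>: "0 \<le> \<sigma>" "\<And>z. summable (\<lambda>n. 1 / wt (p n - z) ^ M0)" "\<And>z. (\<Sum>n. 1 / wt (p n - z) ^ M0) \<le> \<sigma>"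
    by (rule sumE) metis
  define G where "G m n = l2_inner (tf_shift (p n) \<phi>) (tf_shift (p m) \<phi>)" for m n
  \<comment> \<open>Of this decay, \<open>Suc N\<close> powers compensate the commutator of the
    weight and \<open>M0\<close> powers remain for the Schur test.\<close>
  obtain C where C: "0 \<le> C" "\<And>m n. norm (G m n) \<le> C / wt (p m - p n) ^ (Suc N + M0)"
    unfolding G_def by (rule gram_decayE[of "Suc N + M0"]) metis
  define \<kappa> where "\<kappa> = (1 / B) * (real (Suc N) * C) * \<sigma>"
  have "ell2_norm (wc z (Suc N) (step c)) \<le> ell2_norm (wc z (Suc N) c) + \<kappa> * ell2_norm (wc z N c)"
    if c: "rapid c" for z c
  proof -
    let ?w = "\<lambda>n. wt (p n - z)"
    \<comment> \<open>The commutator kernel divided by the weight of order \<open>N\<close> at the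
      column index, so that it acts on \<open>wc z N c\<close> instead of c.\<close>
    define K where "K m n = of_real (- (1 / B) * ((?w m ^ Suc N - ?w n ^ Suc N) / ?w n ^ N)) * G m n" for m n
    have K: "norm (K m n) \<le> ((1 / B) * (real (Suc N) * C)) / wt (p m - p n) ^ M0" for m n
    proof -
      have "\<bar>?w m ^ Suc N - ?w n ^ Suc N\<bar> \<le> real (Suc N) * wt (p m - p n) ^ Suc N * ?w n ^ N"
      proof (rule power_diff_le_weighted)
        show "?w m \<le> wt (p m - p n) * ?w n"
          using wt_add_le[of "p m - p n" "p n - z"] by simp
        have "\<bar>norm (p m - z) - norm (p n - z)\<bar> \<le> norm (p m - p n)"
          using norm_triangle_ineq3[of "p m - z" "p n - z"] by simp
        then show "\<bar>?w m - ?w n\<bar> \<le> wt (p m - p n)"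
          by (simp add: wt_def)
      qed auto
      then have 1: "\<bar>(?w m ^ Suc N - ?w n ^ Suc N) / ?w n ^ N\<bar> \<le> real (Suc N) * wt (p m - p n) ^ Suc N"
        by (simp add: abs_divide divide_le_eq)
      have "norm (K m n) = (1 / B) * (\<bar>(?w m ^ Suc N - ?w n ^ Suc N) / ?w n ^ N\<bar> * norm (G m n))"
        unfolding K_def norm_mult norm_of_real abs_mult using B by simp
      also have "\<dots> \<le> (1 / B) * ((real (Suc N) * wt (p m - p n) ^ Suc N) * (C / wt (p m - p n) ^ (Suc N + M0)))"
        using B by (intro mult_left_mono mult_mono 1 C) auto
      also have "\<dots> = ((1 / B) * (real (Suc N) * C)) / wt (p m - p n) ^ M0"
        by (simp add: power_add)
      finally show ?thesis .
    qed
    define R where "R m = (\<Sum>n. K m n * wc z N c n)" for m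
    have BC: "0 \<le> (1 / B) * (real (Suc N) * C)"
      using B C by simp
    have R: "R \<in> ell2" "ell2_norm R \<le> \<kappa> * ell2_norm (wc z N c)"
      using kernel_ell2[OF K BC \<sigma>(2,3) wc_ell2[OF c, of z N]] by (simp_all add: R_def[abs_def] \<kappa>_def)
    have eq: "wc z (Suc N) (step c) = (\<lambda>m. step (wc z (Suc N) c) m + R m)"
    proof
      fix m
      have 1: "(\<lambda>n. G m n * c n) sums coef (synth c) m"
        using coef_synth[OF c] by (simp add: G_def)
      have 2: "(\<lambda>n. G m n * wc z (Suc N) c n) sums coef (synth (wc z (Suc N) c)) m"
        using coef_synth[OF wc_rapid[OF c]] by (simp add: G_def)
      have "(\<lambda>n. of_real (1 / B) * (G m n * wc z (Suc N) c n) - of_real (?w m ^ Suc N) * (of_real (1 / B) * (G m n * c n))) sums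
          (of_real (1 / B) * coef (synth (wc z (Suc N) c)) m - of_real (?w m ^ Suc N) * (of_real (1 / B) * coef (synth c) m))"
        by (intro sums_diff sums_mult 1 2)
      moreover have "of_real (1 / B) * (G m n * wc z (Suc N) c n) - of_real (?w m ^ Suc N) * (of_real (1 / B) * (G m n * c n)) =
          K m n * wc z N c n" for n
      proof -
        have "K m n * wc z N c n = of_real (- (1 / B) * ((?w m ^ Suc N - ?w n ^ Suc N) / ?w n ^ N) * ?w n ^ N) * (G m n * c n)"
          by (simp add: K_def wc_def)
        also have "- (1 / B) * ((?w m ^ Suc N - ?w n ^ Suc N) / ?w n ^ N) * ?w n ^ N = (1 / B) * (?w n ^ Suc N - ?w m ^ Suc N)"
          using wt_neq0[of "p n - z"] by (simp add: right_diff_distrib)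
        finally show ?thesis
          by (simp add: wc_def algebra_simps)
      qed
      ultimately have "R m = of_real (1 / B) * coef (synth (wc z (Suc N) c)) m - of_real (?w m ^ Suc N) * (of_real (1 / B) * coef (synth c) m)"
        unfolding R_def by (simp only: sums_iff)
      then show "wc z (Suc N) (step c) m = step (wc z (Suc N) c) m + R m"
        unfolding step_def wc_def[of z "Suc N" "\<lambda>n. c n - complex_of_real (1 / B) * coef (synth c) n"]
        by (simp add: wc_def[of z "Suc N"] algebra_simps)
    qed
    have "ell2_norm (wc z (Suc N) (step c)) \<le> ell2_norm (step (wc z (Suc N) c)) + ell2_norm R"
      unfolding eq by (intro ell2_triangle(2) R rapid_ell2 rapid_step wc_rapid c)
    then show ?thesis
      using norm_step_le[OF wc_rapid[OF c, of z "Suc N"]] R(2) by linarith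
  qed
  moreover have "0 \<le> \<kappa>"
    using B C \<sigma> by (simp add: \<kappa>_def)
  ultimately show ?thesis by blast
qed

text \<open>Induction on the order: order 0 is the contraction property, and at order N + 1 each of
  the k steps adds at most a multiple of (1 + k)^N. Prescribing the initial bounds \<open>b\<close>
  for all orders at once makes \<open>L\<close> uniform in z and c.\<close>

lemma iterated_step_growth:
  fixes b :: "nat \<Rightarrow> real"
  shows "\<exists>L\<ge>0. \<forall>z c. rapid c \<and> (\<forall>N. ell2_norm (wc z N c) \<le> b N) \<longrightarrow>
    (\<forall>k. ell2_norm (wc z N ((step ^^ k) c)) \<le> L * (1 + real k) ^ N)"
proof (induction N)
  case 0
  have wc0: "wc z 0 c = c" for z c
    by (simp add: wc_def fun_eq_iff)
  have "ell2_norm ((step ^^ k) c) \<le> \<bar>b 0\<bar>" if c: "rapid c" and b: "ell2_norm c \<le> b 0" for k c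
  proof -
    have "rapid ((step ^^ k) c) \<and> ell2_norm ((step ^^ k) c) \<le> ell2_norm c"
      by (induction k) (auto simp: c intro: rapid_step order_trans[OF norm_step_le])
    then show ?thesis using b by linarith
  qed
  then show ?case
    by (intro exI[of _ "\<bar>b 0\<bar>"]) (metis wc0 abs_ge_zero mult_1_right power_0)
next
  case (Suc N)
  obtain L where L: "0 \<le> L" "\<And>z c k. rapid c \<Longrightarrow> (\<And>N. ell2_norm (wc z N c) \<le> b N) \<Longrightarrow>
      ell2_norm (wc z N ((step ^^ k) c)) \<le> L * (1 + real k) ^ N"
    using Suc.IH by blast
  obtain \<kappa> where \<kappa>: "0 \<le> \<kappa>" "\<And>z c. rapid c \<Longrightarrow>
      ell2_norm (wc z (Suc N) (step c)) \<le> ell2_norm (wc z (Suc N) c) + \<kappa> * ell2_norm (wc z N c)"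
    using weighted_step_le by blast
  define D where "D = \<bar>b (Suc N)\<bar>"
  have "ell2_norm (wc z (Suc N) ((step ^^ k) c)) \<le> (D + \<kappa> * L) * (1 + real k) ^ Suc N"
    if c: "rapid c" and b: "\<And>N. ell2_norm (wc z N c) \<le> b N" for z c k
  proof -
    have r: "rapid ((step ^^ k) c)" for k
      by (induction k) (auto simp: c intro: rapid_step)
    have "ell2_norm (wc z (Suc N) ((step ^^ k) c)) \<le> D + \<kappa> * L * real k * (1 + real k) ^ N" for k
    proof (induction k)
      case 0
      then show ?case using b[of "Suc N"] by (simp add: D_def)
    next
      case (Suc k)
      have "ell2_norm (wc z (Suc N) ((step ^^ Suc k) c)) \<le>
          ell2_norm (wc z (Suc N) ((step ^^ k) c)) + \<kappa> * ell2_norm (wc z N ((step ^^ k) c))"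
        using \<kappa>(2)[OF r] by simp
      also have "\<dots> \<le> (D + \<kappa> * L * real k * (1 + real k) ^ N) + \<kappa> * (L * (1 + real k) ^ N)"
        by (intro add_mono Suc.IH mult_left_mono L \<kappa> c b)
      also have "\<dots> = D + \<kappa> * L * real (Suc k) * (1 + real k) ^ N"
        by (simp add: algebra_simps)
      also have "\<dots> \<le> D + \<kappa> * L * real (Suc k) * (1 + real (Suc k)) ^ N"
        using L(1) \<kappa>(1) by (intro add_left_mono mult_left_mono power_mono) auto
      finally show ?case .
    qed
    then have "ell2_norm (wc z (Suc N) ((step ^^ k) c)) \<le> D + \<kappa> * L * real k * (1 + real k) ^ N" .
    also have "\<dots> \<le> D * (1 + real k) ^ Suc N + \<kappa> * L * (1 + real k) ^ Suc N"
    proof (rule add_mono)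
      show "D \<le> D * (1 + real k) ^ Suc N"
        using mult_left_mono[of 1 "(1 + real k) ^ Suc N" D] one_le_power[of "1 + real k" "Suc N"]
        by (simp add: D_def)
      have "\<kappa> * L * (real k * (1 + real k) ^ N) \<le> \<kappa> * L * ((1 + real k) * (1 + real k) ^ N)"
        using L(1) \<kappa>(1) by (intro mult_left_mono mult_right_mono) auto
      then show "\<kappa> * L * real k * (1 + real k) ^ N \<le> \<kappa> * L * (1 + real k) ^ Suc N"
        by (simp add: mult.assoc)
    qed
    finally show ?thesis
      by (simp add: distrib_right)
  qed
  moreover have "0 \<le> D + \<kappa> * L"
    using L(1) \<kappa>(1) by (simp add: D_def)
  ultimately show ?case by blast
qed

section \<open>The Neumann series on functions: \<open>residual f k\<close> is (1 - S/B)^k f\<close>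

fun residual :: "(real ^ 'd \<Rightarrow> complex) \<Rightarrow> nat \<Rightarrow> real ^ 'd \<Rightarrow> complex"
  where "residual f 0 = f"
  | "residual f (Suc k) = (\<lambda>x. residual f k x - of_real (1 / B) * synth (coef (residual f k)) x)"

lemma residual_schwartz: "f \<in> schwartz \<Longrightarrow> residual f k \<in> schwartz"
proof (induction k)
  case (Suc k)
  then show ?case
    unfolding residual.simps by (intro schwartz_diff schwartz_cmult synth_schwartz rapid_coef)
qed simp

text \<open>The intertwining relation C (1 - S/B) = (1 - G/B) C, iterated. It gives the residuals
  both the geometric L2 decay and the weighted bounds of the matrix iteration.\<close>

lemma coef_residual:
  assumes "f \<in> schwartz"
  shows "coef (residual f k) = (step ^^ k) (coef f)"
proof (induction k)
  case (Suc k)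
  have r: "residual f k \<in> schwartz" and s: "synth (coef (residual f k)) \<in> schwartz"
    using assms by (auto intro: residual_schwartz synth_schwartz rapid_coef)
  have "coef (residual f (Suc k)) n = step (coef (residual f k)) n" for n
  proof -
    have "coef (residual f (Suc k)) n = l2_inner (residual f k) (tf_shift (p n) \<phi>) -
        l2_inner (\<lambda>x. of_real (1 / B) * synth (coef (residual f k)) x) (tf_shift (p n) \<phi>)"
      by (subst coef_def, subst residual.simps(2), rule l2_inner_diff_left[OF r schwartz_cmult[OF s] atom])
    also have "l2_inner (\<lambda>x. of_real (1 / B) * synth (coef (residual f k)) x) (tf_shift (p n) \<phi>) =
        of_real (1 / B) * l2_inner (synth (coef (residual f k))) (tf_shift (p n) \<phi>)"
      by (rule l2_inner_cmult_left[OF s atom])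
    finally show ?thesis
      by (simp only: step_def coef_def)
  qed
  then show ?case
    using Suc.IH by auto
qed simp

text \<open>A ratio strictly between 0 and 1 that dominates 1 - A/B. The latter may vanish, for
  instance for a tight frame with A = B, while positive roots are taken later.\<close>

definition q :: real
  where "q = B / (A + B)"

lemma q: "0 < q" "q < 1" "1 - A / B \<le> q"
proof -
  show "0 < q" "q < 1"
    using A B by (auto simp: q_def)
  have "(B - A) * (A + B) \<le> B * B"
    by (simp add: algebra_simps)
  then show "1 - A / B \<le> q"
    using A B by (simp add: q_def field_simps)
qed

text \<open>Expanding the square of (1 - S/B) r, the cross term is twice the squared norm of C r
  over B and the last term is at most half of that. What remains is bounded by the lower frame
  inequality, so one step gains the factor 1 - A/B.\<close>

lemma residual_norm:
  assumes "f \<in> schwartz"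
  shows "(l2_norm (residual f k))\<^sup>2 \<le> q ^ k * (l2_norm f)\<^sup>2"
proof (induction k)
  case (Suc k)
  define r where "r = residual f k"
  define E where "E = (ell2_norm (coef r))\<^sup>2"
  have r: "r \<in> schwartz"
    unfolding r_def using assms by (rule residual_schwartz)
  then have s: "synth (coef r) \<in> schwartz"
    by (intro synth_schwartz rapid_coef)
  have re: "Re (l2_inner r (synth (coef r))) = E"
    unfolding l2_inner_commute[OF s r] l2_inner_synth_coef_self[OF r] E_def by simp
  have "(l2_norm (residual f (Suc k)))\<^sup>2 = (l2_norm r)\<^sup>2 - 2 * (1 / B) * E + (1 / B)\<^sup>2 * (l2_norm (synth (coef r)))\<^sup>2"
    unfolding residual.simps r_def[symmetric] l2_norm_diff_scaled[OF r s] re ..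
  also have "\<dots> \<le> (l2_norm r)\<^sup>2 - 2 * (1 / B) * E + (1 / B)\<^sup>2 * (B * E)"
    unfolding E_def by (intro add_left_mono mult_left_mono norm_synth_le rapid_coef r) auto
  also have "\<dots> = (l2_norm r)\<^sup>2 - E / B"
    using B by (simp add: power2_eq_square field_simps)
  also have "\<dots> \<le> (l2_norm r)\<^sup>2 - A * (l2_norm r)\<^sup>2 / B"
    using lower[OF r] B by (intro diff_left_mono divide_right_mono) (auto simp: E_def)
  also have "\<dots> = (1 - A / B) * (l2_norm r)\<^sup>2"
    by (simp add: algebra_simps)
  also have "\<dots> \<le> q * (l2_norm r)\<^sup>2"
    by (intro mult_right_mono q) auto
  also have "\<dots> \<le> q * (q ^ k * (l2_norm f)\<^sup>2)"
    using Suc.IH q by (intro mult_left_mono) (auto simp: r_def)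
  finally show ?case
    by simp
qed simp

text \<open>Interpolation entry by entry: the square of w^N |c| is |c| times w^(2N) |c|. The first
  factor decays geometrically in k by the L2 estimate, the second grows at most polynomially by the
  weighted one, and both bounds are uniform in z and n.\<close>

lemma iterated_coef_decay:
  assumes \<psi>: "\<psi> \<in> schwartz"
  shows "\<exists>\<eta>. summable \<eta> \<and> (\<forall>z k n. wt (p n - z) ^ N * norm (coef (residual (tf_shift z \<psi>) k) n) \<le> \<eta> k)"
proof -
  obtain \<sigma> where \<sigma>: "0 \<le> \<sigma>" "\<And>z. summable (\<lambda>n. 1 / wt (p n - z) ^ M0)" "\<And>z. (\<Sum>n. 1 / wt (p n - z) ^ M0) \<le> \<sigma>"
    by (rule sumE) metis
  have "\<forall>K. \<exists>C. 0 \<le> C \<and> (\<forall>z w. norm (l2_inner (tf_shift z \<psi>) (tf_shift w \<phi>)) \<le> C / wt (z - w) ^ K)"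
    using l2_inner_tf_shift_decayE[OF \<psi> \<phi>] by metis
  then obtain C where C: "\<And>K. 0 \<le> C K" "\<And>K z w. norm (l2_inner (tf_shift z \<psi>) (tf_shift w \<phi>)) \<le> C K / wt (z - w) ^ K"
    by metis
  \<comment> \<open>Coefficients of order \<open>K + M0\<close>: \<open>K\<close> powers cancel the
    weight and \<open>M0\<close> powers make the squares summable over the points, with sum at most
    \<sigma>.\<close>
  define b where "b K = C (K + M0) * sqrt \<sigma>" for K
  have sh: "tf_shift z \<psi> \<in> schwartz" for z
    by (rule schwartz_tf_shift[OF \<psi>])
  have rap: "rapid (coef (tf_shift z \<psi>))" for z
    by (rule rapid_coef[OF sh])
  have b: "ell2_norm (wc z K (coef (tf_shift z \<psi>))) \<le> b K" for z K
  proof (rule ell2I(2))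
    show "0 \<le> b K"
      using C \<sigma> by (simp add: b_def)
    fix m
    have le: "(norm (wc z K (coef (tf_shift z \<psi>)) n))\<^sup>2 \<le> (C (K + M0))\<^sup>2 * (1 / wt (p n - z) ^ M0)" for n
    proof -
      have "norm (wc z K (coef (tf_shift z \<psi>)) n) \<le> wt (p n - z) ^ K * (C (K + M0) / wt (p n - z) ^ (K + M0))"
        unfolding norm_wc coef_def using C(2)[of z "p n" "K + M0"]
        by (intro mult_left_mono) (auto simp: wt_minus[of z])
      also have "\<dots> = C (K + M0) * (1 / wt (p n - z) ^ M0)"
        by (simp add: power_add)
      finally have "(norm (wc z K (coef (tf_shift z \<psi>)) n))\<^sup>2 \<le> (C (K + M0) * (1 / wt (p n - z) ^ M0))\<^sup>2"
        by (intro power_mono) auto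
      also have "\<dots> \<le> (C (K + M0))\<^sup>2 * (1 / wt (p n - z) ^ M0)"
      proof -
        have "(1 / wt (p n - z) ^ M0) * (1 / wt (p n - z) ^ M0) \<le> 1 * (1 / wt (p n - z) ^ M0)"
          by (intro mult_right_mono) (auto simp: divide_le_eq)
        then show ?thesis
          unfolding power_mult_distrib by (intro mult_left_mono) (auto simp: power2_eq_square)
      qed
      finally show ?thesis .
    qed
    have "(\<Sum>n<m. (norm (wc z K (coef (tf_shift z \<psi>)) n))\<^sup>2) \<le> (C (K + M0))\<^sup>2 * (\<Sum>n<m. 1 / wt (p n - z) ^ M0)"
      unfolding sum_distrib_left by (intro sum_mono le)
    also have "\<dots> \<le> (C (K + M0))\<^sup>2 * \<sigma>"
      by (intro mult_left_mono order_trans[OF sum_le_suminf \<sigma>(3)] \<sigma>(2)) auto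
    finally show "(\<Sum>n<m. (norm (wc z K (coef (tf_shift z \<psi>)) n))\<^sup>2) \<le> (b K)\<^sup>2"
      using \<sigma>(1) by (simp add: b_def power_mult_distrib)
  qed
  obtain L where L: "0 \<le> L" "\<And>z c k. rapid c \<Longrightarrow> (\<And>K. ell2_norm (wc z K c) \<le> b K) \<Longrightarrow>
      ell2_norm (wc z (2 * N) ((step ^^ k) c)) \<le> L * (1 + real k) ^ (2 * N)"
    using iterated_step_growth[where N="2 * N" and b=b] by blast
  \<comment> \<open>The l2 norms decay like q^(k/2), and interpolation takes one more square root,
    hence the fourth root of q.\<close>
  define r where "r = sqrt (sqrt q)"
  have r: "0 < r" "r < 1"
    using q by (auto simp: r_def)
  have rq: "(r ^ k)\<^sup>2 = sqrt (q ^ k)" for k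
  proof -
    have "(r ^ k)\<^sup>2 = (r\<^sup>2) ^ k"
      by (metis mult.commute power_mult)
    then show ?thesis
      using q by (simp add: r_def real_sqrt_power)
  qed
  \<comment> \<open>A bound for the squared L2 norm of every shift of \<psi>, read off from the
    lower frame inequality and the weighted estimate of order 0.\<close>
  define F where "F = (b 0)\<^sup>2 / A"
  define P where "P = sqrt (B * F) * L"
  define \<eta> where "\<eta> k = sqrt P * (r ^ k * (1 + real k) ^ N)" for k
  have P: "0 \<le> P"
    using A B L by (simp add: P_def F_def)
  have "wt (p n - z) ^ N * norm (coef (residual (tf_shift z \<psi>) k) n) \<le> \<eta> k" for z k n
  proof -
    let ?f = "tf_shift z \<psi>"
    define c where "c = coef (residual ?f k)"
    have res: "residual ?f k \<in> schwartz"
      by (rule residual_schwartz[OF sh])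
    have rc: "rapid c"
      unfolding c_def by (rule rapid_coef[OF res])
    have point: "norm (d n) \<le> ell2_norm d" if "d \<in> ell2" for d
    proof -
      have "(norm (d n))\<^sup>2 \<le> (\<Sum>i. (norm (d i))\<^sup>2)"
        using that sum_le_suminf[of "\<lambda>i. (norm (d i))\<^sup>2" "{n}"] by (simp add: ell2_def)
      then show ?thesis
        unfolding ell2_norm_def by (rule real_le_rsqrt)
    qed
    have "A * (l2_norm ?f)\<^sup>2 \<le> (ell2_norm (coef ?f))\<^sup>2"
      by (rule lower[OF sh])
    also have "\<dots> \<le> (b 0)\<^sup>2"
    proof (rule power_mono)
      have "wc z 0 (coef ?f) = coef ?f"
        by (simp add: wc_def fun_eq_iff)
      then show "ell2_norm (coef ?f) \<le> b 0"
        using b[of z 0] by simp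
    qed (intro ell2_norm_nonneg rapid_ell2 rap)
    finally have fF: "(l2_norm ?f)\<^sup>2 \<le> F"
      using A by (simp add: F_def field_simps)
    have "(ell2_norm c)\<^sup>2 \<le> B * (l2_norm (residual ?f k))\<^sup>2"
      unfolding c_def by (rule upper[OF res])
    also have "\<dots> \<le> B * (q ^ k * (l2_norm ?f)\<^sup>2)"
      using B by (intro mult_left_mono residual_norm sh) auto
    also have "\<dots> \<le> B * (q ^ k * F)"
      using B q by (intro mult_left_mono fF) auto
    finally have "ell2_norm c \<le> sqrt (B * (q ^ k * F))"
      by (rule real_le_rsqrt)
    also have "\<dots> = sqrt (B * F) * (r ^ k)\<^sup>2"
      unfolding rq by (simp add: real_sqrt_mult)
    finally have 1: "ell2_norm c \<le> sqrt (B * F) * (r ^ k)\<^sup>2" .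
    have 2: "ell2_norm (wc z (2 * N) c) \<le> L * (1 + real k) ^ (2 * N)"
      unfolding c_def coef_residual[OF sh] by (rule L(2)[OF rap b])
    have "(wt (p n - z) ^ N * norm (c n))\<^sup>2 = norm (c n) * norm (wc z (2 * N) c n)"
      unfolding norm_wc by (simp add: power_mult_distrib power2_eq_square power_mult)
    also have "\<dots> \<le> (sqrt (B * F) * (r ^ k)\<^sup>2) * (L * (1 + real k) ^ (2 * N))"
      by (intro mult_mono order_trans[OF point 1] order_trans[OF point 2] rapid_ell2[OF rc] wc_ell2[OF rc])
        (use A B in \<open>auto simp: F_def\<close>)
    also have "\<dots> = (\<eta> k)\<^sup>2"
      using P by (simp add: \<eta>_def P_def power_mult_distrib flip: power_mult) (simp add: mult.commute)
    finally show ?thesis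
      unfolding c_def by (rule power2_le_imp_le) (use P r in \<open>simp add: \<eta>_def\<close>)
  qed
  moreover have "summable \<eta>"
    unfolding \<eta>_def by (intro summable_mult summable_power_mult_geometric r)
  ultimately show ?thesis
    by blast
qed

text \<open>The coefficients are \<open>tail 0\<close>, the Neumann series summed entry by entry.
  The difference h between f and its synthesis equals \<open>residual f j - synth (tail j)\<close>
  for every j; both parts tend to 0 in L2, so h vanishes.\<close>

lemma frame_expansion:
  assumes \<psi>: "\<psi> \<in> schwartz"
  obtains C :: "nat \<Rightarrow> real" where "\<And>N. 0 \<le> C N"
    "\<And>z. \<exists>c. (\<forall>N n. norm (c n) \<le> C N / wt (p n - z) ^ N) \<and> rapid c \<and> tf_shift z \<psi> = synth c"
proof -
  have "\<forall>N. \<exists>\<eta>. summable \<eta> \<and> (\<forall>z k n. wt (p n - z) ^ N * norm (coef (residual (tf_shift z \<psi>) k) n) \<le> \<eta> k)"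
    using iterated_coef_decay[OF \<psi>] by blast
  then obtain \<eta> where \<eta>: "\<And>N. summable (\<eta> N)"
    "\<And>N z k n. wt (p n - z) ^ N * norm (coef (residual (tf_shift z \<psi>) k) n) \<le> \<eta> N k"
    by metis
  have \<eta>0: "0 \<le> \<eta> N k" for N k
    by (rule order_trans[OF _ \<eta>(2)[of 0 0 N k]]) simp
  obtain \<sigma> where \<sigma>: "0 \<le> \<sigma>" "\<And>z. summable (\<lambda>n. 1 / wt (p n - z) ^ M0)" "\<And>z. (\<Sum>n. 1 / wt (p n - z) ^ M0) \<le> \<sigma>"
    by (rule sumE) metis
  define C where "C N = (1 / B) * suminf (\<eta> N)" for N
  have C0: "0 \<le> C N" for N
    using B \<eta> \<eta>0 by (simp add: C_def suminf_nonneg)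
  have "\<exists>c. (\<forall>N n. norm (c n) \<le> C N / wt (p n - z) ^ N) \<and> rapid c \<and> tf_shift z \<psi> = synth c" for z
  proof -
    define f where "f = tf_shift z \<psi>"
    have f: "f \<in> schwartz"
      unfolding f_def by (rule schwartz_tf_shift[OF \<psi>])
    define c where "c k = coef (residual f k)" for k
    have c: "wt (p n - z) ^ N * norm (c k n) \<le> \<eta> N k" for N n k
      using \<eta>(2) by (simp add: c_def f_def)
    define tail where "tail j n = of_real (1 / B) * (\<Sum>k. c (k + j) n)" for j n
    have sn: "summable (\<lambda>k. norm (c k n))" for n
      by (rule summable_comparison_test'[OF \<eta>(1)[of 0]]) (use c[of n 0] in simp)
    have tail_le: "wt (p n - z) ^ N * norm (tail j n) \<le> (1 / B) * (\<Sum>k. \<eta> N (k + j))" for N j n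
    proof -
      note sj = summable_ignore_initial_segment[OF sn[of n], of j]
      have "wt (p n - z) ^ N * norm (\<Sum>k. c (k + j) n) \<le> wt (p n - z) ^ N * (\<Sum>k. norm (c (k + j) n))"
        by (intro mult_left_mono summable_norm sj) auto
      also have "\<dots> = (\<Sum>k. wt (p n - z) ^ N * norm (c (k + j) n))"
        by (rule suminf_mult[OF sj, symmetric])
      also have "\<dots> \<le> (\<Sum>k. \<eta> N (k + j))"
        by (intro suminf_le c summable_mult sj summable_ignore_initial_segment \<eta>)
      finally have "(1 / B) * (wt (p n - z) ^ N * norm (\<Sum>k. c (k + j) n)) \<le> (1 / B) * (\<Sum>k. \<eta> N (k + j))"
        using B by (intro mult_left_mono) auto
      then show ?thesis
        unfolding tail_def norm_mult norm_of_real using B by (simp add: mult.left_commute)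
    qed
    have c0: "norm (tail 0 n) \<le> C N / wt (p n - z) ^ N" for N n
    proof -
      have "wt (p n - z) ^ N * norm (tail 0 n) \<le> C N"
        using tail_le[of n N 0] by (simp add: C_def)
      then show ?thesis
        by (simp add: pos_le_divide_eq mult.commute)
    qed
    have rt: "rapid (tail j)" for j
      unfolding rapid_def
    proof
      fix N
      have "wt (p n) ^ N * norm (tail j n) \<le> wt z ^ N * ((1 / B) * (\<Sum>k. \<eta> N (k + j)))" for n
      proof -
        have "wt (p n) ^ N \<le> wt z ^ N * wt (p n - z) ^ N"
          using wt_le_mult_diff[of "p n" z] by (metis mult.commute power_mono power_mult_distrib wt_nonneg)
        then have "wt (p n) ^ N * norm (tail j n) \<le> wt z ^ N * (wt (p n - z) ^ N * norm (tail j n))"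
          unfolding mult.assoc[symmetric] by (intro mult_right_mono) auto
        also have "\<dots> \<le> wt z ^ N * ((1 / B) * (\<Sum>k. \<eta> N (k + j)))"
          by (intro mult_left_mono tail_le) auto
        finally show ?thesis .
      qed
      then show "\<exists>C. \<forall>n. wt (p n) ^ N * norm (tail j n) \<le> C"
        by blast
    qed
    have tail_Suc: "tail j n = tail (Suc j) n - of_real (- (1 / B)) * c j n" for j n
    proof -
      have "summable (\<lambda>k. c k n)"
        by (rule summable_norm_cancel[OF sn])
      from suminf_split_head[OF summable_ignore_initial_segment[OF this, of j]]
      have "(\<Sum>k. c (k + j) n) = (\<Sum>k. c (k + Suc j) n) + c j n"
        by simp
      then show ?thesis
        by (simp add: tail_def algebra_simps)
    qed
    have synth_tail: "synth (tail j) x = synth (tail (Suc j)) x + of_real (1 / B) * synth (c j) x" for j x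
    proof -
      have "tail j = (\<lambda>n. tail (Suc j) n - of_real (- (1 / B)) * c j n)"
        using tail_Suc by blast
      then have "synth (tail j) x = synth (tail (Suc j)) x - of_real (- (1 / B)) * synth (c j) x"
        using synth_diff_scale[OF rt, of "c j" "Suc j" "of_real (- (1 / B))" x] rapid_coef[OF residual_schwartz[OF f]]
        by (simp add: c_def)
      then show ?thesis by simp
    qed
    \<comment> \<open>\<open>h\<close> does not depend on j, while its representation by
      \<open>h_eq\<close> does. The telescoping relation \<open>synth_tail\<close> thus replaces an
      exchange of \<open>synth\<close> with an infinite sum over k.\<close>
    define h where "h = (\<lambda>x. f x - synth (tail 0) x)"
    have h: "h \<in> schwartz"
      unfolding h_def by (intro schwartz_diff f synth_schwartz rt)
    have h_eq: "h x = residual f j x - synth (tail j) x" for x j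
    proof (induction j)
      case (Suc j)
      then show ?case
        using synth_tail[of j x] by (simp add: c_def)
    qed (simp add: h_def)
    have bound: "(l2_norm h)\<^sup>2 \<le> 2 * (q ^ j * (l2_norm f)\<^sup>2) + 2 * (B * (((1 / B) * (\<Sum>k. \<eta> M0 (k + j)))\<^sup>2 * \<sigma>))" for j
    proof -
      define t where "t = (1 / B) * (\<Sum>k. \<eta> M0 (k + j))"
      have r: "residual f j \<in> schwartz" and s: "synth (tail j) \<in> schwartz"
        using f rt by (auto intro: residual_schwartz synth_schwartz)
      have "(norm (h x))\<^sup>2 \<le> 2 * (norm (residual f j x))\<^sup>2 + 2 * (norm (synth (tail j) x))\<^sup>2" for x
      proof -
        have "(norm (h x))\<^sup>2 \<le> (norm (residual f j x) + norm (synth (tail j) x))\<^sup>2"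
          unfolding h_eq[of x j] by (intro power_mono norm_triangle_ineq4) auto
        also have "\<dots> \<le> 2 * (norm (residual f j x))\<^sup>2 + 2 * (norm (synth (tail j) x))\<^sup>2"
          using sum_squares_bound[of "norm (residual f j x)" "norm (synth (tail j) x)"]
          by (simp add: power2_sum)
        finally show ?thesis .
      qed
      then have "(\<integral>x. (norm (h x))\<^sup>2 \<partial>lborel) \<le> (\<integral>x. 2 * (norm (residual f j x))\<^sup>2 + 2 * (norm (synth (tail j) x))\<^sup>2 \<partial>lborel)"
        by (intro integral_mono Bochner_Integration.integrable_add integrable_mult_right schwartz_norm2_integrable h r s)
      also have "\<dots> = 2 * (l2_norm (residual f j))\<^sup>2 + 2 * (l2_norm (synth (tail j)))\<^sup>2"
        using schwartz_norm2_integrable[OF r] schwartz_norm2_integrable[OF s]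
        by (simp add: l2_norm_lborel r s)
      finally have "(l2_norm h)\<^sup>2 \<le> 2 * (l2_norm (residual f j))\<^sup>2 + 2 * (l2_norm (synth (tail j)))\<^sup>2"
        by (simp add: l2_norm_lborel h)
      also have "\<dots> \<le> 2 * (q ^ j * (l2_norm f)\<^sup>2) + 2 * (B * (ell2_norm (tail j))\<^sup>2)"
        by (intro add_mono mult_left_mono residual_norm norm_synth_le f rt) auto
      also have "(ell2_norm (tail j))\<^sup>2 \<le> t\<^sup>2 * \<sigma>"
      proof -
        have "(norm (tail j n))\<^sup>2 \<le> t\<^sup>2 * (1 / wt (p n - z) ^ M0)" for n
        proof -
          have "norm (tail j n) \<le> t * (1 / wt (p n - z) ^ M0)"
            using tail_le[of n M0 j] unfolding t_def[symmetric] by (simp add: pos_le_divide_eq mult.commute)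
          then have "(norm (tail j n))\<^sup>2 \<le> (t * (1 / wt (p n - z) ^ M0))\<^sup>2"
            by (intro power_mono) auto
          also have "\<dots> \<le> t\<^sup>2 * (1 / wt (p n - z) ^ M0)"
          proof -
            have "(1 / wt (p n - z) ^ M0) * (1 / wt (p n - z) ^ M0) \<le> 1 * (1 / wt (p n - z) ^ M0)"
              by (intro mult_right_mono) (auto simp: divide_le_eq)
            then show ?thesis
              unfolding power_mult_distrib by (intro mult_left_mono) (auto simp: power2_eq_square)
          qed
          finally show ?thesis .
        qed
        then have "(\<Sum>n. (norm (tail j n))\<^sup>2) \<le> (\<Sum>n. t\<^sup>2 * (1 / wt (p n - z) ^ M0))"
          using rapid_ell2[OF rt[of j]] by (intro suminf_le summable_mult \<sigma>) (auto simp: ell2_def)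
        also have "\<dots> = t\<^sup>2 * (\<Sum>n. 1 / wt (p n - z) ^ M0)"
          by (rule suminf_mult[OF \<sigma>(2)])
        also have "\<dots> \<le> t\<^sup>2 * \<sigma>"
          by (intro mult_left_mono \<sigma>) auto
        finally show ?thesis
          unfolding ell2_norm_power2[OF rapid_ell2[OF rt]] .
      qed
      finally show ?thesis
        using B unfolding t_def by (simp add: mult_left_mono)
    qed
    have "(\<lambda>j. 2 * (q ^ j * (l2_norm f)\<^sup>2) + 2 * (B * (((1 / B) * (\<Sum>k. \<eta> M0 (k + j)))\<^sup>2 * \<sigma>))) \<longlonglongrightarrow>
        2 * (0 * (l2_norm f)\<^sup>2) + 2 * (B * (((1 / B) * 0)\<^sup>2 * \<sigma>))"
      by (intro tendsto_intros LIMSEQ_realpow_zero suminf_exist_split2 \<eta>) (use q in auto)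
    then have "(l2_norm h)\<^sup>2 \<le> 2 * (0 * (l2_norm f)\<^sup>2) + 2 * (B * (((1 / B) * 0)\<^sup>2 * \<sigma>))"
      by (rule LIMSEQ_le_const) (use bound in auto)
    then have "l2_norm h = 0"
      by simp
    then have "h x = 0" for x
      by (rule l2_norm_zero_imp[OF h])
    then have "f = synth (tail 0)"
      by (auto simp: h_def)
    then show ?thesis
      using c0 rt unfolding f_def by blast
  qed
  then show thesis
    using that[of C] C0 by blast
qed

lemma stft_expansion:
  assumes u: "u \<in> tempered_distributions" and \<psi>: "\<psi> \<in> schwartz"
  obtains C :: "nat \<Rightarrow> real" where "\<And>N. 0 \<le> C N"
    "\<And>z. \<exists>c. (\<forall>N n. norm (c n) \<le> C N / wt (p n - z) ^ N) \<and> (\<lambda>n. c n * stft \<phi> u (p n)) sums stft \<psi> u z"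
proof -
  obtain C where C: "\<And>N. 0 \<le> C N"
    "\<And>z. \<exists>c. (\<forall>N n. norm (c n) \<le> C N / wt (p n - z) ^ N) \<and> rapid c \<and> tf_shift z \<psi> = synth c"
    using frame_expansion[OF \<psi>] by metis
  have "\<exists>c. (\<forall>N n. norm (c n) \<le> C N / wt (p n - z) ^ N) \<and> (\<lambda>n. c n * stft \<phi> u (p n)) sums stft \<psi> u z" for z
  proof -
    obtain c where c: "\<And>N n. norm (c n) \<le> C N / wt (p n - z) ^ N" "rapid c" "tf_shift z \<psi> = synth c"
      using C(2) by blast
    have "(\<lambda>n. u (\<lambda>y. c n * tf_shift (p n) \<phi> y)) sums stft \<psi> u z"
      unfolding stft_def c(3) by (rule synth_functional[OF tempered_distribution_functional[OF u] c(2)])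
    moreover have "u (\<lambda>y. c n * tf_shift (p n) \<phi> y) = cnj (c n) * stft \<phi> u (p n)" for n
      using u atom[of n] by (simp add: tempered_distributions_def stft_def)
    ultimately show ?thesis
      \<comment> \<open>\<open>u\<close> is conjugate linear, so the coefficients come out
        conjugated; their moduli are unchanged.\<close>
      using c(1) by (intro exI[of _ "\<lambda>n. cnj (c n)"]) simp
  qed
  then show thesis
    using that C(1) by blast
qed

end

section \<open>Decay in cones\<close>

text \<open>Continuity of \<open>u\<close> involves finitely many seminorms, and each grows
  polynomially on the shifts of \<phi>. The exponent \<open>M\<close> is the sum of the finitely
  many orders, which dominates each of them.\<close>

lemma stft_growth:
  assumes u: "u \<in> tempered_distributions" and \<phi>: "\<phi> \<in> schwartz"
  shows "\<exists>D M. 0 \<le> D \<and> (\<forall>z. norm (stft \<phi> u z) \<le> D * wt z ^ M)"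
proof -
  obtain I C where I: "finite I" "\<And>f. f \<in> schwartz \<Longrightarrow> norm (u f) \<le> C * (\<Sum>(N, is)\<in>I. schwartz_seminorm N is f)"
    using tempered_distribution_functional[OF u] unfolding tempered_functional_def by blast
  have "\<forall>x. \<exists>K\<ge>0. \<forall>z y. wt y ^ fst x * norm (partial_derivs (snd x) (tf_shift z \<phi>) y) \<le> K * wt z ^ (fst x + length (snd x))"
    using tf_shift_bound[OF \<phi>] by blast
  then obtain K where K: "\<And>x. 0 \<le> K x"
    "\<And>x z y. wt y ^ fst x * norm (partial_derivs (snd x) (tf_shift z \<phi>) y) \<le> K x * wt z ^ (fst x + length (snd x))"
    by metis
  define M where "M = (\<Sum>x\<in>I. fst x + length (snd x))"
  have "norm (stft \<phi> u z) \<le> (\<bar>C\<bar> * (\<Sum>x\<in>I. K x)) * wt z ^ M" for z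
  proof -
    have s: "tf_shift z \<phi> \<in> schwartz"
      by (rule schwartz_tf_shift[OF \<phi>])
    have "schwartz_seminorm (fst x) (snd x) (tf_shift z \<phi>) \<le> K x * wt z ^ M" if x: "x \<in> I" for x
    proof -
      have "schwartz_seminorm (fst x) (snd x) (tf_shift z \<phi>) \<le> K x * wt z ^ (fst x + length (snd x))"
        by (rule schwartz_seminorm_le[OF K(2)])
      also have "\<dots> \<le> K x * wt z ^ M"
      proof (intro mult_left_mono power_increasing K)
        show "fst x + length (snd x) \<le> M"
          unfolding M_def using member_le_sum[OF x, of "\<lambda>x. fst x + length (snd x)"] I(1) by simp
      qed auto
      finally show ?thesis .
    qed
    then have "(\<Sum>(N, is)\<in>I. schwartz_seminorm N is (tf_shift z \<phi>)) \<le> (\<Sum>x\<in>I. K x * wt z ^ M)"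
      unfolding case_prod_beta by (rule sum_mono)
    moreover have "0 \<le> (\<Sum>(N, is)\<in>I. schwartz_seminorm N is (tf_shift z \<phi>))"
      by (intro sum_nonneg) (auto simp: schwartz_seminorm_nonneg s)
    ultimately have "\<bar>C\<bar> * (\<Sum>(N, is)\<in>I. schwartz_seminorm N is (tf_shift z \<phi>)) \<le> \<bar>C\<bar> * (\<Sum>x\<in>I. K x * wt z ^ M)"
      and "C * (\<Sum>(N, is)\<in>I. schwartz_seminorm N is (tf_shift z \<phi>)) \<le> \<bar>C\<bar> * (\<Sum>(N, is)\<in>I. schwartz_seminorm N is (tf_shift z \<phi>))"
      by (auto intro: mult_left_mono mult_right_mono)
    then show ?thesis
      using I(2)[OF s] by (simp add: stft_def sum_distrib_right mult.assoc)
  qed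
  moreover have "0 \<le> \<bar>C\<bar> * (\<Sum>x\<in>I. K x)"
    by (intro mult_nonneg_nonneg sum_nonneg K) auto
  ultimately show ?thesis
    by blast
qed

text \<open>The two weights are comparable, and every real exponent lies below a natural one while
  \<open>jbracket\<close> is at least 1.\<close>

lemma rapid_decay_iff:
  fixes V :: "'a::real_normed_vector \<Rightarrow> complex"
  shows "(\<forall>N::real. N \<ge> 0 \<longrightarrow> bdd_above ((\<lambda>z. jbracket z powr N * norm (V z)) ` S)) \<longleftrightarrow>
    (\<forall>N::nat. \<exists>D. \<forall>z\<in>S. wt z ^ N * norm (V z) \<le> D)"
proof (intro iffI allI impI)
  fix N :: nat
  assume "\<forall>N::real. N \<ge> 0 \<longrightarrow> bdd_above ((\<lambda>z. jbracket z powr N * norm (V z)) ` S)"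
  then have "bdd_above ((\<lambda>z. jbracket z powr real N * norm (V z)) ` S)"
    by simp
  then obtain D where D: "\<And>z. z \<in> S \<Longrightarrow> jbracket z powr real N * norm (V z) \<le> D"
    by (auto simp: bdd_above_def)
  have "wt z ^ N * norm (V z) \<le> 2 ^ N * D" if z: "z \<in> S" for z
  proof -
    have j: "0 < jbracket z"
      using jbracket_ge1[of z] by linarith
    have "wt z ^ N * norm (V z) \<le> (2 * jbracket z) ^ N * norm (V z)"
      by (intro mult_right_mono power_mono wt_le_jbracket) auto
    also have "\<dots> = 2 ^ N * (jbracket z powr real N * norm (V z))"
      using j by (simp add: power_mult_distrib powr_realpow)
    also have "\<dots> \<le> 2 ^ N * D"
      by (intro mult_left_mono D z) auto
    finally show ?thesis .
  qed
  then show "\<exists>D. \<forall>z\<in>S. wt z ^ N * norm (V z) \<le> D"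
    by blast
next
  fix N :: real
  assume N: "0 \<le> N" and all: "\<forall>N::nat. \<exists>D. \<forall>z\<in>S. wt z ^ N * norm (V z) \<le> D"
  obtain K :: nat where K: "N \<le> real K"
    using real_arch_simple by blast
  obtain D where D: "\<And>z. z \<in> S \<Longrightarrow> wt z ^ K * norm (V z) \<le> D"
    using all by blast
  have "jbracket z powr N * norm (V z) \<le> D" if z: "z \<in> S" for z
  proof -
    have j: "1 \<le> jbracket z"
      by (rule jbracket_ge1)
    have "jbracket z powr N \<le> jbracket z powr real K"
      by (rule powr_mono[OF K j])
    also have "\<dots> = jbracket z ^ K"
      using j by (simp add: powr_realpow)
    also have "\<dots> \<le> wt z ^ K"
      using j by (intro power_mono jbracket_le_wt) auto
    finally show ?thesis
      using D[OF z] mult_right_mono[of "jbracket z powr N" "wt z ^ K" "norm (V z)"] by simp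
  qed
  then show "bdd_above ((\<lambda>z. jbracket z powr N * norm (V z)) ` S)"
    by (auto simp: bdd_above_def)
qed

text \<open>The smaller cone is generated by a ball around z0 of at most half the available radius.
  By homogeneity its distance to the complement of \<Gamma> grows linearly along each ray.\<close>

lemma open_cone_shrink:
  fixes z0 :: "'a::real_normed_vector"
  assumes \<Gamma>: "open \<Gamma>" "conic_set \<Gamma>" "z0 \<in> \<Gamma>" and z0: "z0 \<noteq> 0"
  obtains \<Gamma>' \<epsilon> where "open \<Gamma>'" "conic_set \<Gamma>'" "\<Gamma>' \<subseteq> - {0}" "z0 \<in> \<Gamma>'" "0 < \<epsilon>" "\<epsilon> \<le> 1"
    "\<And>z w. z \<in> \<Gamma>' \<Longrightarrow> w \<notin> \<Gamma> \<Longrightarrow> \<epsilon> * norm z \<le> norm (w - z)"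
proof -
  obtain e where e: "e > 0" "ball z0 e \<subseteq> \<Gamma>"
    using \<Gamma>(1,3) open_contains_ball by blast
  define d where "d = min (e / 2) (norm z0 / 2)"
  have d: "0 < d" "2 * d \<le> e" "2 * d \<le> norm z0"
    using e z0 by (auto simp: d_def)
  define \<Gamma>' where "\<Gamma>' = (\<Union>t\<in>{0<..}. (\<lambda>y. t *\<^sub>R y) ` ball z0 d)"
  \<comment> \<open>For z = t y with y in the ball, norm y is at most \<open>2 * norm z0\<close>, so
    \<open>\<epsilon> * norm z\<close> is at most t d. A point w closer to z than this has w/t
    within 2 d of z0, hence in \<Gamma>.\<close>
  define \<epsilon> where "\<epsilon> = d / (2 * norm z0)"
  show thesis
  proof (rule that[of \<Gamma>' \<epsilon>])
    show "open \<Gamma>'"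
      unfolding \<Gamma>'_def by (intro open_UN ballI open_scaling) auto
    show "conic_set \<Gamma>'"
      unfolding conic_set_def
    proof (intro ballI allI impI)
      fix z and s :: real assume "z \<in> \<Gamma>'" and s: "s > 0"
      then obtain t y where t: "t > 0" "y \<in> ball z0 d" "z = t *\<^sub>R y"
        by (auto simp: \<Gamma>'_def)
      then have "s *\<^sub>R z = (s * t) *\<^sub>R y" "s * t > 0"
        using s by auto
      then show "s *\<^sub>R z \<in> \<Gamma>'"
        unfolding \<Gamma>'_def using t(2) by blast
    qed
    show "\<Gamma>' \<subseteq> - {0}"
      using d by (auto simp: \<Gamma>'_def dist_norm)
    show "z0 \<in> \<Gamma>'"
      unfolding \<Gamma>'_def using d by (intro UN_I[of 1]) auto
    show "0 < \<epsilon>" "\<epsilon> \<le> 1"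
      using d z0 by (auto simp: \<epsilon>_def field_simps)
    fix z w assume z: "z \<in> \<Gamma>'" and w: "w \<notin> \<Gamma>"
    obtain t y where t: "t > 0" "y \<in> ball z0 d" "z = t *\<^sub>R y"
      using z by (auto simp: \<Gamma>'_def)
    have "norm y \<le> norm z0 + d"
      using t(2) norm_triangle_ineq2[of y z0] by (auto simp: dist_norm norm_minus_commute)
    then have y: "norm y \<le> 2 * norm z0"
      using d by linarith
    show "\<epsilon> * norm z \<le> norm (w - z)"
    proof (rule ccontr)
      assume "\<not> \<epsilon> * norm z \<le> norm (w - z)"
      then have "norm (w - z) < \<epsilon> * (t * norm y)"
        using t by simp
      also have "\<dots> \<le> \<epsilon> * (t * (2 * norm z0))"
        using y t \<open>0 < \<epsilon>\<close> by (intro mult_left_mono) auto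
      also have "\<dots> = t * d"
        using z0 by (simp add: \<epsilon>_def)
      finally have "norm (w - z) / t < d"
        using t(1) by (simp add: pos_divide_less_eq mult.commute)
      then have "norm ((1 / t) *\<^sub>R (w - z)) < d"
        unfolding norm_scaleR using t(1) by simp
      moreover have "(1 / t) *\<^sub>R (w - z) = (1 / t) *\<^sub>R w - y"
        using t by (simp add: scaleR_diff_right)
      ultimately have "dist y ((1 / t) *\<^sub>R w) < d"
        by (simp add: dist_norm norm_minus_commute)
      then have "dist z0 ((1 / t) *\<^sub>R w) < d + d"
        using t(2) dist_triangle[of z0 "(1 / t) *\<^sub>R w" y] by simp
      then have "(1 / t) *\<^sub>R w \<in> \<Gamma>"
        using e d by auto
      then have "t *\<^sub>R ((1 / t) *\<^sub>R w) \<in> \<Gamma>"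
        using \<Gamma>(2) t(1) unfolding conic_set_def by blast
      then show False
        using w t(1) by simp
    qed
  qed
qed

context gabor_frame_points
begin

text \<open>The expansion of the \<psi>-transform at z in the smaller cone splits by the position of
  \<open>p n\<close>. Inside \<Gamma> the \<phi>-transform decays, and Peetre's inequality transfers
  that to z. Outside, \<open>p n\<close> is at distance at least a multiple of norm z, so the
  coefficients outweigh the polynomial growth of the \<phi>-transform.\<close>

lemma WF'_subset_WF_G:
  assumes u: "u \<in> tempered_distributions" and \<psi>: "\<psi> \<in> schwartz"
  shows "WF' \<psi> u \<subseteq> WF_G \<phi> (range p) u"
proof
  fix z0 assume z0: "z0 \<in> WF' \<psi> u"
  then have z0n: "z0 \<noteq> 0"
    by (simp add: WF'_def)
  show "z0 \<in> WF_G \<phi> (range p) u"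
  proof (rule ccontr)
    assume "z0 \<notin> WF_G \<phi> (range p) u"
    then obtain \<Gamma> where \<Gamma>: "open \<Gamma>" "conic_set \<Gamma>" "\<Gamma> \<subseteq> - {0}" "z0 \<in> \<Gamma>"
      and dec: "\<forall>N::nat. \<exists>D. \<forall>z\<in>range p \<inter> \<Gamma>. wt z ^ N * norm (stft \<phi> u z) \<le> D"
      using z0n unfolding WF_G_def rapid_decay_iff by blast
    obtain \<Gamma>' \<epsilon> where \<Gamma>': "open \<Gamma>'" "conic_set \<Gamma>'" "\<Gamma>' \<subseteq> - {0}" "z0 \<in> \<Gamma>'" and \<epsilon>: "0 < \<epsilon>" "\<epsilon> \<le> 1"
      and far: "\<And>z w. z \<in> \<Gamma>' \<Longrightarrow> w \<notin> \<Gamma> \<Longrightarrow> \<epsilon> * norm z \<le> norm (w - z)"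
      using open_cone_shrink[OF \<Gamma>(1,2,4) z0n] by metis
    obtain D1 M1 where D1: "0 \<le> D1" "\<And>z. norm (stft \<phi> u z) \<le> D1 * wt z ^ M1"
      using stft_growth[OF u \<phi>] by blast
    obtain C where C: "\<And>N. 0 \<le> C N"
      "\<And>z. \<exists>c. (\<forall>N n. norm (c n) \<le> C N / wt (p n - z) ^ N) \<and> (\<lambda>n. c n * stft \<phi> u (p n)) sums stft \<psi> u z"
      using stft_expansion[OF u \<psi>] by metis
    obtain \<sigma> where \<sigma>: "0 \<le> \<sigma>" "\<And>z. summable (\<lambda>n. 1 / wt (p n - z) ^ M0)" "\<And>z. (\<Sum>n. 1 / wt (p n - z) ^ M0) \<le> \<sigma>"
      by (rule sumE) metis
    have "\<exists>D. \<forall>z\<in>\<Gamma>'. wt z ^ N * norm (stft \<psi> u z) \<le> D" for N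
    proof -
      obtain D where D: "\<And>n. p n \<in> \<Gamma> \<Longrightarrow> wt (p n) ^ N * norm (stft \<phi> u (p n)) \<le> D"
        using dec by blast
      define E1 where "E1 = C (N + M0) * \<bar>D\<bar>"
      \<comment> \<open>Exponents of the coefficient decay: \<open>M0\<close> for the sum over the
        points, \<open>M1\<close> for passing from \<open>wt (p n)\<close> to \<open>wt z\<close> in
        the growth bound, and \<open>N + M1\<close> for the resulting power of \<open>wt z\<close>,
        which is at most a multiple of the same power of the distance weight.\<close>
      define E2 where "E2 = C (M0 + M1 + (N + M1)) * D1 * (1 / \<epsilon>) ^ (N + M1)"
      have E: "0 \<le> E1" "0 \<le> E2"
        using C(1) D1(1) \<epsilon> by (auto simp: E1_def E2_def)
      have "wt z ^ N * norm (stft \<psi> u z) \<le> (E1 + E2) * \<sigma>" if z: "z \<in> \<Gamma>'" for z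
      proof -
        obtain c where c: "\<And>N n. norm (c n) \<le> C N / wt (p n - z) ^ N" "(\<lambda>n. c n * stft \<phi> u (p n)) sums stft \<psi> u z"
          using C(2) by blast
        have le: "norm (of_real (wt z ^ N) * (c n * stft \<phi> u (p n))) \<le> (E1 + E2) * (1 / wt (p n - z) ^ M0)" for n
        proof (cases "p n \<in> \<Gamma>")
          case True
          have "wt z ^ N \<le> wt (p n - z) ^ N * wt (p n) ^ N"
            using wt_le_mult_diff[of z "p n"] by (metis power_mono power_mult_distrib wt_minus wt_nonneg)
          then have "norm (of_real (wt z ^ N) * (c n * stft \<phi> u (p n))) \<le>
              (wt (p n - z) ^ N * wt (p n) ^ N) * (C (N + M0) / wt (p n - z) ^ (N + M0) * norm (stft \<phi> u (p n)))"
            unfolding norm_mult norm_of_real by (intro mult_mono c mult_right_mono) (auto simp: C(1))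
          also have "\<dots> = C (N + M0) * (wt (p n) ^ N * norm (stft \<phi> u (p n))) * (1 / wt (p n - z) ^ M0)"
            by (simp add: power_add)
          also have "\<dots> \<le> E1 * (1 / wt (p n - z) ^ M0)"
            unfolding E1_def using D[OF True] C(1) by (intro mult_right_mono mult_left_mono) auto
          also have "\<dots> \<le> (E1 + E2) * (1 / wt (p n - z) ^ M0)"
            using E by (intro mult_right_mono) auto
          finally show ?thesis .
        next
          case False
          define a where "a = wt (p n - z)"
          \<comment> \<open>This uses \<epsilon> \<le> 1 to handle the constant 1 inside
            \<open>wt\<close>.\<close>
          have "\<epsilon> * wt z \<le> a"
            using far[OF z False] \<epsilon> by (simp add: a_def wt_def distrib_left)
          then have "wt z \<le> (1 / \<epsilon>) * a"
            using \<epsilon> by (simp add: field_simps)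
          then have 1: "wt z ^ (N + M1) \<le> (1 / \<epsilon>) ^ (N + M1) * a ^ (N + M1)"
            by (metis power_mono power_mult_distrib wt_nonneg)
          have 2: "wt (p n) ^ M1 \<le> a ^ M1 * wt z ^ M1"
            unfolding a_def using wt_le_mult_diff[of "p n" z] by (metis power_mono power_mult_distrib wt_nonneg)
          have a: "0 < a"
            by (simp add: a_def)
          have "norm (stft \<phi> u (p n)) \<le> D1 * (a ^ M1 * wt z ^ M1)"
            by (rule order_trans[OF D1(2)]) (intro mult_left_mono 2 D1(1))
          then have "norm (of_real (wt z ^ N) * (c n * stft \<phi> u (p n))) \<le>
              wt z ^ N * ((C (M0 + M1 + (N + M1)) / a ^ (M0 + M1 + (N + M1))) * (D1 * (a ^ M1 * wt z ^ M1)))"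
            unfolding norm_mult norm_of_real using c(1)[of n "M0 + M1 + (N + M1)"]
            by (intro mult_mono) (auto simp: C(1) a_def)
          also have "\<dots> = (C (M0 + M1 + (N + M1)) / a ^ (M0 + (N + M1))) * D1 * wt z ^ (N + M1)"
            using a by (simp add: power_add)
          also have "\<dots> \<le> (C (M0 + M1 + (N + M1)) / a ^ (M0 + (N + M1))) * D1 * ((1 / \<epsilon>) ^ (N + M1) * a ^ (N + M1))"
            using C(1) D1(1) a by (intro mult_left_mono 1) auto
          also have "\<dots> = E2 * (1 / a ^ M0)"
            using a by (simp add: E2_def power_add)
          also have "\<dots> \<le> (E1 + E2) * (1 / a ^ M0)"
            using E a by (intro mult_right_mono) auto
          finally show ?thesis
            by (simp add: a_def)
        qed
        have s: "summable (\<lambda>n. (E1 + E2) * (1 / wt (p n - z) ^ M0))"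
          by (intro summable_mult \<sigma>)
        have sn: "summable (\<lambda>n. norm (of_real (wt z ^ N) * (c n * stft \<phi> u (p n))))"
          by (rule summable_comparison_test'[OF s]) (use le in simp)
        have "wt z ^ N * norm (stft \<psi> u z) = norm (\<Sum>n. of_real (wt z ^ N) * (c n * stft \<phi> u (p n)))"
          using sums_unique[OF sums_mult[OF c(2), of "of_real (wt z ^ N)"]] by (metis norm_mult norm_of_real abs_of_nonneg wt_nonneg zero_le_power)
        also have "\<dots> \<le> (\<Sum>n. norm (of_real (wt z ^ N) * (c n * stft \<phi> u (p n))))"
          by (rule summable_norm[OF sn])
        also have "\<dots> \<le> (\<Sum>n. (E1 + E2) * (1 / wt (p n - z) ^ M0))"
          by (rule suminf_le[OF le sn s])
        also have "\<dots> = (E1 + E2) * (\<Sum>n. 1 / wt (p n - z) ^ M0)"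
          by (rule suminf_mult[OF \<sigma>(2)])
        also have "\<dots> \<le> (E1 + E2) * \<sigma>"
          using E by (intro mult_left_mono \<sigma>) auto
        finally show ?thesis .
      qed
      then show ?thesis by blast
    qed
    then show False
      using z0 \<Gamma>' unfolding WF'_def rapid_decay_iff by blast
  qed
qed

end

lemma WF_G_subset_WF': "WF_G \<phi> \<Lambda> u \<subseteq> WF' \<phi> u"
proof
  fix z0 assume z0: "z0 \<in> WF_G \<phi> \<Lambda> u"
  show "z0 \<in> WF' \<phi> u"
  proof (rule ccontr)
    assume "z0 \<notin> WF' \<phi> u"
    moreover have "z0 \<noteq> 0"
      using z0 by (simp add: WF_G_def)
    ultimately obtain \<Gamma> where \<Gamma>: "open \<Gamma>" "conic_set \<Gamma>" "\<Gamma> \<subseteq> - {0}" "z0 \<in> \<Gamma>"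
      and dec: "\<forall>N::nat. \<exists>D. \<forall>z\<in>\<Gamma>. wt z ^ N * norm (stft \<phi> u z) \<le> D"
      unfolding WF'_def rapid_decay_iff by blast
    have "\<forall>N::nat. \<exists>D. \<forall>z\<in>\<Lambda> \<inter> \<Gamma>. wt z ^ N * norm (stft \<phi> u z) \<le> D"
      using dec by (meson IntD2)
    then show False
      using z0 \<Gamma> unfolding WF_G_def rapid_decay_iff by blast
  qed
qed

section \<open>Periodization and trigonometric approximation\<close>

definition int_vecs :: "(real ^ 'd::finite) set"
  where "int_vecs = {k. \<forall>i. k $ i \<in> \<int>}"

lemma int_vecs_zero [simp]: "0 \<in> int_vecs"
  and int_vecs_add: "k \<in> int_vecs \<Longrightarrow> l \<in> int_vecs \<Longrightarrow> k + l \<in> int_vecs"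
  and int_vecs_diff: "k \<in> int_vecs \<Longrightarrow> l \<in> int_vecs \<Longrightarrow> k - l \<in> int_vecs"
  and int_vecs_uminus: "k \<in> int_vecs \<Longrightarrow> - k \<in> int_vecs"
  by (auto simp: int_vecs_def)

lemma int_vecs_inner: "k \<in> int_vecs \<Longrightarrow> l \<in> int_vecs \<Longrightarrow> k \<bullet> l \<in> \<int>"
  unfolding inner_vec_def by (rule Ints_sum) (auto simp: int_vecs_def)

lemma int_vecs_norm_ge1:
  assumes "k \<in> int_vecs" "k \<noteq> 0"
  shows "1 \<le> norm k"
proof -
  obtain i where i: "k $ i \<noteq> 0"
    using assms(2) by (auto simp: vec_eq_iff)
  then have "1 \<le> \<bar>k $ i\<bar>"
    using assms(1) by (intro Ints_nonzero_abs_ge1) (auto simp: int_vecs_def)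
  then show ?thesis
    using component_le_norm_cart[of k i] by linarith
qed

lemma int_vecs_eq: "int_vecs = range (\<lambda>f :: 'd::finite \<Rightarrow> int. \<chi> i. of_int (f i))"
proof
  show "int_vecs \<subseteq> range (\<lambda>f :: 'd \<Rightarrow> int. \<chi> i. of_int (f i))"
  proof
    fix k :: "real ^ 'd" assume "k \<in> int_vecs"
    then have "k = (\<chi> i. of_int \<lfloor>k $ i\<rfloor>)"
      by (auto simp: int_vecs_def vec_eq_iff)
    then show "k \<in> range (\<lambda>f :: 'd \<Rightarrow> int. \<chi> i. of_int (f i))"
      by (intro image_eqI[where x="\<lambda>i. \<lfloor>k $ i\<rfloor>"]) auto
  qed
qed (auto simp: int_vecs_def)

lemma countable_int_vecs: "countable (int_vecs :: (real ^ 'd::finite) set)"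
  unfolding int_vecs_eq by (rule countable_image) simp

lemma infinite_int_vecs: "infinite (int_vecs :: (real ^ 'd::finite) set)"
proof
  assume "finite (int_vecs :: (real ^ 'd) set)"
  moreover have "range (\<lambda>n::nat. \<chi> i::'d. real n) \<subseteq> int_vecs"
    by (auto simp: int_vecs_def)
  ultimately have "finite (range (\<lambda>n::nat. \<chi> i::'d. real n))"
    by (rule rev_finite_subset)
  moreover have "inj (\<lambda>n::nat. \<chi> i::'d. real n)"
    by (auto simp: inj_def vec_eq_iff)
  ultimately show False
    using finite_imageD by blast
qed

definition enum_vec :: "nat \<Rightarrow> real ^ 'd::finite"
  where "enum_vec = from_nat_into int_vecs"

lemma bij_enum_vec: "bij_betw enum_vec UNIV int_vecs"
  unfolding enum_vec_def by (rule bij_betw_from_nat_into[OF countable_int_vecs infinite_int_vecs])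

lemma enum_vec_int [simp]: "enum_vec n \<in> int_vecs"
  using bij_enum_vec by (auto simp: bij_betw_def)

lemma enum_vec_inj: "enum_vec m = enum_vec n \<longleftrightarrow> m = n"
  using bij_enum_vec by (auto simp: bij_betw_def inj_def)

lemma enum_vec_surj: "k \<in> int_vecs \<Longrightarrow> \<exists>n. enum_vec n = k"
  using bij_betw_imp_surj_on[OF bij_enum_vec] by (metis imageE)

lemma enum_vec_separated: "m \<noteq> n \<Longrightarrow> 1 \<le> dist (enum_vec m) (enum_vec n)"
  unfolding dist_norm by (intro int_vecs_norm_ge1 int_vecs_diff) (auto simp: enum_vec_inj)

text \<open>The \<open>itself\<close> argument pins the dimension \<open>'d\<close>, which the
  number \<open>L\<close> alone would leave undetermined.\<close>

locale periodization =
  fixes L :: real and dim :: "'d::finite itself"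
  assumes L: "L > 0"
begin

definition pt :: "nat \<Rightarrow> real ^ 'd"
  where "pt n = L *\<^sub>R enum_vec n"

definition Q :: "(real ^ 'd) set"
  where "Q = {y. \<forall>i. 0 \<le> y $ i \<and> y $ i < L}"

definition d0 :: nat
  where "d0 = DIM(real ^ 'd) + 2"

text \<open>The volume of the period cell, which becomes the constant in Parseval's
  identity.\<close>

definition \<mu> :: real
  where "\<mu> = (\<integral>y. indicator Q y \<partial>lborel)"

definition periodize :: "(real ^ 'd \<Rightarrow> complex) \<Rightarrow> real ^ 'd \<Rightarrow> complex"
  where "periodize F y = (\<Sum>n. F (y + pt n))"

lemma Q_borel: "Q \<in> sets borel"
proof -
  have "Q = (\<Inter>i. {y. 0 \<le> y $ i} \<inter> {y. y $ i < L})"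
    by (auto simp: Q_def)
  also have "\<dots> \<in> sets borel"
    by (intro sets.countable_INT'' sets.Int borel_open borel_closed closed_Collect_le open_Collect_less continuous_intros) auto
  finally show ?thesis .
qed

lemma Q_norm: "y \<in> Q \<Longrightarrow> norm y \<le> real CARD('d) * L"
proof -
  assume y: "y \<in> Q"
  have "norm y \<le> (\<Sum>i\<in>UNIV. \<bar>y $ i\<bar>)"
    by (rule norm_le_l1_cart)
  also have "\<dots> \<le> (\<Sum>i\<in>(UNIV::'d set). L)"
    using y by (intro sum_mono) (auto simp: Q_def less_imp_le)
  finally show ?thesis by simp
qed

lemma Q_emeasure: "emeasure lborel Q < \<infinity>"
proof -
  have "Q \<subseteq> ball 0 (real CARD('d) * L + 1)"
    using Q_norm by force
  then have "emeasure lborel Q \<le> emeasure lborel (ball (0::real ^ 'd) (real CARD('d) * L + 1))"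
    by (intro emeasure_mono) auto
  then show ?thesis
    using emeasure_lborel_ball_finite le_less_trans by blast
qed

lemma Q_integrable: "integrable lborel (\<lambda>y. indicator Q y :: real)"
  using Q_borel Q_emeasure by (intro integrable_real_indicator) auto

lemma \<mu>_pos: "0 < \<mu>"
proof -
  let ?B = "ball (\<chi> i. L / 2 :: real ^ 'd) (L / 4)"
  have "?B \<subseteq> Q"
  proof
    fix y assume "y \<in> ?B"
    then have "norm ((\<chi> i. L / 2) - y) < L / 4"
      by (simp add: dist_norm)
    then have "\<bar>L / 2 - y $ i\<bar> < L / 4" for i
      using component_le_norm_cart[of "(\<chi> i. L / 2) - y" i] by simp
    then have "0 \<le> y $ i \<and> y $ i < L" for i
      using abs_less_iff[of "L / 2 - y $ i" "L / 4"] by fastforce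
    then show "y \<in> Q"
      by (simp add: Q_def)
  qed
  then have "measure lborel ?B \<le> measure lborel Q"
    using Q_borel Q_emeasure by (intro measure_mono_fmeasurable) (auto simp: fmeasurable_def)
  moreover have "0 < measure lborel ?B"
    using L by (intro content_ball_pos) auto
  ultimately have "0 < measure lborel Q"
    by (rule less_le_trans[rotated])
  then show ?thesis
    by (simp add: \<mu>_def)
qed

lemma Q_shift_unique:
  "\<exists>n. \<forall>m. (y - pt m \<in> Q) = (m = n)"
proof -
  define k :: "real ^ 'd" where "k = (\<chi> i. of_int \<lfloor>y $ i / L\<rfloor>)"
  have "k \<in> int_vecs"
    by (auto simp: k_def int_vecs_def)
  then obtain n where n: "enum_vec n = k"
    using enum_vec_surj by blast
  have iff: "(y - L *\<^sub>R l \<in> Q) = (l = k)" if l: "l \<in> int_vecs" for l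
  proof -
    have "(0 \<le> y $ i - L * l $ i \<and> y $ i - L * l $ i < L) = (l $ i = of_int \<lfloor>y $ i / L\<rfloor>)" for i
    proof -
      obtain j where j: "l $ i = of_int j"
        using l by (auto simp: int_vecs_def elim: Ints_cases)
      have "(0 \<le> y $ i - L * l $ i \<and> y $ i - L * l $ i < L) = (of_int j \<le> y $ i / L \<and> y $ i / L < of_int j + 1)"
        using L by (auto simp: j field_simps)
      also have "\<dots> = (\<lfloor>y $ i / L\<rfloor> = j)"
        by (simp add: floor_eq_iff)
      finally show ?thesis
        by (auto simp: j)
    qed
    then show ?thesis
      by (auto simp: Q_def k_def vec_eq_iff)
  qed
  have "(y - pt m \<in> Q) = (m = n)" for m
    unfolding pt_def iff[OF enum_vec_int] n[symmetric] enum_vec_inj ..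
  then show ?thesis by blast
qed

lemma Q_shift_unique':
  "\<exists>n. \<forall>m. (y + pt m \<in> Q) = (m = n)"
proof -
  obtain n where n: "\<And>m. (y - pt m \<in> Q) = (m = n)"
    using Q_shift_unique by blast
  have neg: "\<exists>m. enum_vec m = - (enum_vec k :: real ^ 'd)" for k
    by (intro enum_vec_surj int_vecs_uminus enum_vec_int)
  obtain n' where n': "enum_vec n' = - (enum_vec n :: real ^ 'd)"
    using neg by blast
  have "(y + pt m \<in> Q) = (m = n')" for m
  proof -
    obtain m' where m': "enum_vec m' = - (enum_vec m :: real ^ 'd)"
      using neg by blast
    then have "y + pt m = y - pt m'"
      by (simp add: pt_def)
    then have "(y + pt m \<in> Q) = (m' = n)"
      using n by simp
    also have "\<dots> = (enum_vec m' = (enum_vec n :: real ^ 'd))"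
      by (simp add: enum_vec_inj)
    also have "\<dots> = (enum_vec m = (enum_vec n' :: real ^ 'd))"
      unfolding m' n' by (metis minus_minus)
    finally show ?thesis
      by (simp add: enum_vec_inj)
  qed
  then show ?thesis by blast
qed

lemma pt_sum:
  obtains \<sigma> where "0 \<le> \<sigma>" "\<And>z. summable (\<lambda>n. 1 / wt (pt n - z) ^ d0)" "\<And>z. (\<Sum>n. 1 / wt (pt n - z) ^ d0) \<le> \<sigma>"
proof (rule separated_sum_bound[of L pt])
  fix m n :: nat assume "m \<noteq> n"
  then have "1 \<le> dist (enum_vec m :: real ^ 'd) (enum_vec n)"
    by (rule enum_vec_separated)
  then have "L * 1 \<le> L * dist (enum_vec m :: real ^ 'd) (enum_vec n)"
    using L by (intro mult_left_mono) auto
  then show "L \<le> dist (pt m) (pt n)"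
    using L by (simp add: pt_def dist_norm flip: scaleR_diff_right)
qed (use L in \<open>auto intro!: that simp: d0_def\<close>)

lemma summable_pt: "summable (\<lambda>n. 1 / wt (pt n) ^ d0)"
proof -
  obtain \<sigma> where "\<And>z. summable (\<lambda>n. 1 / wt (pt n - z) ^ d0)"
    by (rule pt_sum) metis
  from this[of 0] show ?thesis by simp
qed

definition cQ :: real
  where "cQ = (1 + real CARD('d) * L) ^ d0"

lemma Q_wt:
  assumes "y - pt n \<in> Q"
  shows "1 / wt y ^ d0 \<le> cQ * (1 / wt (pt n) ^ d0)"
proof -
  have "wt (pt n) \<le> wt (pt n - y) * wt y"
    by (rule wt_le_mult_diff)
  also have "\<dots> \<le> (1 + real CARD('d) * L) * wt y"
    using Q_norm[OF assms] by (intro mult_right_mono) (auto simp: wt_def norm_minus_commute)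
  finally have "wt (pt n) ^ d0 \<le> cQ * wt y ^ d0"
    unfolding cQ_def power_mult_distrib[symmetric] by (intro power_mono) auto
  then show ?thesis
    by (simp add: divide_simps)
qed

lemma cQ: "0 \<le> cQ"
  using L by (simp add: cQ_def)

text \<open>Cut the integral along the translated cells, move each piece to \<open>Q\<close> by
  translation invariance, and sum again. Half of the exponent \<open>2 * d0\<close> makes the series
  over the cells converge, the other half the integral over y.\<close>

lemma unfold_integral:
  assumes G: "G \<in> borel_measurable borel" and le: "\<And>y. norm (G y :: complex) \<le> C / wt y ^ (2 * d0)"
  shows "(\<integral>y. G y \<partial>lborel) = (\<integral>y. of_real (indicator Q y) * periodize G y \<partial>lborel)"
    and "integrable lborel (\<lambda>y. of_real (indicator Q y) * periodize G y)"
proof -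
  define I where "I y = complex_of_real (indicator Q y)" for y
  have I: "I \<in> borel_measurable borel"
    unfolding I_def using Q_borel by measurable
  have C: "0 \<le> C"
    using le[of 0] by (simp add: wt_def) (metis norm_ge_zero order_trans)
  define \<kappa> where "\<kappa> n = C * (cQ * (1 / wt (pt n) ^ d0))" for n
  have \<kappa>: "summable \<kappa>"
    unfolding \<kappa>_def by (intro summable_mult summable_pt)
  define g where "g n y = I (y - pt n) * G y" for n y
  define g' where "g' n y = I y * G (y + pt n)" for n y
  have gb: "g n \<in> borel_measurable borel" for n
    unfolding g_def using I G by measurable
  have g'b: "g' n \<in> borel_measurable borel" for n
    unfolding g'_def using I G by measurable
  have iwt: "integrable lborel (\<lambda>y::real ^ 'd. 1 / wt y ^ d0)"
    unfolding d0_def by (rule integrable_wt)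
  have gle: "norm (g n y) \<le> \<kappa> n * (1 / wt y ^ d0)" for n y
  proof (cases "y - pt n \<in> Q")
    case True
    have "norm (g n y) \<le> C / wt y ^ (2 * d0)"
      using True le by (simp add: g_def I_def)
    also have "\<dots> = C * (1 / wt y ^ d0) * (1 / wt y ^ d0)"
      by (simp add: mult_2 power_add)
    also have "\<dots> \<le> C * (cQ * (1 / wt (pt n) ^ d0)) * (1 / wt y ^ d0)"
      by (intro mult_right_mono mult_left_mono Q_wt True C) auto
    finally show ?thesis by (simp add: \<kappa>_def)
  next
    case False
    then show ?thesis
      using C cQ by (simp add: g_def I_def \<kappa>_def)
  qed
  have gsum: "(\<Sum>n. g n y) = G y" for y
  proof -
    obtain n where n: "\<And>m. (y - pt m \<in> Q) = (m = n)"
      using Q_shift_unique by blast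
    have "(\<Sum>m. g m y) = (\<Sum>m\<in>{n}. g m y)"
      by (rule suminf_finite) (auto simp: g_def I_def n)
    then show ?thesis
      using n[of n] by (simp add: g_def I_def)
  qed
  have 1: "(\<lambda>n. \<integral>y. g n y \<partial>lborel) sums (\<integral>y. G y \<partial>lborel)"
    using integral_suminf_dominated(2)[OF gb gle \<kappa> iwt] by (simp add: gsum)
  have eq: "(\<integral>y. g' n y \<partial>lborel) = (\<integral>y. g n y \<partial>lborel)" for n
    using lborel_shift(1)[OF gb[of n], of "pt n"] by (simp add: g_def g'_def add.commute)
  have g'le: "norm (g' n y) \<le> \<kappa> n * indicator Q y" for n y
  proof (cases "y \<in> Q")
    case True
    have "norm (g' n y) \<le> C / wt (y + pt n) ^ (2 * d0)"
      using True le by (simp add: g'_def I_def)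
    also have "\<dots> = C * (1 / wt (y + pt n) ^ d0) * (1 / wt (y + pt n) ^ d0)"
      by (simp add: mult_2 power_add)
    also have "\<dots> \<le> C * (1 / wt (y + pt n) ^ d0) * 1"
      using C by (intro mult_left_mono) (auto simp: divide_le_eq)
    also have "\<dots> \<le> C * (cQ * (1 / wt (pt n) ^ d0)) * 1"
      using True by (intro mult_right_mono mult_left_mono Q_wt C) auto
    finally show ?thesis using True by (simp add: \<kappa>_def)
  qed (simp add: g'_def I_def)
  have pe: "(\<Sum>n. g' n y) = I y * periodize G y" for y
  proof (cases "y \<in> Q")
    case True
    then have "g' n y = G (y + pt n)" for n
      by (simp add: g'_def I_def)
    then show ?thesis
      using True by (simp add: periodize_def I_def)
  qed (simp add: g'_def I_def)
  note 2 = integral_suminf_dominated[OF g'b g'le \<kappa> Q_integrable]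
  show "integrable lborel (\<lambda>y. of_real (indicator Q y) * periodize G y)"
    using 2(1) by (simp add: pe I_def)
  show "(\<integral>y. G y \<partial>lborel) = (\<integral>y. of_real (indicator Q y) * periodize G y \<partial>lborel)"
    using 1 2(2) sums_unique2 by (simp add: pe I_def eq)
qed

section \<open>Characters of the period lattice and trigonometric polynomials\<close>

definition ch :: "real ^ 'd \<Rightarrow> real ^ 'd \<Rightarrow> complex"
  where "ch l y = exp (\<i> * complex_of_real (y \<bullet> ((2 * pi / L) *\<^sub>R l)))"

lemma norm_ch [simp]: "norm (ch l y) = 1"
  by (simp add: ch_def)

lemma ch_add: "ch l (x + y) = ch l x * ch l y"
  by (simp only: ch_def inner_add_left of_real_add distrib_left exp_add)

lemma ch_mult: "ch k y * ch l y = ch (k + l) y"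
  by (simp only: ch_def scaleR_right_distrib inner_add_right of_real_add distrib_left exp_add)

lemma cnj_ch: "cnj (ch l y) = ch (- l) y"
  by (simp add: ch_def exp_cnj)

lemma ch_zero [simp]: "ch 0 y = 1"
  by (simp add: ch_def)

lemma ch_period:
  assumes "k \<in> int_vecs" "l \<in> int_vecs"
  shows "ch l (y + L *\<^sub>R k) = ch l y"
proof -
  obtain j where j: "k \<bullet> l = of_int j"
    using int_vecs_inner[OF assms] by (auto elim: Ints_cases)
  have "ch l (L *\<^sub>R k) = exp (2 * of_int j * pi * \<i>)"
    using L by (simp add: ch_def j algebra_simps)
  then show ?thesis
    using exp_integer_2pi[of "of_int j"] by (simp add: ch_add)
qed

lemma ch_continuous: "continuous_on S (ch l)"
  unfolding ch_def by (intro continuous_intros)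

lemma ch_borel [measurable]: "ch l \<in> borel_measurable borel"
  by (intro borel_measurable_continuous_onI ch_continuous)

text \<open>A shift by \<open>a\<close> multiplies the character by -1. The cell itself is not
  invariant under this shift, but the character cut off to the shifted cell has the same
  periodization, so unfolding shows that the integral equals its own negative.\<close>

lemma ch_orthogonal:
  assumes l: "l \<in> int_vecs" "l \<noteq> 0"
  shows "(\<integral>y. of_real (indicator Q y) * ch l y \<partial>lborel) = 0"
proof -
  obtain j where j: "l $ j \<noteq> 0"
    using l(2) by (auto simp: vec_eq_iff)
  \<comment> \<open>Half a period of \<open>ch l\<close> along a coordinate in which l is nonzero:
    its inner product with the frequency is pi.\<close>
  define a :: "real ^ 'd" where "a = (L / (2 * l $ j)) *\<^sub>R axis j 1"
  have ca: "ch l a = -1"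
    using j L by (simp add: ch_def a_def inner_axis' exp_pi_i mult.commute)
  define G where "G y = complex_of_real (indicator Q (y - a)) * ch l y" for y
  have Gb: "G \<in> borel_measurable borel"
    unfolding G_def using Q_borel by measurable
  define R where "R = (real CARD('d) * L + norm a + 1)"
  have Gle: "norm (G y) \<le> R ^ (2 * d0) / wt y ^ (2 * d0)" for y
  proof (cases "y - a \<in> Q")
    case True
    have "norm y \<le> norm (y - a) + norm a"
      using norm_triangle_sub[of y a] by (simp add: add.commute)
    then have "wt y \<le> R"
      using Q_norm[OF True] by (simp add: wt_def R_def)
    then have "wt y ^ (2 * d0) \<le> R ^ (2 * d0)"
      by (intro power_mono) auto
    then show ?thesis
      using True by (simp add: G_def norm_mult)
  next
    case False
    then show ?thesis
      using L by (simp add: G_def R_def)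
  qed
  have per: "periodize G y = ch l y" for y
  proof -
    obtain n where n: "\<And>m. (y - a + pt m \<in> Q) = (m = n)"
      using Q_shift_unique' by blast
    have G: "G (y + pt m) = (if m = n then ch l y else 0)" for m
    proof -
      have 1: "y + pt m - a = y - a + pt m" and 2: "ch l (y + pt m) = ch l y"
        using ch_period[OF enum_vec_int l(1), of y m] by (simp_all add: pt_def)
      show ?thesis
        unfolding G_def 1 2 indicator_def n by simp
    qed
    have "periodize G y = (\<Sum>m\<in>{n}. G (y + pt m))"
      unfolding periodize_def by (rule suminf_finite) (auto simp: G)
    then show ?thesis
      by (simp add: G)
  qed
  have "(\<integral>y. G y \<partial>lborel) = (\<integral>y. of_real (indicator Q y) * ch l y \<partial>lborel)"
    using unfold_integral(1)[OF Gb Gle] by (simp add: per)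
  moreover have "(\<integral>y. G y \<partial>lborel) = - (\<integral>y. of_real (indicator Q y) * ch l y \<partial>lborel)"
    using lborel_shift(1)[OF Gb, of a] by (simp add: G_def ch_add ca)
  ultimately show ?thesis by simp
qed

text \<open>Trigonometric polynomials, generated inductively so that closure under products and
  conjugation is rule induction; \<open>trig_sum\<close> recovers the finite sum with
  coefficients.\<close>

inductive trig :: "(real ^ 'd \<Rightarrow> complex) \<Rightarrow> bool" where
  ch: "l \<in> int_vecs \<Longrightarrow> trig (\<lambda>y. a * ch l y)"
| add: "trig f \<Longrightarrow> trig g \<Longrightarrow> trig (\<lambda>y. f y + g y)"

lemma trig_const: "trig (\<lambda>y. a)"
  using trig.ch[of 0 a] by simp

lemma trig_cnj: "trig f \<Longrightarrow> trig (\<lambda>y. cnj (f y))"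
proof (induction rule: trig.induct)
  case (ch l a)
  then show ?case
    using trig.ch[OF int_vecs_uminus, of l "cnj a"] by (simp add: cnj_ch)
qed (simp add: trig.add)

lemma trig_mult_ch: "trig g \<Longrightarrow> l \<in> int_vecs \<Longrightarrow> trig (\<lambda>y. a * ch l y * g y)"
proof (induction rule: trig.induct)
  case (ch k b)
  have "(\<lambda>y. a * ch l y * (b * ch k y)) = (\<lambda>y. (a * b) * ch (l + k) y)"
    by (simp add: ch_mult[symmetric] mult_ac)
  then show ?case
    using trig.ch[OF int_vecs_add[OF ch.prems ch.hyps]] by simp
next
  case (add f g)
  then show ?case
    using trig.add[OF add.IH(1)[OF add.prems] add.IH(2)[OF add.prems]] by (simp add: distrib_left)
qed

lemma trig_mult: "trig f \<Longrightarrow> trig g \<Longrightarrow> trig (\<lambda>y. f y * g y)"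
proof (induction rule: trig.induct)
  case (ch l a)
  then show ?case by (simp add: trig_mult_ch)
next
  case (add f h)
  then show ?case
    using trig.add[OF add.IH(1)[OF add.prems] add.IH(2)[OF add.prems]] by (simp add: distrib_right)
qed

lemma trig_sum:
  assumes "trig f"
  shows "\<exists>S a. finite S \<and> S \<subseteq> int_vecs \<and> f = (\<lambda>y. \<Sum>l\<in>S. a l * ch l y)"
  using assms
proof (induction rule: trig.induct)
  case (ch l a)
  then show ?case
    by (intro exI[of _ "{l}"] exI[of _ "\<lambda>_. a"]) auto
next
  case (add f g)
  obtain S a where S: "finite S" "S \<subseteq> int_vecs" "f = (\<lambda>y. \<Sum>l\<in>S. a l * ch l y)"
    using add.IH by blast
  obtain T b where T: "finite T" "T \<subseteq> int_vecs" "g = (\<lambda>y. \<Sum>l\<in>T. b l * ch l y)"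
    using add.IH by blast
  define c where "c l = (if l \<in> S then a l else 0) + (if l \<in> T then b l else 0)" for l
  have "f y + g y = (\<Sum>l\<in>S \<union> T. c l * ch l y)" for y
  proof -
    have "(\<Sum>l\<in>S \<union> T. c l * ch l y) = (\<Sum>l\<in>S \<union> T. (if l \<in> S then a l * ch l y else 0)) + (\<Sum>l\<in>S \<union> T. (if l \<in> T then b l * ch l y else 0))"
      unfolding sum.distrib[symmetric] by (intro sum.cong) (auto simp: c_def distrib_right)
    also have "(\<Sum>l\<in>S \<union> T. (if l \<in> S then a l * ch l y else 0)) = f y"
      unfolding S(3) by (intro sum.mono_neutral_cong_right) (use S T in auto)
    also have "(\<Sum>l\<in>S \<union> T. (if l \<in> T then b l * ch l y else 0)) = g y"
      unfolding T(3) by (intro sum.mono_neutral_cong_right) (use S T in auto)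
    finally show ?thesis ..
  qed
  then show ?case
    using S T by (intro exI[of _ "S \<union> T"] exI[of _ c]) auto
qed

section \<open>Density of trigonometric polynomials via the compact torus\<close>

definition torus :: "real ^ 'd \<Rightarrow> complex ^ 'd"
  where "torus y = (\<chi> i. ch (axis i 1) y)"

lemma axis_int_vecs: "axis i 1 \<in> int_vecs"
  by (auto simp: int_vecs_def axis_def)

lemma torus_eq:
  assumes "torus x = torus y"
  shows "\<exists>k\<in>int_vecs. x = y + L *\<^sub>R k"
proof -
  have "\<exists>j::int. x $ i = y $ i + L * of_int j" for i
  proof -
    have "ch (axis i 1) x = ch (axis i 1) y"
      using assms by (simp add: torus_def vec_eq_iff)
    then obtain j where "\<i> * complex_of_real (x \<bullet> ((2 * pi / L) *\<^sub>R axis i 1)) =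
        \<i> * complex_of_real (y \<bullet> ((2 * pi / L) *\<^sub>R axis i 1)) + of_int (2 * j) * pi * \<i>"
      unfolding ch_def exp_eq by auto
    then have "\<i> * complex_of_real (2 * pi / L * x $ i) = \<i> * complex_of_real (2 * pi / L * y $ i + of_int (2 * j) * pi)"
      by (simp add: inner_axis algebra_simps)
    then have "2 * pi / L * x $ i = 2 * pi / L * y $ i + of_int (2 * j) * pi"
      by (metis mult_cancel_left complex_i_not_zero of_real_eq_iff)
    then have "2 * pi * x $ i = 2 * pi * (y $ i + L * of_int j)"
      using L by (simp add: field_simps)
    then have "x $ i = y $ i + L * of_int j"
      using pi_neq_zero by (simp only: mult_cancel_left) simp
    then show ?thesis by blast
  qed
  then obtain j where j: "\<And>i. x $ i = y $ i + L * of_int (j i)"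
    by metis
  have "x = y + L *\<^sub>R (\<chi> i. of_int (j i))" "(\<chi> i. of_int (j i)) \<in> int_vecs"
    by (auto simp: j vec_eq_iff int_vecs_def)
  then show ?thesis by blast
qed

lemma torus_periodic: "k \<in> int_vecs \<Longrightarrow> torus (y + L *\<^sub>R k) = torus y"
  by (simp add: torus_def ch_period axis_int_vecs)

lemma torus_continuous: "continuous_on S torus"
  unfolding torus_def by (intro continuous_intros ch_continuous)

lemma torus_cube: "torus ` cbox 0 (\<chi> i. L) = range torus"
proof
  show "range torus \<subseteq> torus ` cbox 0 (\<chi> i. L)"
  proof
    fix w assume "w \<in> range torus"
    then obtain y where y: "w = torus y" by blast
    obtain n where "y + pt n \<in> Q"
      using Q_shift_unique' by blast
    then have "y + pt n \<in> cbox 0 (\<chi> i. L)"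
      by (auto simp: Q_def mem_box_cart less_imp_le)
    moreover have "w = torus (y + pt n)"
      unfolding y pt_def by (rule torus_periodic[symmetric]) simp
    ultimately show "w \<in> torus ` cbox 0 (\<chi> i. L)"
      by blast
  qed
qed auto

text \<open>The fibres of \<open>torus\<close> are the cosets of the period lattice, so P factors
  through its compact range. Stone-Weierstrass applies there to the real functions whose pullback is
  a trigonometric polynomial; real and imaginary parts of the coordinates separate points.\<close>

lemma trig_dense_real:
  fixes P :: "real ^ 'd \<Rightarrow> real"
  assumes P: "continuous_on UNIV P" and per: "\<And>k y. k \<in> int_vecs \<Longrightarrow> P (y + L *\<^sub>R k) = P y"
    and \<eta>: "\<eta> > 0"
  shows "\<exists>q. trig q \<and> (\<forall>y. norm (q y - of_real (P y)) < \<eta>)"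
proof -
  let ?K = "range torus" and ?C = "cbox 0 (\<chi> i. L) :: (real ^ 'd) set"
  define h where "h w = P (SOME y. torus y = w)" for w
  have h: "h (torus y) = P y" for y
  proof -
    have "torus (SOME x. torus x = torus y) = torus y"
      by (rule someI[of "\<lambda>x. torus x = torus y"]) simp
    then obtain k where "k \<in> int_vecs" "(SOME x. torus x = torus y) = y + L *\<^sub>R k"
      using torus_eq by blast
    then show ?thesis
      by (simp add: h_def per)
  qed
  have comp: "compact ?K"
    unfolding torus_cube[symmetric] by (intro compact_continuous_image torus_continuous compact_cbox)
  \<comment> \<open>Continuity descends to the range because \<open>torus\<close>, restricted to the
    compact cube, is a quotient map.\<close>
  have ch: "continuous_on ?K h"
    unfolding continuous_openin_preimage_eq
  proof (intro allI impI)
    fix T :: "real set" assume T: "open T"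
    have "?C \<inter> torus -` (?K \<inter> h -` T) = ?C \<inter> P -` T"
      by (rule set_eqI) (simp add: h)
    moreover have "openin (top_of_set ?C) (?C \<inter> P -` T)"
      by (rule continuous_openin_preimage_gen[OF continuous_on_subset[OF P] T]) auto
    ultimately have "openin (top_of_set ?C) (?C \<inter> torus -` (?K \<inter> h -` T))"
      by simp
    then show "openin (top_of_set ?K) (?K \<inter> h -` T)"
      using Abstract_Topology_2.continuous_imp_quotient_map[OF torus_continuous torus_cube compact_cbox, of "?K \<inter> h -` T"] by simp
  qed
  define R where "R g \<longleftrightarrow> continuous_on ?K g \<and> trig (\<lambda>y. of_real (g (torus y)))" for g :: "complex ^ 'd \<Rightarrow> real"
  have "\<exists>g. R g \<and> (\<forall>x\<in>?K. \<bar>h x - g x\<bar> < \<eta>)"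
  proof (rule Stone_Weierstrass_HOL[OF comp _ _ _ _ _ ch \<eta>])
    show "R (\<lambda>x. c)" for c
      by (simp add: R_def trig_const)
    show "R f \<Longrightarrow> continuous_on ?K f" for f
      by (simp add: R_def)
    show "R f \<and> R g \<Longrightarrow> R (\<lambda>x. f x + g x)" for f g
      by (auto simp: R_def intro: continuous_on_add trig.add)
    show "R f \<and> R g \<Longrightarrow> R (\<lambda>x. f x * g x)" for f g
      by (auto simp: R_def intro: continuous_on_mult trig_mult)
    fix x y assume "x \<in> ?K \<and> y \<in> ?K \<and> x \<noteq> y"
    then obtain i where i: "x $ i \<noteq> y $ i"
      by (auto simp: vec_eq_iff)
    have t: "trig (\<lambda>y. ch (axis i 1) y)"
      using trig.ch[OF axis_int_vecs, of 1] by simp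
    have re: "complex_of_real (Re z) = (1 / 2) * z + (1 / 2) * cnj z"
      and im: "complex_of_real (Im z) = (- \<i> / 2) * z + (\<i> / 2) * cnj z" for z
      by (auto simp: complex_eq_iff)
    have "R (\<lambda>w. Re (w $ i))" "R (\<lambda>w. Im (w $ i))"
      unfolding R_def torus_def vec_lambda_beta re im
      by (intro conjI trig.add trig_mult trig_const trig_cnj t continuous_intros)+
    moreover have "Re (x $ i) \<noteq> Re (y $ i) \<or> Im (x $ i) \<noteq> Im (y $ i)"
      using i by (simp add: complex_eq_iff)
    ultimately show "\<exists>f. R f \<and> f x \<noteq> f y"
      by blast
  qed
  then obtain g where g: "R g" "\<And>y. \<bar>P y - g (torus y)\<bar> < \<eta>"
    using h by fastforce
  have "norm (complex_of_real (g (torus y)) - of_real (P y)) < \<eta>" for y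
    using g(2)[of y] by (simp add: abs_minus_commute flip: of_real_diff)
  then show ?thesis
    using g(1) unfolding R_def by blast
qed

lemma trig_dense:
  fixes P :: "real ^ 'd \<Rightarrow> complex"
  assumes P: "continuous_on UNIV P" and per: "\<And>k y. k \<in> int_vecs \<Longrightarrow> P (y + L *\<^sub>R k) = P y"
    and \<eta>: "\<eta> > 0"
  shows "\<exists>q. trig q \<and> (\<forall>y. norm (q y - P y) < \<eta>)"
proof -
  obtain q where q: "trig q" "\<And>y. norm (q y - of_real (Re (P y))) < \<eta> / 2"
    using trig_dense_real[of "\<lambda>y. Re (P y)" "\<eta> / 2"] P per \<eta> by (auto intro: continuous_intros)
  obtain r where r: "trig r" "\<And>y. norm (r y - of_real (Im (P y))) < \<eta> / 2"
    using trig_dense_real[of "\<lambda>y. Im (P y)" "\<eta> / 2"] P per \<eta> by (auto intro: continuous_intros)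
  have "norm (q y + \<i> * r y - P y) < \<eta>" for y
  proof -
    have "q y + \<i> * r y - P y = (q y - of_real (Re (P y))) + \<i> * (r y - of_real (Im (P y)))"
      by (simp add: complex_eq_iff)
    also have "norm \<dots> \<le> norm (q y - of_real (Re (P y))) + norm (r y - of_real (Im (P y)))"
      by (rule order_trans[OF norm_triangle_ineq]) (simp add: norm_mult)
    finally show ?thesis
      using q(2)[of y] r(2)[of y] by linarith
  qed
  moreover have "trig (\<lambda>y. q y + \<i> * r y)"
    by (intro trig.add trig_mult trig_const q r)
  ultimately show ?thesis by blast
qed

section \<open>Convergence, continuity and periodicity of periodizations\<close>

lemma periodize_terms:
  assumes le: "\<And>y. norm (F y :: complex) \<le> C / wt y ^ (2 * d0)" and C: "0 \<le> C"
  shows "norm (F (y + pt n)) \<le> C * (1 / wt (pt n - (- y)) ^ d0)"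
proof -
  have "norm (F (y + pt n)) \<le> C * (1 / wt (y + pt n) ^ d0) * (1 / wt (y + pt n) ^ d0)"
    using le[of "y + pt n"] by (simp add: mult_2 power_add)
  also have "\<dots> \<le> C * (1 / wt (y + pt n) ^ d0) * 1"
    using C by (intro mult_left_mono) (auto simp: divide_le_eq)
  finally show ?thesis
    by (simp add: add.commute)
qed

lemma periodize_summable:
  assumes le: "\<And>y. norm (F y :: complex) \<le> C / wt y ^ (2 * d0)" and C: "0 \<le> C"
  shows "summable (\<lambda>n. norm (F (y + pt n)))"
proof -
  obtain \<sigma> where \<sigma>: "\<And>z. summable (\<lambda>n. 1 / wt (pt n - z) ^ d0)"
    by (rule pt_sum) metis
  show ?thesis
    by (rule summable_comparison_test'[OF summable_mult[OF \<sigma>[of "- y"], of C]])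
      (use periodize_terms[OF le C] in simp)
qed

lemma periodize_bounded:
  assumes le: "\<And>y. norm (F y :: complex) \<le> C / wt y ^ (2 * d0)" and C: "0 \<le> C"
  obtains W where "\<And>y. norm (periodize F y) \<le> W"
proof -
  obtain \<sigma> where \<sigma>: "\<And>z. summable (\<lambda>n. 1 / wt (pt n - z) ^ d0)" "\<And>z. (\<Sum>n. 1 / wt (pt n - z) ^ d0) \<le> \<sigma>"
    by (rule pt_sum) metis
  have "norm (periodize F y) \<le> C * \<sigma>" for y
  proof -
    have "norm (periodize F y) \<le> (\<Sum>n. norm (F (y + pt n)))"
      unfolding periodize_def by (rule summable_norm[OF periodize_summable[OF le C]])
    also have "\<dots> \<le> (\<Sum>n. C * (1 / wt (pt n - (- y)) ^ d0))"
      by (rule suminf_le[OF periodize_terms[OF le C] periodize_summable[OF le C] summable_mult[OF \<sigma>(1)]])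
    also have "\<dots> = C * (\<Sum>n. 1 / wt (pt n - (- y)) ^ d0)"
      by (rule suminf_mult[OF \<sigma>(1)])
    also have "\<dots> \<le> C * \<sigma>"
      by (intro mult_left_mono \<sigma> C)
    finally show ?thesis .
  qed
  then show thesis
    using that by blast
qed

lemma periodize_continuous:
  assumes F: "continuous_on UNIV F"
    and le: "\<And>y. norm (F y :: complex) \<le> C / wt y ^ (2 * d0)" and C: "0 \<le> C"
  shows "continuous_on UNIV (periodize F)"
proof -
  have "continuous_on (ball 0 R) (periodize F)" for R
  proof -
    define \<kappa> where "\<kappa> n = C * (1 + \<bar>R\<bar>) ^ d0 * (1 / wt (pt n) ^ d0)" for n
    have "uniform_limit (ball 0 R) (\<lambda>n y. \<Sum>i<n. F (y + pt i)) (\<lambda>y. \<Sum>i. F (y + pt i)) sequentially"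
    proof (rule Weierstrass_m_test)
      fix n and y :: "real ^ 'd" assume y: "y \<in> ball 0 R"
      have "wt (pt n) \<le> wt (- y) * wt (pt n - (- y))"
        using wt_le_mult_diff[of "pt n" "- y"] by (simp add: mult.commute)
      also have "\<dots> \<le> (1 + \<bar>R\<bar>) * wt (pt n - (- y))"
        using y by (intro mult_right_mono) (auto simp: wt_def)
      finally have "wt (pt n) ^ d0 \<le> (1 + \<bar>R\<bar>) ^ d0 * wt (pt n - (- y)) ^ d0"
        by (metis power_mono power_mult_distrib wt_nonneg)
      then have "1 / wt (pt n - (- y)) ^ d0 \<le> (1 + \<bar>R\<bar>) ^ d0 * (1 / wt (pt n) ^ d0)"
        by (simp add: divide_simps)
      then have "C * (1 / wt (pt n - (- y)) ^ d0) \<le> C * ((1 + \<bar>R\<bar>) ^ d0 * (1 / wt (pt n) ^ d0))"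
        by (rule mult_left_mono[OF _ C])
      then show "norm (F (y + pt n)) \<le> \<kappa> n"
        using periodize_terms[OF le C, of y n] by (simp only: \<kappa>_def mult.assoc)
    next
      show "summable \<kappa>"
        unfolding \<kappa>_def by (intro summable_mult summable_pt)
    qed
    then have "uniform_limit (ball 0 R) (\<lambda>n y. \<Sum>i<n. F (y + pt i)) (periodize F) sequentially"
      by (simp add: periodize_def[abs_def])
    then show ?thesis
      by (rule uniform_limit_theorem[rotated])
        (auto intro!: always_eventually continuous_intros continuous_on_compose2[OF F])
  qed
  then have "isCont (periodize F) y" for y
    using continuous_on_eq_continuous_at[OF open_ball] by (metis centre_in_ball dist_0_norm less_add_one mem_ball)
  then show ?thesis
    by (simp add: continuous_at_imp_continuous_on)
qed

text \<open>A shift by a period permutes the lattice points. Absolute convergence allows the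
  rearrangement, carried out with \<open>infsum\<close> because \<open>suminf\<close> is tied to one
  order of summation.\<close>

lemma periodize_periodic:
  assumes le: "\<And>y. norm (F y :: complex) \<le> C / wt y ^ (2 * d0)" and C: "0 \<le> C" and k: "k \<in> int_vecs"
  shows "periodize F (y + L *\<^sub>R k) = periodize F y"
proof -
  define \<pi> where "\<pi> n = inv enum_vec (enum_vec n + k)" for n
  have \<pi>: "enum_vec (\<pi> n) = enum_vec n + k" for n
    unfolding \<pi>_def using enum_vec_surj[OF int_vecs_add[OF enum_vec_int k]]
    by (intro f_inv_into_f) (metis rangeI)
  have bij: "bij_betw \<pi> UNIV UNIV"
  proof (rule bij_betwI')
    show "\<pi> m = \<pi> n \<longleftrightarrow> m = n" for m n
      using \<pi>[of m] \<pi>[of n] by (metis add_right_cancel enum_vec_inj)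
    show "\<exists>m\<in>UNIV. n = \<pi> m" for n
    proof -
      obtain m where "enum_vec m = (enum_vec n - k :: real ^ 'd)"
        using enum_vec_surj[OF int_vecs_diff[OF enum_vec_int k]] by blast
      then have "enum_vec (\<pi> m) = (enum_vec n :: real ^ 'd)"
        by (simp add: \<pi>)
      then show ?thesis
        unfolding enum_vec_inj by blast
    qed
  qed simp
  have inf: "periodize F y = infsum (\<lambda>n. F (y + pt n)) UNIV" for y
    unfolding periodize_def
    by (rule infsumI[symmetric]) (rule norm_summable_imp_has_sum[OF periodize_summable[OF le C]
      summable_sums[OF summable_norm_cancel[OF periodize_summable[OF le C]]]])
  have "y + L *\<^sub>R k + pt n = y + pt (\<pi> n)" for n
    by (simp add: pt_def \<pi> scaleR_add_right)
  then have "periodize F (y + L *\<^sub>R k) = infsum (\<lambda>n. F (y + pt (\<pi> n))) UNIV"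
    unfolding inf by (simp only:)
  also have "\<dots> = infsum (\<lambda>n. F (y + pt n)) UNIV"
    by (rule infsum_reindex_bij_betw[OF bij])
  finally show ?thesis
    by (simp add: inf)
qed

section \<open>One inequality of Parseval's identity for periodizations\<close>

lemma Q_mult_integrable:
  assumes "h \<in> borel_measurable borel" "\<And>y. norm (h y :: complex) \<le> W"
  shows "integrable lborel (\<lambda>y. of_real (indicator Q y) * h y)"
proof (rule Bochner_Integration.integrable_bound)
  show "integrable lborel (\<lambda>y. W * indicator Q y)"
    by (intro integrable_mult_right Q_integrable)
  show "(\<lambda>y. of_real (indicator Q y) * h y) \<in> borel_measurable lborel"
    using assms(1) Q_borel by measurable
  show "AE y in lborel. norm (of_real (indicator Q y) * h y) \<le> norm (W * indicator Q y)"
    using order_trans[OF assms(2) abs_ge_self] by (intro AE_I2) (auto simp: indicator_def)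
qed

lemma trig_norm_integral:
  assumes S: "finite S" "S \<subseteq> int_vecs" and q: "\<And>y. q y = (\<Sum>l\<in>S. a l * ch l y)"
  shows "(\<integral>y. of_real (indicator Q y) * (q y * cnj (q y)) \<partial>lborel) = of_real (\<mu> * (\<Sum>l\<in>S. (norm (a l))\<^sup>2))"
proof -
  have chQ: "integrable lborel (\<lambda>y. of_real (indicator Q y) * ch l y)" for l
    by (rule Q_mult_integrable[OF ch_borel, where W=1]) simp
  have J: "(\<integral>y. of_real (indicator Q y) * ch (l - k) y \<partial>lborel) = (if k = l then of_real \<mu> else 0)"
    if "l \<in> S" "k \<in> S" for k l
  proof (cases "k = l")
    case True
    have "(\<integral>y. complex_of_real (indicator Q y) \<partial>lborel) = of_real (\<integral>y. indicator Q y \<partial>lborel)"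
      by (rule integral_bounded_linear[OF bounded_linear_of_real Q_integrable])
    then show ?thesis
      using True by (simp add: \<mu>_def)
  next
    case False
    then show ?thesis
      using ch_orthogonal[of "l - k"] S(2) that int_vecs_diff by auto
  qed
  have eq: "of_real (indicator Q y) * (q y * cnj (q y)) =
      (\<Sum>l\<in>S. \<Sum>k\<in>S. (a l * cnj (a k)) * (of_real (indicator Q y) * ch (l - k) y))" for y
  proof -
    have "ch (l - k) y = ch l y * cnj (ch k y)" for l k
      by (simp add: cnj_ch ch_mult)
    moreover have "q y * cnj (q y) = (\<Sum>l\<in>S. \<Sum>k\<in>S. (a l * ch l y) * cnj (a k * ch k y))"
      by (simp only: q cnj_sum sum_product)
    ultimately show ?thesis
      by (simp only: sum_distrib_left complex_cnj_mult mult_ac)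
  qed
  have "(\<integral>y. of_real (indicator Q y) * (q y * cnj (q y)) \<partial>lborel) =
      (\<Sum>l\<in>S. \<Sum>k\<in>S. (a l * cnj (a k)) * (\<integral>y. of_real (indicator Q y) * ch (l - k) y \<partial>lborel))"
    unfolding eq using chQ by (simp add: Bochner_Integration.integral_sum)
  also have "\<dots> = (\<Sum>l\<in>S. \<Sum>k\<in>S. (a l * cnj (a k)) * (if k = l then of_real \<mu> else 0))"
    by (intro sum.cong refl) (simp only: J)
  also have "\<dots> = (\<Sum>l\<in>S. (a l * cnj (a l)) * of_real \<mu>)"
    using S(1) by (intro sum.cong refl) (simp add: if_distrib[of "(*) _"] cong: if_cong)
  also have "\<dots> = of_real (\<mu> * (\<Sum>l\<in>S. (norm (a l))\<^sup>2))"
    unfolding of_real_mult of_real_sum complex_norm_square sum_distrib_left by (simp add: mult_ac)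
  finally show ?thesis .
qed

text \<open>The exact identity would equate the sum over all l with \<mu> times the integral. Here a
  trigonometric polynomial q, uniformly close to the periodization P, is tested against F:
  orthogonality evaluates the integral of |q|^2 over the cell, and the loss is \<mu> times the
  integral of |P - q|^2.\<close>

lemma Parseval_lower:
  assumes F: "continuous_on UNIV F"
    and le: "\<And>y. norm (F y :: complex) \<le> C / wt y ^ (2 * d0)" and C: "0 \<le> C" and \<eta>: "\<eta> > 0"
  shows "\<exists>S. finite S \<and> S \<subseteq> int_vecs \<and>
    \<mu> * Re (\<integral>y. F y * cnj (periodize F y) \<partial>lborel) - \<eta> \<le> (\<Sum>l\<in>S. (norm (\<integral>y. F y * cnj (ch l y) \<partial>lborel))\<^sup>2)"
proof -
  define P where "P = periodize F"
  have Pc: "continuous_on UNIV P"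
    unfolding P_def by (rule periodize_continuous[OF F le C])
  have Pp: "P (y + L *\<^sub>R k) = P y" if "k \<in> int_vecs" for k y
    unfolding P_def by (rule periodize_periodic[OF le C that])
  obtain W where W: "\<And>y. norm (P y) \<le> W"
    unfolding P_def using periodize_bounded[OF le C] by metis
  have Fb: "F \<in> borel_measurable borel" and Pb: "P \<in> borel_measurable borel"
    using F Pc by (auto intro: borel_measurable_continuous_onI)
  \<comment> \<open>The integral of |P - q|^2 over the cell is at most \<epsilon>^2 \<mu>, and the
    factor \<mu> turns this into \<eta>.\<close>
  define \<epsilon> where "\<epsilon> = sqrt \<eta> / \<mu>"
  have \<epsilon>: "\<epsilon> > 0" "\<mu> * (\<epsilon>\<^sup>2 * \<mu>) = \<eta>"
    using \<eta> \<mu>_pos by (auto simp: \<epsilon>_def power2_eq_square)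
  obtain q where q: "trig q" "\<And>y. norm (q y - P y) < \<epsilon>"
    using trig_dense[OF Pc Pp \<epsilon>(1)] by blast
  obtain S a where S: "finite S" "S \<subseteq> int_vecs" and qa: "q = (\<lambda>y. \<Sum>l\<in>S. a l * ch l y)"
    using trig_sum[OF q(1)] by blast
  have qc: "continuous_on UNIV q"
    unfolding qa by (intro continuous_intros ch_continuous)
  have qb: "q \<in> borel_measurable borel"
    by (rule borel_measurable_continuous_onI[OF qc])
  have qp: "q (y + L *\<^sub>R k) = q y" if "k \<in> int_vecs" for k y
    unfolding qa using S(2) that by (intro sum.cong refl) (auto simp: ch_period)
  have qW: "norm (q y) \<le> W + \<epsilon>" for y
    using q(2)[of y] W[of y] norm_triangle_sub[of "q y" "P y"] by linarith
  \<comment> \<open>For periodic h the factor \<open>cnj (h y)\<close> leaves the sum over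
    translates, so F times it unfolds to P times it over the cell.\<close>
  have fold: "(\<integral>y. F y * cnj (h y) \<partial>lborel) = (\<integral>y. of_real (indicator Q y) * (P y * cnj (h y)) \<partial>lborel)"
    if hb: "h \<in> borel_measurable borel" and hp: "\<And>k y. k \<in> int_vecs \<Longrightarrow> h (y + L *\<^sub>R k) = h y"
      and hW: "\<And>y. norm (h y) \<le> V" for h V
  proof -
    define G where "G y = F y * cnj (h y)" for y
    have Gb: "G \<in> borel_measurable borel"
      unfolding G_def using Fb hb by measurable
    have Gle: "norm (G y) \<le> (C * V) / wt y ^ (2 * d0)" for y
    proof -
      have "norm (G y) \<le> (C / wt y ^ (2 * d0)) * V"
        unfolding G_def norm_mult complex_mod_cnj using C by (intro mult_mono le hW) auto
      then show ?thesis by simp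
    qed
    have per: "periodize G y = P y * cnj (h y)" for y
    proof -
      have "G (y + pt n) = F (y + pt n) * cnj (h y)" for n
        by (simp add: G_def pt_def hp)
      then show ?thesis
        unfolding periodize_def P_def
        using suminf_mult2[OF summable_norm_cancel[OF periodize_summable[OF le C]], of y "cnj (h y)"] by simp
    qed
    have "(\<integral>y. G y \<partial>lborel) = (\<integral>y. of_real (indicator Q y) * (P y * cnj (h y)) \<partial>lborel)"
      using unfold_integral(1)[OF Gb Gle] by (simp only: per)
    then show ?thesis
      by (simp only: G_def)
  qed
  have Fi: "integrable lborel (\<lambda>y. F y * cnj (ch l y))" for l
  proof (rule integrable_decay)
    show "(\<lambda>y. F y * cnj (ch l y)) \<in> borel_measurable borel"
      using Fb by measurable
    fix y
    have "norm (F y * cnj (ch l y)) \<le> C / wt y ^ (2 * d0)"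
      using le by (simp add: norm_mult)
    also have "\<dots> \<le> C / wt y ^ d0"
      using C by (intro divide_left_mono power_increasing) auto
    finally show "norm (F y * cnj (ch l y)) \<le> C / wt y ^ (DIM(real ^ 'd) + 2)"
      by (simp add: d0_def)
  qed
  define Fh where "Fh l = (\<integral>y. F y * cnj (ch l y) \<partial>lborel)" for l
  \<comment> \<open>Nonnegativity of |w - \<mu> b|^2. Equality would hold if b were the exact
    Fourier coefficient w / \<mu> of P.\<close>
  have low: "(norm w)\<^sup>2 \<ge> 2 * \<mu> * Re (cnj b * w) - \<mu>\<^sup>2 * (norm b)\<^sup>2" for w b :: complex
  proof -
    have "0 \<le> (norm w)\<^sup>2 - 2 * \<mu> * Re (w * cnj b) + \<mu>\<^sup>2 * (norm b)\<^sup>2"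
      unfolding norm_diff_scaled_power2[symmetric] by simp
    then show ?thesis
      unfolding mult.commute[of "cnj b"] by linarith
  qed
  have Fq: "(\<Sum>l\<in>S. cnj (a l) * Fh l) = (\<integral>y. of_real (indicator Q y) * (P y * cnj (q y)) \<partial>lborel)"
  proof -
    have "(\<Sum>l\<in>S. cnj (a l) * Fh l) = (\<integral>y. (\<Sum>l\<in>S. cnj (a l) * (F y * cnj (ch l y))) \<partial>lborel)"
      unfolding Fh_def using Fi by (simp add: Bochner_Integration.integral_sum)
    also have "\<dots> = (\<integral>y. F y * cnj (q y) \<partial>lborel)"
      by (simp add: qa sum_distrib_left mult_ac)
    also have "\<dots> = (\<integral>y. of_real (indicator Q y) * (P y * cnj (q y)) \<partial>lborel)"
      by (rule fold[OF qb qp qW])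
    finally show ?thesis .
  qed
  have Ipq: "integrable lborel (\<lambda>y. of_real (indicator Q y) * (P y * cnj (q y)))"
    by (rule Q_mult_integrable[where W="W * (W + \<epsilon>)"])
      (use Pb qb in measurable, auto simp: norm_mult intro!: mult_mono W qW order_trans[OF norm_ge_zero W])
  have Iqq: "integrable lborel (\<lambda>y. of_real (indicator Q y) * (q y * cnj (q y)))"
    by (rule Q_mult_integrable[where W="(W + \<epsilon>) * (W + \<epsilon>)"])
      (use qb in measurable, auto simp: norm_mult intro!: mult_mono qW order_trans[OF norm_ge_zero qW])
  have Ipp: "integrable lborel (\<lambda>y. of_real (indicator Q y) * (P y * cnj (P y)))"
    by (rule Q_mult_integrable[where W="W * W"])
      (use Pb in measurable, auto simp: norm_mult intro!: mult_mono W order_trans[OF norm_ge_zero W])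
  have I1: "complex_of_real (\<mu>) = (\<integral>y. complex_of_real (indicator Q y) \<partial>lborel)"
    unfolding \<mu>_def by (rule integral_bounded_linear[OF bounded_linear_of_real Q_integrable, symmetric])
  have FP: "(\<integral>y. F y * cnj (P y) \<partial>lborel) = (\<integral>y. of_real (indicator Q y) * (P y * cnj (P y)) \<partial>lborel)"
    by (rule fold[OF Pb Pp W])
  have "Re (\<integral>y. F y * cnj (P y) \<partial>lborel) - \<epsilon>\<^sup>2 * \<mu> =
      (\<integral>y. Re (of_real (indicator Q y) * (P y * cnj (P y))) - \<epsilon>\<^sup>2 * indicator Q y \<partial>lborel)"
    using integral_Re[OF Ipp] integrable_Re[OF Ipp] Q_integrable by (simp add: FP \<mu>_def)
  also have "\<dots> \<le> (\<integral>y. 2 * Re (of_real (indicator Q y) * (P y * cnj (q y))) - Re (of_real (indicator Q y) * (q y * cnj (q y))) \<partial>lborel)"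
  proof (intro integral_mono Bochner_Integration.integrable_diff integrable_mult_right integrable_Re Ipp Ipq Iqq Q_integrable)
    fix y
    have "(norm (P y - q y))\<^sup>2 \<le> \<epsilon>\<^sup>2"
      using q(2)[of y] by (intro power_mono) (auto simp: norm_minus_commute less_imp_le)
    moreover have "(norm (P y - q y))\<^sup>2 = (norm (P y))\<^sup>2 - 2 * Re (P y * cnj (q y)) + (norm (q y))\<^sup>2"
      using norm_diff_scaled_power2[of "P y" 1 "q y"] by simp
    moreover have "Re (z * cnj z) = (norm z)\<^sup>2" for z
      by (metis Re_complex_of_real complex_norm_square)
    ultimately show "Re (of_real (indicator Q y) * (P y * cnj (P y))) - \<epsilon>\<^sup>2 * indicator Q y \<le>
        2 * Re (of_real (indicator Q y) * (P y * cnj (q y))) - Re (of_real (indicator Q y) * (q y * cnj (q y)))"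
      by (cases "y \<in> Q") auto
  qed
  also have "\<dots> = 2 * Re (\<Sum>l\<in>S. cnj (a l) * Fh l) - \<mu> * (\<Sum>l\<in>S. (norm (a l))\<^sup>2)"
    using integral_Re[OF Ipq] integral_Re[OF Iqq] integrable_Re[OF Ipq] integrable_Re[OF Iqq]
      trig_norm_integral[OF S, of q a] by (simp add: Fq qa)
  finally have "\<mu> * (Re (\<integral>y. F y * cnj (P y) \<partial>lborel) - \<epsilon>\<^sup>2 * \<mu>) \<le> \<mu> * (2 * Re (\<Sum>l\<in>S. cnj (a l) * Fh l) - \<mu> * (\<Sum>l\<in>S. (norm (a l))\<^sup>2))"
    using \<mu>_pos by (intro mult_left_mono) auto
  also have "\<dots> = (\<Sum>l\<in>S. 2 * \<mu> * Re (cnj (a l) * Fh l) - \<mu>\<^sup>2 * (norm (a l))\<^sup>2)"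
    by (simp add: sum_subtractf sum_distrib_left power2_eq_square algebra_simps)
  also have "\<dots> \<le> (\<Sum>l\<in>S. (norm (Fh l))\<^sup>2)"
    by (intro sum_mono low)
  finally have "\<mu> * Re (\<integral>y. F y * cnj (P y) \<partial>lborel) - \<eta> \<le> (\<Sum>l\<in>S. (norm (Fh l))\<^sup>2)"
    using \<epsilon>(2) by (simp add: right_diff_distrib)
  then show ?thesis
    using S unfolding P_def Fh_def by blast
qed

section \<open>The lower frame bound for fine lattices\<close>

lemma zero_point:
  obtains n0 where "\<And>n. (enum_vec n = (0 :: real ^ 'd)) = (n = n0)"
proof -
  obtain n0 where "enum_vec n0 = (0 :: real ^ 'd)"
    using enum_vec_surj[OF int_vecs_zero] by blast
  then have "(enum_vec n = (0 :: real ^ 'd)) = (n = n0)" for n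
    by (metis enum_vec_inj)
  then show thesis
    using that by blast
qed

definition offdiag :: "(real ^ 'd \<Rightarrow> complex) \<Rightarrow> nat \<Rightarrow> real ^ 'd \<Rightarrow> real"
  where "offdiag F n y = (if enum_vec n = (0 :: real ^ 'd) then 0 else norm (F y) * norm (F (y + pt n)))"

text \<open>The index \<open>n0\<close> of the zero vector contributes the diagonal term |F y|^2;
  all other translates are estimated in modulus and form \<open>offdiag\<close>.\<close>

lemma Re_periodize_ge:
  assumes le: "\<And>y. norm (F y :: complex) \<le> C / wt y ^ (2 * d0)" and C: "0 \<le> C"
  shows "summable (\<lambda>n. offdiag F n y)"
    and "(norm (F y))\<^sup>2 - (\<Sum>n. offdiag F n y) \<le> Re (F y * cnj (periodize F y))"
proof -
  obtain n0 where n0: "\<And>n. (enum_vec n = (0 :: real ^ 'd)) = (n = n0)"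
    by (rule zero_point) metis
  then have pt0: "pt n0 = 0"
    by (simp add: pt_def)
  note sn = periodize_summable[OF le C, of y]
  note s = summable_norm_cancel[OF sn]
  show so: "summable (\<lambda>n. offdiag F n y)"
    by (rule summable_comparison_test'[OF summable_mult[OF sn, of "norm (F y)"]]) (simp add: offdiag_def)
  define G where "G n = (if n = n0 then 0 else F (y + pt n))" for n
  have Gn: "norm (G n) \<le> norm (F (y + pt n))" for n
    by (simp add: G_def)
  have sGn: "summable (\<lambda>n. norm (G n))"
    by (rule summable_comparison_test'[OF sn]) (simp add: Gn)
  have "(\<lambda>n. (if n = n0 then F y else 0) + G n) sums (F y + suminf G)"
    by (intro sums_add sums_single summable_sums summable_norm_cancel[OF sGn])
  moreover have "(if n = n0 then F y else 0) + G n = F (y + pt n)" for n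
    by (simp add: G_def pt0)
  ultimately have P: "periodize F y = F y + suminf G"
    by (simp add: periodize_def sums_iff)
  have "norm (F y * cnj (suminf G)) \<le> norm (F y) * (\<Sum>n. norm (G n))"
    unfolding norm_mult complex_mod_cnj by (intro mult_left_mono summable_norm sGn) auto
  also have "\<dots> = (\<Sum>n. norm (F y) * norm (G n))"
    by (rule suminf_mult[OF sGn, symmetric])
  also have "\<dots> = (\<Sum>n. offdiag F n y)"
    by (intro suminf_cong) (simp add: offdiag_def G_def n0)
  finally have "- (\<Sum>n. offdiag F n y) \<le> Re (F y * cnj (suminf G))"
    using abs_Re_le_cmod[of "F y * cnj (suminf G)"] by linarith
  moreover have "Re (F y * cnj (periodize F y)) = (norm (F y))\<^sup>2 + Re (F y * cnj (suminf G))"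
    unfolding P complex_cnj_add distrib_left plus_complex.sel
    using cmod_power2[of "F y"] by (simp add: power2_eq_square)
  ultimately show "(norm (F y))\<^sup>2 - (\<Sum>n. offdiag F n y) \<le> Re (F y * cnj (periodize F y))"
    by linarith
qed

text \<open>Each product is at most half the sum of the two squares, and both squares have the same
  integral by translation invariance.\<close>

lemma cross_term_bound:
  assumes f: "f \<in> schwartz" and \<kappa>: "summable \<kappa>" "\<And>n. 0 \<le> \<kappa> n"
  shows "integrable lborel (\<lambda>y. \<Sum>n. \<kappa> n * (norm (f y) * norm (f (y + pt n))))"
    and "(\<integral>y. (\<Sum>n. \<kappa> n * (norm (f y) * norm (f (y + pt n)))) \<partial>lborel) \<le> suminf \<kappa> * (l2_norm f)\<^sup>2"
    and "\<And>y. summable (\<lambda>n. \<kappa> n * (norm (f y) * norm (f (y + pt n))))"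
proof -
  obtain S where S: "0 \<le> S" "\<And>y. norm (f y) \<le> S / wt y ^ 0"
    using schwartz_decayE[OF f] by metis
  define g where "g n y = \<kappa> n * (norm (f y) * norm (f (y + pt n)))" for n y
  have [measurable]: "f \<in> borel_measurable borel"
    by (rule schwartz_borel[OF f])
  have gb: "g n \<in> borel_measurable borel" for n
    unfolding g_def by measurable
  have gle: "norm (g n y) \<le> \<kappa> n * (S * norm (f y))" for n y
  proof -
    have "norm (f y) * norm (f (y + pt n)) \<le> norm (f y) * S"
      using S(2)[of "y + pt n"] by (intro mult_left_mono) auto
    then have "\<kappa> n * (norm (f y) * norm (f (y + pt n))) \<le> \<kappa> n * (norm (f y) * S)"
      using \<kappa>(2) by (rule mult_left_mono)
    then show ?thesis
      using \<kappa>(2)[of n] by (simp add: g_def abs_mult mult.commute[of S])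
  qed
  have h: "integrable lborel (\<lambda>y. S * norm (f y))"
    by (intro integrable_mult_right integrable_norm schwartz_integrable f)
  note sw = integral_suminf_dominated[OF gb gle \<kappa>(1) h]
  have ig: "integrable lborel (g n)" for n
  proof (rule Bochner_Integration.integrable_bound)
    show "integrable lborel (\<lambda>y. \<kappa> n * (S * norm (f y)))"
      using h by simp
    show "AE y in lborel. norm (g n y) \<le> norm (\<kappa> n * (S * norm (f y)))"
      using order_trans[OF gle abs_ge_self] by (intro AE_I2) simp
  qed (use gb in simp)
  have n2: "integrable lborel (\<lambda>y. (norm (f y))\<^sup>2)"
    by (rule schwartz_norm2_integrable[OF f])
  have n2b: "(\<lambda>y. (norm (f y))\<^sup>2) \<in> borel_measurable borel"
    by measurable
  have sh: "integrable lborel (\<lambda>y. (norm (f (y + a)))\<^sup>2)" "(\<integral>y. (norm (f (y + a)))\<^sup>2 \<partial>lborel) = (l2_norm f)\<^sup>2" for a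
    using lborel_shift[OF n2b, of a] n2 by (simp_all add: add.commute l2_norm_lborel[OF f])
  have gi: "(\<integral>y. g n y \<partial>lborel) \<le> \<kappa> n * (l2_norm f)\<^sup>2" for n
  proof -
    have "(\<integral>y. g n y \<partial>lborel) \<le> (\<integral>y. \<kappa> n * ((1 / 2) * (norm (f y))\<^sup>2 + (1 / 2) * (norm (f (y + pt n)))\<^sup>2) \<partial>lborel)"
      unfolding g_def
    proof (intro integral_mono ig[unfolded g_def] integrable_mult_right Bochner_Integration.integrable_add n2 sh mult_left_mono \<kappa>)
      show "norm (f y) * norm (f (y + pt n)) \<le> 1 / 2 * (norm (f y))\<^sup>2 + 1 / 2 * (norm (f (y + pt n)))\<^sup>2" for y
        using sum_squares_bound[of "norm (f y)" "norm (f (y + pt n))"] by simp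
    qed
    also have "\<dots> = \<kappa> n * (l2_norm f)\<^sup>2"
      using n2 sh[of "pt n"] by (simp add: l2_norm_lborel[OF f])
    finally show ?thesis .
  qed
  show "integrable lborel (\<lambda>y. \<Sum>n. \<kappa> n * (norm (f y) * norm (f (y + pt n))))"
    using sw(1) by (simp add: g_def)
  have "(\<integral>y. (\<Sum>n. g n y) \<partial>lborel) = (\<Sum>n. \<integral>y. g n y \<partial>lborel)"
    using sums_unique[OF sw(2)] .
  also have "\<dots> \<le> (\<Sum>n. \<kappa> n * (l2_norm f)\<^sup>2)"
    by (intro suminf_le gi sums_summable[OF sw(2)] summable_mult2 \<kappa>)
  also have "\<dots> = suminf \<kappa> * (l2_norm f)\<^sup>2"
    by (rule suminf_mult2[OF \<kappa>(1), symmetric])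
  finally show "(\<integral>y. (\<Sum>n. \<kappa> n * (norm (f y) * norm (f (y + pt n)))) \<partial>lborel) \<le> suminf \<kappa> * (l2_norm f)\<^sup>2"
    by (simp add: g_def)
  show "summable (\<lambda>n. \<kappa> n * (norm (f y) * norm (f (y + pt n))))" for y
    using summable_comparison_test'[OF summable_mult2[OF \<kappa>(1), of "S * norm (f y)"], of 0 "\<lambda>n. g n y"] gle
    by (simp add: g_def)
qed

text \<open>With modulation step 2 pi / L, the frame coefficient is the integral of f times the
  conjugate translate of \<psi> against a character of period L, hence accessible to
  \<open>Parseval_lower\<close>.\<close>

lemma l2_inner_tf_shift_lattice:
  assumes "f \<in> schwartz" "\<psi> \<in> schwartz"
  shows "l2_inner f (tf_shift (\<alpha> *\<^sub>R k, (2 * pi / L) *\<^sub>R l) \<psi>) =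
    (\<integral>y. f y * cnj (\<psi> (y - \<alpha> *\<^sub>R k)) * cnj (ch l y) \<partial>lborel)"
  unfolding l2_inner_lborel[OF assms(1) schwartz_tf_shift[OF assms(2)]]
  by (simp add: tf_shift_apply ch_def mult_ac)

text \<open>Walnut's representation: summing the frame coefficients over the modulations periodizes
  \<open>f * cnj (T \<psi>)\<close>, whose diagonal term is bounded below by \<open>c0\<close> and whose other terms are small
  when the period is large.\<close>

lemma lattice_lower_bound:
  assumes f: "f \<in> schwartz" and \<psi>: "\<psi> \<in> schwartz"
    and c0: "c0 > 0" "\<And>y. \<exists>n. c0 \<le> (norm (\<psi> (y - \<alpha> *\<^sub>R enum_vec n)))\<^sup>2"
    and \<kappa>: "summable \<kappa>" "\<And>n. 0 \<le> \<kappa> n" "suminf \<kappa> \<le> c0 / 2"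
    and cross: "\<And>n y j. enum_vec n \<noteq> (0 :: real ^ 'd) \<Longrightarrow>
      (\<Sum>i<j. norm (\<psi> (y - \<alpha> *\<^sub>R enum_vec i)) * norm (\<psi> (y + pt n - \<alpha> *\<^sub>R enum_vec i))) \<le> \<kappa> n"
    and \<alpha>: "\<alpha> > 0"
    and B: "\<And>T. finite T \<Longrightarrow> T \<subseteq> tf_lattice \<alpha> (2 * pi / L) \<Longrightarrow> (\<Sum>w\<in>T. (norm (l2_inner f (tf_shift w \<psi>)))\<^sup>2) \<le> B"
  shows "\<mu> * (c0 / 2) * (l2_norm f)\<^sup>2 \<le> B"
proof -
  define F where "F i y = f y * cnj (\<psi> (y - \<alpha> *\<^sub>R enum_vec i))" for i y
  have Fc: "continuous_on UNIV (F i)" for i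
    unfolding F_def
    by (intro continuous_intros schwartz_continuous_on f continuous_on_compose2[OF schwartz_continuous_on[OF \<psi>, of UNIV]]) auto
  obtain Cf where Cf: "0 \<le> Cf" "\<And>y. norm (f y) \<le> Cf / wt y ^ (2 * d0)"
    using schwartz_decayE[OF f] by metis
  obtain Cp where Cp: "0 \<le> Cp" "\<And>y. norm (\<psi> y) \<le> Cp / wt y ^ 0"
    using schwartz_decayE[OF \<psi>] by metis
  define C where "C = Cf * Cp"
  have C: "0 \<le> C"
    using Cf Cp by (simp add: C_def)
  have Fle: "norm (F i y) \<le> C / wt y ^ (2 * d0)" for i y
    using mult_mono[OF Cf(2)[of y] Cp(2)[of "y - \<alpha> *\<^sub>R enum_vec i"]] Cf(1)
    by (simp add: F_def C_def norm_mult)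
  have Pc: "continuous_on UNIV (periodize (F i))" for i
    by (rule periodize_continuous[OF Fc Fle C])
  have FPi: "integrable lborel (\<lambda>y. F i y * cnj (periodize (F i) y))" for i
  proof -
    obtain W where W: "\<And>y. norm (periodize (F i) y) \<le> W"
      by (rule periodize_bounded[of "F i", OF Fle C]) metis
    show ?thesis
    proof (rule integrable_decay)
      show "(\<lambda>y. F i y * cnj (periodize (F i) y)) \<in> borel_measurable borel"
        by (intro borel_measurable_continuous_onI continuous_intros Fc Pc)
      fix y
      have "norm (F i y * cnj (periodize (F i) y)) \<le> (C / wt y ^ (2 * d0)) * W"
        unfolding norm_mult complex_mod_cnj using C by (intro mult_mono Fle W) auto
      also have "\<dots> \<le> (C / wt y ^ d0) * W"
        using C order_trans[OF norm_ge_zero W] by (intro mult_right_mono divide_left_mono power_increasing) auto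
      finally show "norm (F i y * cnj (periodize (F i) y)) \<le> (C * W) / wt y ^ (DIM(real ^ 'd) + 2)"
        by (simp add: d0_def)
    qed
  qed
  define X where "X i = Re (\<integral>y. F i y * cnj (periodize (F i) y) \<partial>lborel)" for i
  have upper: "\<mu> * (\<Sum>i<j. X i) \<le> B" for j
  proof (rule field_le_epsilon)
    fix e :: real assume e: "e > 0"
    \<comment> \<open>Parseval is applied once for each of the j translations, so the total error
      stays below \<open>e\<close>; the 1 covers j = 0.\<close>
    define \<eta> where "\<eta> = e / (real j + 1)"
    have \<eta>: "\<eta> > 0" "real j * \<eta> \<le> e"
      using e by (auto simp: \<eta>_def field_simps)
    have "\<forall>i. \<exists>S. finite S \<and> S \<subseteq> int_vecs \<and> \<mu> * X i - \<eta> \<le> (\<Sum>l\<in>S. (norm (\<integral>y. F i y * cnj (ch l y) \<partial>lborel))\<^sup>2)"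
      unfolding X_def using Parseval_lower[OF Fc Fle C \<eta>(1)] by blast
    from choice[OF this] obtain S where "\<forall>i. finite (S i) \<and> S i \<subseteq> int_vecs \<and>
        \<mu> * X i - \<eta> \<le> (\<Sum>l\<in>S i. (norm (\<integral>y. F i y * cnj (ch l y) \<partial>lborel))\<^sup>2)"
      by (elim exE)
    then have S: "\<And>i. finite (S i)" "\<And>i. S i \<subseteq> int_vecs"
      "\<And>i. \<mu> * X i - \<eta> \<le> (\<Sum>l\<in>S i. (norm (\<integral>y. F i y * cnj (ch l y) \<partial>lborel))\<^sup>2)"
      by auto
    define J where "J = (\<lambda>(i, l). (\<alpha> *\<^sub>R (enum_vec i :: real ^ 'd), (2 * pi / L) *\<^sub>R (l :: real ^ 'd)))"
    define T where "T = Sigma {..<j} S"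
    have inj: "inj_on J T"
      using \<alpha> L by (auto simp: inj_on_def J_def enum_vec_inj)
    have "\<mu> * (\<Sum>i<j. X i) - e \<le> (\<Sum>i<j. \<mu> * X i - \<eta>)"
      using \<eta>(2) by (simp add: sum_subtractf sum_distrib_left)
    also have "\<dots> \<le> (\<Sum>i<j. \<Sum>l\<in>S i. (norm (\<integral>y. F i y * cnj (ch l y) \<partial>lborel))\<^sup>2)"
      by (intro sum_mono S)
    also have "\<dots> = (\<Sum>x\<in>T. (norm (l2_inner f (tf_shift (J x) \<psi>)))\<^sup>2)"
      unfolding T_def using S(1)
      by (subst sum.Sigma) (auto simp: J_def l2_inner_tf_shift_lattice[OF f \<psi>] F_def intro!: sum.cong)
    also have "\<dots> = (\<Sum>w\<in>J ` T. (norm (l2_inner f (tf_shift w \<psi>)))\<^sup>2)"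
      by (simp add: sum.reindex[OF inj])
    also have "\<dots> \<le> B"
    proof (rule B)
      show "finite (J ` T)"
        using S(1) by (simp add: T_def)
      show "J ` T \<subseteq> tf_lattice \<alpha> (2 * pi / L)"
      proof
        fix x assume "x \<in> J ` T"
        then obtain i l where "l \<in> S i" "x = (\<alpha> *\<^sub>R enum_vec i, (2 * pi / L) *\<^sub>R l)"
          by (auto simp: T_def J_def)
        moreover have "enum_vec i \<in> (int_vecs :: (real ^ 'd) set)" "l \<in> int_vecs"
          using S(2) \<open>l \<in> S i\<close> by auto
        ultimately show "x \<in> tf_lattice \<alpha> (2 * pi / L)"
          unfolding tf_lattice_def int_vecs_def by blast
      qed
    qed
    finally show "\<mu> * (\<Sum>i<j. X i) \<le> B + e"
      by simp
  qed
  define s where "s j y = (\<Sum>i<j. (norm (\<psi> (y - \<alpha> *\<^sub>R enum_vec i)))\<^sup>2)" for j y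
  \<comment> \<open>Capping at \<open>c0\<close> provides the dominating function c0 |f|^2. By the
    covering hypothesis \<open>g j y\<close> equals it once j passes a suitable index, so dominated
    convergence applies.\<close>
  define g where "g j y = min c0 (s j y) * (norm (f y))\<^sup>2" for j y
  have f2: "integrable lborel (\<lambda>y. (norm (f y))\<^sup>2)"
    by (rule schwartz_norm2_integrable[OF f])
  have s0: "0 \<le> s j y" for j y
    unfolding s_def by (intro sum_nonneg) auto
  have gle: "norm (g j y) \<le> c0 * (norm (f y))\<^sup>2" for j y
    using c0(1) s0[of j y] by (simp add: g_def abs_mult mult_right_mono)
  have gb: "g j \<in> borel_measurable lborel" for j
  proof -
    have "continuous_on UNIV (g j)"
      unfolding g_def s_def
      by (intro continuous_intros schwartz_continuous_on f continuous_on_compose2[OF schwartz_continuous_on[OF \<psi>, of UNIV]]) auto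
    then show ?thesis
      using borel_measurable_continuous_onI by simp
  qed
  have ig: "integrable lborel (g j)" for j
    by (rule Bochner_Integration.integrable_bound[OF integrable_mult_right[OF f2, of c0] gb])
      (use order_trans[OF gle abs_ge_self] in simp)
  note ct = cross_term_bound[OF f \<kappa>(1,2)]
  have low: "(\<integral>y. g j y \<partial>lborel) - c0 / 2 * (l2_norm f)\<^sup>2 \<le> (\<Sum>i<j. X i)" for j
  proof -
    have ptw: "g j y - (\<Sum>n. \<kappa> n * (norm (f y) * norm (f (y + pt n)))) \<le> (\<Sum>i<j. Re (F i y * cnj (periodize (F i) y)))" for y
    proof -
      note so = Re_periodize_ge(1)[OF Fle C]
      have "(\<Sum>i<j. offdiag (F i) n y) \<le> \<kappa> n * (norm (f y) * norm (f (y + pt n)))" for n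
      proof (cases "enum_vec n = (0 :: real ^ 'd)")
        case True
        then show ?thesis
          using \<kappa>(2)[of n] by (simp add: offdiag_def)
      next
        case False
        then have "(\<Sum>i<j. offdiag (F i) n y) = (\<Sum>i<j. norm (\<psi> (y - \<alpha> *\<^sub>R enum_vec i)) * norm (\<psi> (y + pt n - \<alpha> *\<^sub>R enum_vec i))) *
            (norm (f y) * norm (f (y + pt n)))"
          unfolding sum_distrib_right by (intro sum.cong) (auto simp: offdiag_def F_def norm_mult)
        also have "\<dots> \<le> \<kappa> n * (norm (f y) * norm (f (y + pt n)))"
          by (intro mult_right_mono cross False) auto
        finally show ?thesis .
      qed
      then have "(\<Sum>n. \<Sum>i<j. offdiag (F i) n y) \<le> (\<Sum>n. \<kappa> n * (norm (f y) * norm (f (y + pt n))))"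
        by (intro suminf_le summable_sum so ct(3))
      then have 1: "(\<Sum>i<j. \<Sum>n. offdiag (F i) n y) \<le> (\<Sum>n. \<kappa> n * (norm (f y) * norm (f (y + pt n))))"
        by (simp add: suminf_sum so)
      have "g j y \<le> s j y * (norm (f y))\<^sup>2"
        unfolding g_def by (intro mult_right_mono) auto
      also have "\<dots> = (\<Sum>i<j. (norm (F i y))\<^sup>2)"
        unfolding s_def sum_distrib_right by (intro sum.cong) (auto simp: F_def norm_mult power_mult_distrib)
      finally have "g j y - (\<Sum>i<j. \<Sum>n. offdiag (F i) n y) \<le> (\<Sum>i<j. (norm (F i y))\<^sup>2 - (\<Sum>n. offdiag (F i) n y))"
        by (simp add: sum_subtractf)
      also have "\<dots> \<le> (\<Sum>i<j. Re (F i y * cnj (periodize (F i) y)))"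
        by (intro sum_mono Re_periodize_ge(2)[OF Fle C])
      finally show ?thesis
        using 1 by linarith
    qed
    have "(\<integral>y. g j y \<partial>lborel) - (\<integral>y. (\<Sum>n. \<kappa> n * (norm (f y) * norm (f (y + pt n)))) \<partial>lborel) =
        (\<integral>y. g j y - (\<Sum>n. \<kappa> n * (norm (f y) * norm (f (y + pt n)))) \<partial>lborel)"
      by (rule Bochner_Integration.integral_diff[OF ig ct(1), symmetric])
    also have "\<dots> \<le> (\<integral>y. (\<Sum>i<j. Re (F i y * cnj (periodize (F i) y))) \<partial>lborel)"
      by (intro integral_mono Bochner_Integration.integrable_diff ig ct(1) Bochner_Integration.integrable_sum integrable_Re FPi ptw)
    also have "\<dots> = (\<Sum>i<j. X i)"
      using integrable_Re[OF FPi] integral_Re[OF FPi] by (simp add: Bochner_Integration.integral_sum X_def del: times_complex.sel)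
    finally have "(\<integral>y. g j y \<partial>lborel) - (\<integral>y. (\<Sum>n. \<kappa> n * (norm (f y) * norm (f (y + pt n)))) \<partial>lborel) \<le> (\<Sum>i<j. X i)" .
    moreover have "(\<integral>y. (\<Sum>n. \<kappa> n * (norm (f y) * norm (f (y + pt n)))) \<partial>lborel) \<le> c0 / 2 * (l2_norm f)\<^sup>2"
      using ct(2) mult_right_mono[OF \<kappa>(3), of "(l2_norm f)\<^sup>2"] by simp
    ultimately show ?thesis
      by linarith
  qed
  have "(\<lambda>j. \<integral>y. g j y \<partial>lborel) \<longlonglongrightarrow> (\<integral>y. c0 * (norm (f y))\<^sup>2 \<partial>lborel)"
  proof (rule integral_dominated_convergence[where w="\<lambda>y. c0 * (norm (f y))\<^sup>2"])
    show "integrable lborel (\<lambda>y. c0 * (norm (f y))\<^sup>2)"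
      by (intro integrable_mult_right f2)
    then show "(\<lambda>y. c0 * (norm (f y))\<^sup>2) \<in> borel_measurable lborel"
      by (rule borel_measurable_integrable)
    have "(\<lambda>j. g j y) \<longlonglongrightarrow> c0 * (norm (f y))\<^sup>2" for y
    proof (rule tendsto_eventually)
      obtain n where n: "c0 \<le> (norm (\<psi> (y - \<alpha> *\<^sub>R enum_vec n)))\<^sup>2"
        using c0(2) by blast
      have "g j y = c0 * (norm (f y))\<^sup>2" if "n < j" for j
      proof -
        have "(norm (\<psi> (y - \<alpha> *\<^sub>R enum_vec n)))\<^sup>2 \<le> s j y"
          unfolding s_def using that by (intro member_le_sum[where f="\<lambda>i. (norm (\<psi> (y - \<alpha> *\<^sub>R enum_vec i)))\<^sup>2"]) auto
        then show ?thesis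
          using n by (simp add: g_def min_absorb1)
      qed
      then show "\<forall>\<^sub>F j in sequentially. g j y = c0 * (norm (f y))\<^sup>2"
        unfolding eventually_sequentially by (intro exI[of _ "Suc n"]) auto
    qed
    then show "AE y in lborel. (\<lambda>j. g j y) \<longlonglongrightarrow> c0 * (norm (f y))\<^sup>2"
      by simp
  qed (use gb gle in auto)
  then have "(\<lambda>j. \<mu> * ((\<integral>y. g j y \<partial>lborel) - c0 / 2 * (l2_norm f)\<^sup>2)) \<longlonglongrightarrow>
      \<mu> * (c0 * (l2_norm f)\<^sup>2 - c0 / 2 * (l2_norm f)\<^sup>2)"
    by (intro tendsto_intros) (simp add: l2_norm_lborel[OF f])
  moreover have "\<mu> * ((\<integral>y. g j y \<partial>lborel) - c0 / 2 * (l2_norm f)\<^sup>2) \<le> B" for j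
    using mult_left_mono[OF low[of j], of \<mu>] upper[of j] \<mu>_pos by linarith
  ultimately have "\<mu> * (c0 * (l2_norm f)\<^sup>2 - c0 / 2 * (l2_norm f)\<^sup>2) \<le> B"
    using LIMSEQ_le_const2 by blast
  then show ?thesis
    by (simp add: algebra_simps)
qed

end

text \<open>First \<alpha> is taken small enough that the translates cover, which bounds the
  diagonal term below by \<open>c0\<close>; then L is taken large enough that the overlaps, of size
  O(1/L), use up at most half of it. Stating the upper side through finite subsets of the lattice
  avoids any enumeration.\<close>

lemma lattice_lower_bound_exists:
  fixes \<psi> :: "real ^ 'd::finite \<Rightarrow> complex"
  assumes \<psi>: "\<psi> \<in> schwartz" and nz: "\<psi> \<noteq> (\<lambda>_. 0)"
  obtains \<alpha> \<beta> A where "\<alpha> > 0" "\<beta> > 0" "A > 0"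
    "\<And>f B. f \<in> schwartz \<Longrightarrow>
      (\<And>T. finite T \<Longrightarrow> T \<subseteq> tf_lattice \<alpha> \<beta> \<Longrightarrow> (\<Sum>w\<in>T. (norm (l2_inner f (tf_shift w \<psi>)))\<^sup>2) \<le> B) \<Longrightarrow>
      A * (l2_norm f)\<^sup>2 \<le> B"
proof -
  define M where "M = DIM(real ^ 'd) + 2"
  obtain y0 where y0: "\<psi> y0 \<noteq> 0"
    using nz by auto
  define t where "t = norm (\<psi> y0) / 2"
  define c0 where "c0 = t\<^sup>2"
  have t: "t > 0"
    using y0 by (simp add: t_def)
  then have c0: "c0 > 0"
    by (simp add: c0_def)
  have "isCont \<psi> y0"
    using schwartz_continuous_on[OF \<psi>, of UNIV] by (simp add: continuous_on_eq_continuous_at)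
  then obtain r where r: "r > 0" "\<And>y. dist y y0 < r \<Longrightarrow> dist (\<psi> y) (\<psi> y0) < t"
    unfolding continuous_at_eps_delta using t by metis
  have big: "t \<le> norm (\<psi> y)" if "dist y y0 < r" for y
  proof -
    have "norm (\<psi> y0) \<le> norm (\<psi> y) + dist (\<psi> y) (\<psi> y0)"
      unfolding dist_norm using norm_triangle_sub[of "\<psi> y0" "\<psi> y"] by (simp add: norm_minus_commute)
    then show ?thesis
      using r(2)[OF that] by (simp add: t_def)
  qed
  \<comment> \<open>Rounding to the grid of step \<alpha> leaves an error of at most \<alpha> per
    coordinate, so the l1 bound gives r/2, inside the ball where the modulus of \<psi> is at least
    \<open>t\<close>.\<close>
  define \<alpha> where "\<alpha> = r / (2 * real CARD('d))"
  have \<alpha>: "\<alpha> > 0" "real CARD('d) * \<alpha> = r / 2"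
    using r by (auto simp: \<alpha>_def)
  have hit: "\<exists>n. c0 \<le> (norm (\<psi> (y - \<alpha> *\<^sub>R enum_vec n)))\<^sup>2" for y
  proof -
    define k :: "real ^ 'd" where "k = (\<chi> i. of_int \<lfloor>(y - y0) $ i / \<alpha>\<rfloor>)"
    have "k \<in> int_vecs"
      by (auto simp: k_def int_vecs_def)
    then obtain n where n: "enum_vec n = k"
      using enum_vec_surj by blast
    have comp: "\<bar>(y - \<alpha> *\<^sub>R k - y0) $ i\<bar> \<le> \<alpha>" for i
    proof -
      define x where "x = (y - y0) $ i / \<alpha>"
      have "(y - \<alpha> *\<^sub>R k - y0) $ i = \<alpha> * (x - of_int \<lfloor>x\<rfloor>)"
      proof -
        have "(y - y0) $ i = \<alpha> * x"
          using \<alpha>(1) by (simp add: x_def)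
        moreover have "(y - \<alpha> *\<^sub>R k - y0) $ i = (y - y0) $ i - \<alpha> * of_int \<lfloor>x\<rfloor>"
          by (simp add: k_def x_def)
        ultimately show ?thesis
          by (simp only: right_diff_distrib)
      qed
      moreover have "\<bar>x - of_int \<lfloor>x\<rfloor>\<bar> \<le> 1"
        by linarith
      ultimately show ?thesis
        using \<alpha>(1) by (simp add: abs_mult mult_left_le)
    qed
    have "norm (y - \<alpha> *\<^sub>R k - y0) \<le> (\<Sum>i\<in>UNIV. \<bar>(y - \<alpha> *\<^sub>R k - y0) $ i\<bar>)"
      by (rule norm_le_l1_cart)
    also have "\<dots> \<le> (\<Sum>i\<in>(UNIV :: 'd set). \<alpha>)"
      by (intro sum_mono comp)
    also have "\<dots> < r"
      using \<alpha>(2) r(1) by simp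
    finally have "t \<le> norm (\<psi> (y - \<alpha> *\<^sub>R k))"
      by (intro big) (simp add: dist_norm)
    then show ?thesis
      unfolding c0_def using t by (intro exI[of _ n]) (simp add: n power_mono)
  qed
  obtain \<sigma> where \<sigma>: "0 \<le> \<sigma>" "\<And>z. summable (\<lambda>i. 1 / wt (\<alpha> *\<^sub>R (enum_vec i :: real ^ 'd) - z) ^ M)"
    "\<And>z. (\<Sum>i. 1 / wt (\<alpha> *\<^sub>R (enum_vec i :: real ^ 'd) - z) ^ M) \<le> \<sigma>"
  proof (rule separated_sum_bound[of \<alpha> "\<lambda>i. \<alpha> *\<^sub>R (enum_vec i :: real ^ 'd)"])
    fix m n :: nat assume "m \<noteq> n"
    then have "1 \<le> dist (enum_vec m :: real ^ 'd) (enum_vec n)"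
      by (rule enum_vec_separated)
    then have "\<alpha> * 1 \<le> \<alpha> * dist (enum_vec m :: real ^ 'd) (enum_vec n)"
      using \<alpha> by (intro mult_left_mono) auto
    then show "\<alpha> \<le> dist (\<alpha> *\<^sub>R (enum_vec m :: real ^ 'd)) (\<alpha> *\<^sub>R enum_vec n)"
      using \<alpha> by (simp add: dist_norm flip: scaleR_diff_right)
  qed (use \<alpha> in \<open>auto simp: M_def\<close>)
  have s1: "summable (\<lambda>n. 1 / wt (enum_vec n :: real ^ 'd) ^ M)"
  proof -
    obtain \<sigma>' where "\<And>z. summable (\<lambda>n. 1 / wt ((enum_vec n :: real ^ 'd) - z) ^ M)"
      by (rule separated_sum_bound[of 1 "enum_vec :: nat \<Rightarrow> real ^ 'd"]) (auto intro: enum_vec_separated simp: M_def)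
    from this[of 0] show ?thesis
      by simp
  qed
  define \<Sigma>1 where "\<Sigma>1 = (\<Sum>n. 1 / wt (enum_vec n :: real ^ 'd) ^ M)"
  have \<Sigma>1: "0 \<le> \<Sigma>1"
    unfolding \<Sigma>1_def by (intro suminf_nonneg s1) auto
  \<comment> \<open>One \<open>M\<close> sums over the translations, the other over the periods, and
    the single extra power produces the factor 1/L.\<close>
  obtain D where D: "0 \<le> D" "\<And>y. norm (\<psi> y) \<le> D / wt y ^ (M + 1 + M)"
    using schwartz_decayE[OF \<psi>] by metis
  define E where "E = D\<^sup>2 * \<sigma>"
  have E: "0 \<le> E"
    using \<sigma> by (simp add: E_def)
  \<comment> \<open>Large enough to push the total overlap below c0/2. The lower bound 1 keeps L
    positive and makes \<open>wt (pt n)\<close> at least \<open>wt (enum_vec n)\<close>.\<close>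
  define L where "L = max 1 (2 * E * \<Sigma>1 / c0)"
  have Lge: "1 \<le> L" "E * \<Sigma>1 / L \<le> c0 / 2"
  proof -
    show L1: "1 \<le> L"
      by (simp add: L_def)
    have "2 * E * \<Sigma>1 / c0 \<le> L"
      by (simp add: L_def)
    then show "E * \<Sigma>1 / L \<le> c0 / 2"
      using c0 L1 by (simp add: field_simps)
  qed
  interpret periodization L "TYPE('d)"
    using Lge by unfold_locales simp
  define \<kappa> where "\<kappa> n = E / L * (1 / wt (enum_vec n :: real ^ 'd) ^ M)" for n
  have \<kappa>: "summable \<kappa>" "0 \<le> \<kappa> n" "suminf \<kappa> \<le> c0 / 2" for n
  proof -
    show "summable \<kappa>"
      unfolding \<kappa>_def by (intro summable_mult s1)
    show "0 \<le> \<kappa> n"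
      using E Lge by (simp add: \<kappa>_def)
    have "suminf \<kappa> = E / L * \<Sigma>1"
      unfolding \<kappa>_def \<Sigma>1_def by (rule suminf_mult[OF s1])
    then show "suminf \<kappa> \<le> c0 / 2"
      using Lge(2) by simp
  qed
  have cross: "(\<Sum>i<j. norm (\<psi> (y - \<alpha> *\<^sub>R enum_vec i)) * norm (\<psi> (y + pt n - \<alpha> *\<^sub>R enum_vec i))) \<le> \<kappa> n"
    if n: "enum_vec n \<noteq> (0 :: real ^ 'd)" for n y j
  proof -
    let ?K = "M + 1"
    have le: "norm (\<psi> (y - \<alpha> *\<^sub>R enum_vec i)) * norm (\<psi> (y + pt n - \<alpha> *\<^sub>R enum_vec i)) \<le>
        D\<^sup>2 / wt (pt n) ^ ?K * (1 / wt (\<alpha> *\<^sub>R enum_vec i - y) ^ M)" for i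
    proof -
      define a b where "a = y - \<alpha> *\<^sub>R enum_vec i" and "b = y + pt n - \<alpha> *\<^sub>R enum_vec i"
      have "wt (pt n) \<le> wt b * wt a"
      proof -
        have "b + - a = pt n"
          by (simp add: a_def b_def)
        then show ?thesis
          using wt_add_le[of b "- a"] by (simp only: wt_uminus)
      qed
      then have ab: "wt (pt n) ^ ?K \<le> wt b ^ ?K * wt a ^ ?K"
        by (metis power_mono power_mult_distrib wt_nonneg)
      have "D / wt b ^ (?K + M) \<le> D / wt b ^ ?K"
        using D(1) by (intro divide_left_mono power_increasing) auto
      then have "norm (\<psi> b) \<le> D / wt b ^ ?K"
        using D(2)[of b] by linarith
      then have "norm (\<psi> a) * norm (\<psi> b) \<le> D / wt a ^ (?K + M) * (D / wt b ^ ?K)"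
        using D by (intro mult_mono) auto
      also have "\<dots> = D\<^sup>2 / (wt b ^ ?K * wt a ^ ?K) * (1 / wt a ^ M)"
        by (simp add: power_add power2_eq_square)
      also have "\<dots> \<le> D\<^sup>2 / wt (pt n) ^ ?K * (1 / wt a ^ M)"
        by (intro mult_right_mono divide_left_mono ab) auto
      finally show ?thesis
        unfolding a_def[symmetric] b_def[symmetric] by (simp add: wt_minus[of "\<alpha> *\<^sub>R enum_vec i"] a_def)
    qed
    have "(\<Sum>i<j. norm (\<psi> (y - \<alpha> *\<^sub>R enum_vec i)) * norm (\<psi> (y + pt n - \<alpha> *\<^sub>R enum_vec i))) \<le>
        D\<^sup>2 / wt (pt n) ^ ?K * (\<Sum>i<j. 1 / wt (\<alpha> *\<^sub>R (enum_vec i :: real ^ 'd) - y) ^ M)"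
      unfolding sum_distrib_left by (intro sum_mono le)
    also have "\<dots> \<le> D\<^sup>2 / wt (pt n) ^ ?K * \<sigma>"
      by (intro mult_left_mono order_trans[OF sum_le_suminf[OF \<sigma>(2)] \<sigma>(3)]) auto
    also have "\<dots> = E * (1 / wt (pt n) ^ ?K)"
      by (simp add: E_def)
    also have "\<dots> \<le> E * (1 / (L * wt (enum_vec n :: real ^ 'd) ^ M))"
    proof (intro mult_left_mono divide_left_mono E)
      have e: "1 \<le> norm (enum_vec n :: real ^ 'd)"
        by (intro int_vecs_norm_ge1 n) simp
      have "L * 1 \<le> L * norm (enum_vec n :: real ^ 'd)"
        using e Lge by (intro mult_left_mono) auto
      have wtp: "wt (pt n) = 1 + L * norm (enum_vec n :: real ^ 'd)"
        using Lge(1) by (simp add: wt_def pt_def)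
      then have 1: "L \<le> wt (pt n)"
        using \<open>L * 1 \<le> L * norm (enum_vec n :: real ^ 'd)\<close> by linarith
      have "1 * norm (enum_vec n :: real ^ 'd) \<le> L * norm (enum_vec n :: real ^ 'd)"
        using Lge by (intro mult_right_mono) auto
      then have 2: "wt (enum_vec n :: real ^ 'd) \<le> wt (pt n)"
        using wtp wt_def[of "enum_vec n :: real ^ 'd"] by linarith
      have "L * wt (enum_vec n :: real ^ 'd) ^ M \<le> wt (pt n) * wt (pt n) ^ M"
        using Lge by (intro mult_mono power_mono 1 2) auto
      then show "L * wt (enum_vec n :: real ^ 'd) ^ M \<le> wt (pt n) ^ ?K"
        by simp
    qed (use Lge in auto)
    also have "\<dots> = \<kappa> n"
      by (simp add: \<kappa>_def)
    finally show ?thesis .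
  qed
  show thesis
  proof (rule that[of \<alpha> "2 * pi / L" "\<mu> * (c0 / 2)"])
    show "\<alpha> > 0" "2 * pi / L > 0" "\<mu> * (c0 / 2) > 0"
      using \<alpha> Lge \<mu>_pos c0 by auto
    show "\<mu> * (c0 / 2) * (l2_norm f)\<^sup>2 \<le> B"
      if "f \<in> schwartz" "\<And>T. finite T \<Longrightarrow> T \<subseteq> tf_lattice \<alpha> (2 * pi / L) \<Longrightarrow>
        (\<Sum>w\<in>T. (norm (l2_inner f (tf_shift w \<psi>)))\<^sup>2) \<le> B" for f B
      by (rule lattice_lower_bound[OF that(1) \<psi> c0 hit \<kappa> cross \<alpha>(1) that(2)])
  qed
qed

section \<open>Wave front sets\<close>

lemma tf_lattice_eq: "tf_lattice \<alpha> \<beta> = (\<lambda>(k, l). (\<alpha> *\<^sub>R k, \<beta> *\<^sub>R l)) ` (int_vecs \<times> int_vecs)"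
  unfolding tf_lattice_def int_vecs_def by auto

lemma countable_tf_lattice: "countable (tf_lattice \<alpha> \<beta>)"
  unfolding tf_lattice_eq by (intro countable_image countable_SIGMA countable_int_vecs)

lemma infinite_tf_lattice:
  assumes "\<alpha> > 0"
  shows "infinite (tf_lattice \<alpha> \<beta> :: ((real ^ 'd::finite) \<times> (real ^ 'd)) set)"
proof
  assume "finite (tf_lattice \<alpha> \<beta> :: ((real ^ 'd) \<times> (real ^ 'd)) set)"
  moreover have "(\<lambda>k. (\<alpha> *\<^sub>R k, 0)) ` (int_vecs :: (real ^ 'd) set) \<subseteq> tf_lattice \<alpha> \<beta>"
    unfolding tf_lattice_eq by (force intro: rev_image_eqI[where x="(_, 0)"])
  moreover have "inj_on (\<lambda>k :: real ^ 'd. (\<alpha> *\<^sub>R k, 0 :: real ^ 'd)) int_vecs"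
    using assms by (auto simp: inj_on_def)
  ultimately show False
    using infinite_int_vecs finite_subset finite_imageD by metis
qed

lemma tf_lattice_separated:
  fixes v w :: "(real ^ 'd::finite) \<times> (real ^ 'd)"
  assumes "\<alpha> > 0" "\<beta> > 0" "v \<in> tf_lattice \<alpha> \<beta>" "w \<in> tf_lattice \<alpha> \<beta>" "v \<noteq> w"
  shows "min \<alpha> \<beta> \<le> dist v w"
proof -
  have sep: "c \<le> dist (c *\<^sub>R k) (c *\<^sub>R l)" if "c > 0" "k \<in> int_vecs" "l \<in> int_vecs" "k \<noteq> l" for c and k l :: "real ^ 'd"
  proof -
    have "1 \<le> norm (k - l)"
      using that by (intro int_vecs_norm_ge1 int_vecs_diff) auto
    then have "c * 1 \<le> c * norm (k - l)"
      using that by (intro mult_left_mono) auto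
    then show ?thesis
      using that by (simp add: dist_norm flip: scaleR_diff_right)
  qed
  obtain k l where v: "k \<in> int_vecs" "l \<in> int_vecs" "v = (\<alpha> *\<^sub>R k, \<beta> *\<^sub>R l)"
    using assms(3) unfolding tf_lattice_eq by auto
  obtain k' l' where w: "k' \<in> int_vecs" "l' \<in> int_vecs" "w = (\<alpha> *\<^sub>R k', \<beta> *\<^sub>R l')"
    using assms(4) unfolding tf_lattice_eq by auto
  show ?thesis
  proof (cases "k = k'")
    case True
    then have "l \<noteq> l'"
      using assms(5) v w by auto
    then have "\<beta> \<le> dist (snd v) (snd w)"
      using sep[OF assms(2) v(2) w(2)] by (simp add: v w)
    then show ?thesis
      using dist_snd_le[of v w] by simp
  next
    case False
    then have "\<alpha> \<le> dist (fst v) (fst w)"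
      using sep[OF assms(1) v(1) w(1)] by (simp add: v w)
    then show ?thesis
      using dist_fst_le[of v w] by simp
  qed
qed

lemma tf_lattice_enumeration:
  assumes "\<alpha> > 0" "\<beta> > 0"
  shows "\<exists>p. bij_betw p (UNIV :: nat set) (tf_lattice \<alpha> \<beta> :: ((real ^ 'd::finite) \<times> (real ^ 'd)) set) \<and>
    (\<forall>m n. m \<noteq> n \<longrightarrow> min \<alpha> \<beta> \<le> dist (p m) (p n))"
proof -
  define p :: "nat \<Rightarrow> (real ^ 'd) \<times> (real ^ 'd)" where "p = from_nat_into (tf_lattice \<alpha> \<beta>)"
  have bij: "bij_betw p UNIV (tf_lattice \<alpha> \<beta>)"
    unfolding p_def by (rule bij_betw_from_nat_into[OF countable_tf_lattice infinite_tf_lattice[OF assms(1)]])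
  have "min \<alpha> \<beta> \<le> dist (p m) (p n)" if "m \<noteq> n" for m n
    using bij that by (intro tf_lattice_separated assms) (auto simp: bij_betw_def inj_def)
  then show ?thesis
    using bij by blast
qed

text \<open>Enumerating the lattice turns the sums of the frame condition into squared l2 norms of
  coefficients. Specialised to Schwartz functions, these are the inequalities of the locale.\<close>

lemma WF'_subset_WF_G_if_gabor_frame:
  fixes u :: "(real ^ 'd::finite \<Rightarrow> complex) \<Rightarrow> complex"
  assumes u: "u \<in> tempered_distributions" and \<psi>: "\<psi> \<in> schwartz" and \<phi>: "\<phi> \<in> schwartz"
    and pos: "\<alpha> > 0" "\<beta> > 0" and frame: "gabor_frame \<phi> (tf_lattice \<alpha> \<beta>)"
  shows "WF' \<psi> u \<subseteq> WF_G \<phi> (tf_lattice \<alpha> \<beta>) u"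
proof -
  have "\<exists>p. bij_betw p (UNIV :: nat set) (tf_lattice \<alpha> \<beta> :: ((real ^ 'd) \<times> (real ^ 'd)) set) \<and>
      (\<forall>m n. m \<noteq> n \<longrightarrow> min \<alpha> \<beta> \<le> dist (p m) (p n))"
    by (rule tf_lattice_enumeration[OF pos])
  then obtain p where p: "bij_betw p (UNIV :: nat set) (tf_lattice \<alpha> \<beta> :: ((real ^ 'd) \<times> (real ^ 'd)) set)"
    "\<forall>m n. m \<noteq> n \<longrightarrow> min \<alpha> \<beta> \<le> dist (p m) (p n)"
    by (elim exE conjE)
  interpret gabor_points \<phi> p "min \<alpha> \<beta>"
    using \<phi> pos p(2) by unfold_locales auto
  obtain A B where AB: "A > 0" "B > 0" and fr: "\<forall>f\<in>l2_functions.
      (\<lambda>z. (norm (l2_inner f (tf_shift z \<phi>)))\<^sup>2) summable_on tf_lattice \<alpha> \<beta> \<and>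
      A * (l2_norm f)\<^sup>2 \<le> (\<Sum>\<^sub>\<infinity>z\<in>tf_lattice \<alpha> \<beta>. (norm (l2_inner f (tf_shift z \<phi>)))\<^sup>2) \<and>
      (\<Sum>\<^sub>\<infinity>z\<in>tf_lattice \<alpha> \<beta>. (norm (l2_inner f (tf_shift z \<phi>)))\<^sup>2) \<le> B * (l2_norm f)\<^sup>2"
    using frame unfolding gabor_frame_def by (elim exE conjE)
  have eq: "(\<Sum>\<^sub>\<infinity>z\<in>tf_lattice \<alpha> \<beta>. (norm (l2_inner f (tf_shift z \<phi>)))\<^sup>2) = (ell2_norm (coef f))\<^sup>2" if f: "f \<in> schwartz" for f
  proof -
    have e: "coef f \<in> ell2"
      by (intro rapid_ell2 rapid_coef f)
    have "(\<Sum>\<^sub>\<infinity>z\<in>tf_lattice \<alpha> \<beta>. (norm (l2_inner f (tf_shift z \<phi>)))\<^sup>2) = (\<Sum>\<^sub>\<infinity>n. (norm (coef f n))\<^sup>2)"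
      unfolding coef_def by (rule infsum_reindex_bij_betw[OF p(1), symmetric])
    also have "\<dots> = (\<Sum>n. (norm (coef f n))\<^sup>2)"
      using e by (intro infsumI norm_summable_imp_has_sum) (auto simp: ell2_def summable_sums)
    finally show ?thesis
      by (simp add: ell2_norm_power2[OF e])
  qed
  interpret gabor_frame_points \<phi> p "min \<alpha> \<beta>" A B
  proof unfold_locales
    fix f :: "real ^ 'd \<Rightarrow> complex" assume f: "f \<in> schwartz"
    show "A * (l2_norm f)\<^sup>2 \<le> (ell2_norm (coef f))\<^sup>2" "(ell2_norm (coef f))\<^sup>2 \<le> B * (l2_norm f)\<^sup>2"
      using fr[rule_format, OF schwartz_l2[OF f]] by (simp_all only: eq[OF f])
  qed (use AB in auto)
  have "range p = tf_lattice \<alpha> \<beta>"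
    using p(1) by (simp add: bij_betw_def)
  then show ?thesis
    using WF'_subset_WF_G[OF u \<psi>] by simp
qed

text \<open>A fine lattice for \<psi> serves as an intermediary: the expansion in its atoms controls
  the \<phi>-transform by samples of the \<psi>-transform, and samples inherit decay from the whole
  cone.\<close>

lemma WF'_window_subset:
  fixes u :: "(real ^ 'd::finite \<Rightarrow> complex) \<Rightarrow> complex"
  assumes u: "u \<in> tempered_distributions" and \<phi>: "\<phi> \<in> schwartz"
    and \<psi>: "\<psi> \<in> schwartz" "\<psi> \<noteq> (\<lambda>_. 0)"
  shows "WF' \<phi> u \<subseteq> WF' \<psi> u"
proof -
  obtain \<alpha> \<beta> A where ab: "\<alpha> > 0" "\<beta> > 0" and A: "A > 0"
    and lower: "\<And>f B. f \<in> schwartz \<Longrightarrow>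
      (\<And>T. finite T \<Longrightarrow> T \<subseteq> tf_lattice \<alpha> \<beta> \<Longrightarrow> (\<Sum>w\<in>T. (norm (l2_inner f (tf_shift w \<psi>)))\<^sup>2) \<le> B) \<Longrightarrow>
      A * (l2_norm f)\<^sup>2 \<le> B"
    by (rule lattice_lower_bound_exists[OF \<psi>]) metis
  have "\<exists>p. bij_betw p (UNIV :: nat set) (tf_lattice \<alpha> \<beta> :: ((real ^ 'd) \<times> (real ^ 'd)) set) \<and>
      (\<forall>m n. m \<noteq> n \<longrightarrow> min \<alpha> \<beta> \<le> dist (p m) (p n))"
    by (rule tf_lattice_enumeration[OF ab])
  then obtain p where p: "bij_betw p (UNIV :: nat set) (tf_lattice \<alpha> \<beta> :: ((real ^ 'd) \<times> (real ^ 'd)) set)"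
    "\<forall>m n. m \<noteq> n \<longrightarrow> min \<alpha> \<beta> \<le> dist (p m) (p n)"
    by (elim exE conjE)
  interpret gabor_points \<psi> p "min \<alpha> \<beta>"
    using \<psi> ab p(2) by unfold_locales auto
  obtain B where B: "B > 0" "\<And>f. f \<in> schwartz \<Longrightarrow> (ell2_norm (coef f))\<^sup>2 \<le> B * (l2_norm f)\<^sup>2"
    by (rule upper_frame_bound) metis
  have low: "A * (l2_norm f)\<^sup>2 \<le> (ell2_norm (coef f))\<^sup>2" if f: "f \<in> schwartz" for f
  proof (rule lower[OF f])
    fix T :: "((real ^ 'd) \<times> (real ^ 'd)) set" assume T: "finite T" "T \<subseteq> tf_lattice \<alpha> \<beta>"
    have e: "coef f \<in> ell2"
      by (intro rapid_ell2 rapid_coef f)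
    obtain I where I: "finite I" "T = p ` I"
      using finite_subset_image[OF T(1), of p UNIV] T(2) p(1) by (auto simp: bij_betw_def)
    have "inj_on p I"
      using p(1) by (auto simp: bij_betw_def inj_on_def)
    then have "(\<Sum>w\<in>T. (norm (l2_inner f (tf_shift w \<psi>)))\<^sup>2) = (\<Sum>n\<in>I. (norm (coef f n))\<^sup>2)"
      by (simp add: I(2) sum.reindex coef_def)
    also have "\<dots> \<le> (\<Sum>n. (norm (coef f n))\<^sup>2)"
      using e by (intro sum_le_suminf I(1)) (auto simp: ell2_def)
    finally show "(\<Sum>w\<in>T. (norm (l2_inner f (tf_shift w \<psi>)))\<^sup>2) \<le> (ell2_norm (coef f))\<^sup>2"
      by (simp add: ell2_norm_power2[OF e])
  qed
  interpret gabor_frame_points \<psi> p "min \<alpha> \<beta>" A B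
    using A B low by unfold_locales auto
  show ?thesis
    using WF'_subset_WF_G[OF u assms(2)] WF_G_subset_WF' by (rule order_trans)
qed

theorem theorem3p5:
  fixes u :: "(real ^ 'd::finite \<Rightarrow> complex) \<Rightarrow> complex"
    and \<phi> \<psi> :: "real ^ 'd \<Rightarrow> complex"
    and \<alpha> \<beta> :: real
  assumes "u \<in> tempered_distributions"
    and "\<psi> \<in> schwartz" and "\<psi> \<noteq> (\<lambda>_. 0)"
    and "\<phi> \<in> schwartz" and "\<phi> \<noteq> (\<lambda>_. 0)"
    and "\<alpha> > 0" and "\<beta> > 0"
    and "gabor_frame \<phi> (tf_lattice \<alpha> \<beta>)"
  shows "WF' \<psi> u = WF_G \<phi> (tf_lattice \<alpha> \<beta>) u"
proof
  show "WF' \<psi> u \<subseteq> WF_G \<phi> (tf_lattice \<alpha> \<beta>) u"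
    by (rule WF'_subset_WF_G_if_gabor_frame[OF assms(1,2,4,6,7,8)])
  \<comment> \<open>Restriction to lattice points stays with the window \<phi>; the change of window
    then leads to \<psi>.\<close>
  show "WF_G \<phi> (tf_lattice \<alpha> \<beta>) u \<subseteq> WF' \<psi> u"
    using WF_G_subset_WF' WF'_window_subset[OF assms(1,4,2,3)] by (rule order_trans)
qed

end
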